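(* Let $E:\mathcal{U}$ and $\mathsf{List},\mathsf{nil},\mathsf{cons}$ be as in the context. For every predicate $P:\mathsf{List}\to\mathcal{U}$, $$P\,\mathsf{nil}\ \to\ \Big(\prod_{l:\mathsf{List}}\prod_{e:E} P\,l\to P(\mathsf{cons}\,e\,l)\Big)\ \to\ \prod_{l:\mathsf{List}} P\,l .$$
   Context: Type theory: intensional Martin-Löf type theory with a cumulative hierarchy of universes $\mathcal{U} : \mathcal{U}_0 : \cdots$, bottom universe $\mathcal{U}$ impredicative (if $A$ is a type in any universe and $a:A\vdash B:\mathcal{U}$ then $\prod_{a:A}B:\mathcal{U}$), universes closed under $\Sigma$ and identity types; $\pi_1,\pi_2$ projections. Axioms: function extensionality and UIP. Fix $E:\mathcal{U}$. $\mathsf{List}^* := \prod_{X:\mathcal{U}} X\to(E\to X\to X)\to X$, $\mathsf{nil}^* := \lambda X\,x\,f.\,x$, $\mathsf{cons}^*\,e\,l := \lambda X\,x\,f.\ f\,e\,(l\,X\,x\,f)$, $\mathsf{rec}^*\,X\,x\,g\,l := l\,X\,x\,g$. $\mathsf{MorphList}\,X\,x\,g\ Y\,y\,h\ f := (f\,x = y)\times \prod_{e:E} f\circ(g\,e) = (h\,e)\circ f$. $\mathsf{LimList}\,l := \prod_{X,Y:\mathcal{U}}\prod_{x:X,y:Y}\prod_{f:X\to Y}\prod_{g:E\to X\to X,h:E\to Y\to Y} \mathsf{MorphList}\,X\,x\,g\ Y\,y\,h\ f \to f(\mathsf{rec}^*\,X\,x\,g\,l) = \mathsf{rec}^*\,Y\,y\,h\,l$.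 $\mathsf{List} := \sum_{l:\mathsf{List}^*}\mathsf{LimList}\,l$. With proofs $p_0 : \mathsf{LimList}\,\mathsf{nil}^*$ and $p_c : \prod_{e,l}\mathsf{LimList}(\mathsf{cons}^*\,e\,(\pi_1 l))$ (which exist), $\mathsf{nil} := \langle \mathsf{nil}^*, p_0\rangle$ and $\mathsf{cons}\,e\,l := \langle\mathsf{cons}^*\,e\,(\pi_1 l), p_c\,e\,l\rangle$. *)

theory Defs
  imports Main
begin

section \<open>Raw terms\<close>

text \<open>
  The type theory is deeply embedded, with de Bruijn indices. Abstractions and pairs carry no type
  annotations. \<open>Univ 0\<close> is the impredicative bottom universe and \<open>Univ (Suc n)\<close> is the \<open>n\<close>-th
  universe above it. Binding structure: the second argument of \<open>Pi\<close> and \<open>Sig\<close> and the argument of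
  \<open>Lam\<close> bind one variable; the second argument of \<open>Split\<close> binds two (index 1 is the first component,
  index 0 the second); the second argument of \<open>J\<close> binds one.
\<close>

datatype tm =
    Var nat
  | Univ nat
  | Pi tm tm
  | Lam tm
  | App tm tm
  | Sig tm tm
  | Pair tm tm
  | Split tm tm
  | Id tm tm tm
  | Refl tm
  | J tm tm
  | Funext tm
  | Uip tm tm

definition scons :: "'a \<Rightarrow> (nat \<Rightarrow> 'a) \<Rightarrow> nat \<Rightarrow> 'a" (infixr "\<cdot>" 65) where
  "a \<cdot> \<sigma> = case_nat a \<sigma>"

definition upr :: "(nat \<Rightarrow> nat) \<Rightarrow> nat \<Rightarrow> nat" where
  "upr \<xi> = 0 \<cdot> (\<lambda>k. Suc (\<xi> k))"

primrec ren :: "(nat \<Rightarrow> nat) \<Rightarrow> tm \<Rightarrow> tm" where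
  "ren \<xi> (Var k) = Var (\<xi> k)"
| "ren \<xi> (Univ n) = Univ n"
| "ren \<xi> (Pi A B) = Pi (ren \<xi> A) (ren (upr \<xi>) B)"
| "ren \<xi> (Lam b) = Lam (ren (upr \<xi>) b)"
| "ren \<xi> (App f a) = App (ren \<xi> f) (ren \<xi> a)"
| "ren \<xi> (Sig A B) = Sig (ren \<xi> A) (ren (upr \<xi>) B)"
| "ren \<xi> (Pair a b) = Pair (ren \<xi> a) (ren \<xi> b)"
| "ren \<xi> (Split p d) = Split (ren \<xi> p) (ren (upr (upr \<xi>)) d)"
| "ren \<xi> (Id A a b) = Id (ren \<xi> A) (ren \<xi> a) (ren \<xi> b)"
| "ren \<xi> (Refl a) = Refl (ren \<xi> a)"
| "ren \<xi> (J p d) = J (ren \<xi> p) (ren (upr \<xi>) d)"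
| "ren \<xi> (Funext h) = Funext (ren \<xi> h)"
| "ren \<xi> (Uip p q) = Uip (ren \<xi> p) (ren \<xi> q)"

definition shift :: "nat \<Rightarrow> tm \<Rightarrow> tm" where
  "shift n = ren (\<lambda>k. k + n)"

definition up :: "(nat \<Rightarrow> tm) \<Rightarrow> nat \<Rightarrow> tm" where
  "up \<sigma> = Var 0 \<cdot> (\<lambda>k. shift 1 (\<sigma> k))"

primrec sub :: "(nat \<Rightarrow> tm) \<Rightarrow> tm \<Rightarrow> tm" where
  "sub \<sigma> (Var k) = \<sigma> k"
| "sub \<sigma> (Univ n) = Univ n"
| "sub \<sigma> (Pi A B) = Pi (sub \<sigma> A) (sub (up \<sigma>) B)"
| "sub \<sigma> (Lam b) = Lam (sub (up \<sigma>) b)"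
| "sub \<sigma> (App f a) = App (sub \<sigma> f) (sub \<sigma> a)"
| "sub \<sigma> (Sig A B) = Sig (sub \<sigma> A) (sub (up \<sigma>) B)"
| "sub \<sigma> (Pair a b) = Pair (sub \<sigma> a) (sub \<sigma> b)"
| "sub \<sigma> (Split p d) = Split (sub \<sigma> p) (sub (up (up \<sigma>)) d)"
| "sub \<sigma> (Id A a b) = Id (sub \<sigma> A) (sub \<sigma> a) (sub \<sigma> b)"
| "sub \<sigma> (Refl a) = Refl (sub \<sigma> a)"
| "sub \<sigma> (J p d) = J (sub \<sigma> p) (sub (up \<sigma>) d)"
| "sub \<sigma> (Funext h) = Funext (sub \<sigma> h)"
| "sub \<sigma> (Uip p q) = Uip (sub \<sigma> p) (sub \<sigma> q)"

abbreviation inst :: "tm \<Rightarrow> tm \<Rightarrow> tm" where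
  "inst t a \<equiv> sub (a \<cdot> Var) t"

text \<open>Non-dependent function and product types, and composition.\<close>

definition arr :: "tm \<Rightarrow> tm \<Rightarrow> tm" where
  "arr A B = Pi A (shift 1 B)"

definition prodT :: "tm \<Rightarrow> tm \<Rightarrow> tm" where
  "prodT A B = Sig A (shift 1 B)"

definition compT :: "tm \<Rightarrow> tm \<Rightarrow> tm" where
  "compT f g = Lam (App (shift 1 f) (App (shift 1 g) (Var 0)))"

text \<open>The projections, in terms of the dependent eliminator of \<open>Sig\<close>.\<close>

definition pi1 :: "tm \<Rightarrow> tm" where
  "pi1 p = Split p (Var 1)"

definition pi2 :: "tm \<Rightarrow> tm" where
  "pi2 p = Split p (Var 0)"

section \<open>Judgements\<close>

text \<open>
  The judgements are: well-formed context, typing, and judgemental equality at a type. Contexts are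
  lists with the most recent declaration first. Universes are a la Russell, so that \<open>A\<close> is a type
  in \<open>\<Gamma>\<close> iff \<open>\<Gamma> \<turnstile> A \<Colon> Univ n\<close> for some \<open>n\<close>. The rules are those of Martin-Loef's intensional theory
  for \<open>\<Pi>\<close>, \<open>\<Sigma>\<close> (dependent eliminator \<open>Split\<close>) and identity types (eliminator \<open>J\<close>), each with its
  computation rule and the congruence rules. No judgemental uniqueness (eta) rule is
  assumed for \<open>\<Pi>\<close> or \<open>\<Sigma>\<close>, so every derivation remains valid in a theory that has them.
  \<open>Funext\<close> and \<open>Uip\<close> are the two axioms: they have no computation rules.
\<close>

inductive
  ctx :: "tm list \<Rightarrow> bool" and
  has_type :: "tm list \<Rightarrow> tm \<Rightarrow> tm \<Rightarrow> bool" ("_ \<turnstile> _ \<Colon> _" [50, 50, 50] 50) and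
  jeq :: "tm list \<Rightarrow> tm \<Rightarrow> tm \<Rightarrow> tm \<Rightarrow> bool" ("_ \<turnstile> _ \<simeq> _ \<Colon> _" [50, 51, 51, 50] 50)
where
  ctx_Nil: "ctx []"
| ctx_Cons: "\<lbrakk>ctx \<Gamma>; \<Gamma> \<turnstile> A \<Colon> Univ n\<rbrakk> \<Longrightarrow> ctx (A # \<Gamma>)"

| t_Var: "\<lbrakk>ctx \<Gamma>; k < length \<Gamma>\<rbrakk> \<Longrightarrow> \<Gamma> \<turnstile> Var k \<Colon> shift (Suc k) (\<Gamma> ! k)"
| t_Conv: "\<lbrakk>\<Gamma> \<turnstile> a \<Colon> A; \<Gamma> \<turnstile> A \<simeq> B \<Colon> Univ n\<rbrakk> \<Longrightarrow> \<Gamma> \<turnstile> a \<Colon> B"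

| t_Univ: "ctx \<Gamma> \<Longrightarrow> \<Gamma> \<turnstile> Univ n \<Colon> Univ (Suc n)"
| t_Cumul: "\<Gamma> \<turnstile> A \<Colon> Univ n \<Longrightarrow> \<Gamma> \<turnstile> A \<Colon> Univ (Suc n)"

| t_Pi: "\<lbrakk>\<Gamma> \<turnstile> A \<Colon> Univ n; A # \<Gamma> \<turnstile> B \<Colon> Univ n\<rbrakk> \<Longrightarrow> \<Gamma> \<turnstile> Pi A B \<Colon> Univ n"
| t_Pi_impred: "\<lbrakk>\<Gamma> \<turnstile> A \<Colon> Univ n; A # \<Gamma> \<turnstile> B \<Colon> Univ 0\<rbrakk> \<Longrightarrow> \<Gamma> \<turnstile> Pi A B \<Colon> Univ 0"
| t_Lam: "\<lbrakk>\<Gamma> \<turnstile> A \<Colon> Univ n; A # \<Gamma> \<turnstile> b \<Colon> B\<rbrakk> \<Longrightarrow> \<Gamma> \<turnstile> Lam b \<Colon> Pi A B"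
| t_App: "\<lbrakk>\<Gamma> \<turnstile> f \<Colon> Pi A B; \<Gamma> \<turnstile> a \<Colon> A\<rbrakk> \<Longrightarrow> \<Gamma> \<turnstile> App f a \<Colon> inst B a"

| t_Sig: "\<lbrakk>\<Gamma> \<turnstile> A \<Colon> Univ n; A # \<Gamma> \<turnstile> B \<Colon> Univ n\<rbrakk> \<Longrightarrow> \<Gamma> \<turnstile> Sig A B \<Colon> Univ n"
| t_Pair: "\<lbrakk>\<Gamma> \<turnstile> A \<Colon> Univ n; A # \<Gamma> \<turnstile> B \<Colon> Univ m; \<Gamma> \<turnstile> a \<Colon> A; \<Gamma> \<turnstile> b \<Colon> inst B a\<rbrakk>
    \<Longrightarrow> \<Gamma> \<turnstile> Pair a b \<Colon> Sig A B"
| t_Split: "\<lbrakk>\<Gamma> \<turnstile> A \<Colon> Univ n; A # \<Gamma> \<turnstile> B \<Colon> Univ m; Sig A B # \<Gamma> \<turnstile> C \<Colon> Univ i; \<Gamma> \<turnstile> p \<Colon> Sig A B;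
      B # A # \<Gamma> \<turnstile> d \<Colon> sub (Pair (Var 1) (Var 0) \<cdot> (\<lambda>k. Var (k + 2))) C\<rbrakk>
    \<Longrightarrow> \<Gamma> \<turnstile> Split p d \<Colon> inst C p"

| t_Id: "\<lbrakk>\<Gamma> \<turnstile> A \<Colon> Univ n; \<Gamma> \<turnstile> a \<Colon> A; \<Gamma> \<turnstile> b \<Colon> A\<rbrakk> \<Longrightarrow> \<Gamma> \<turnstile> Id A a b \<Colon> Univ n"
| t_Refl: "\<Gamma> \<turnstile> a \<Colon> A \<Longrightarrow> \<Gamma> \<turnstile> Refl a \<Colon> Id A a a"
| t_J: "\<lbrakk>\<Gamma> \<turnstile> A \<Colon> Univ n; Id (shift 2 A) (Var 1) (Var 0) # shift 1 A # A # \<Gamma> \<turnstile> C \<Colon> Univ m;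
      A # \<Gamma> \<turnstile> d \<Colon> sub (Refl (Var 0) \<cdot> Var 0 \<cdot> Var 0 \<cdot> (\<lambda>k. Var (k + 1))) C;
      \<Gamma> \<turnstile> a \<Colon> A; \<Gamma> \<turnstile> b \<Colon> A; \<Gamma> \<turnstile> p \<Colon> Id A a b\<rbrakk>
    \<Longrightarrow> \<Gamma> \<turnstile> J p d \<Colon> sub (p \<cdot> b \<cdot> a \<cdot> Var) C"

| t_Funext: "\<lbrakk>\<Gamma> \<turnstile> A \<Colon> Univ n; A # \<Gamma> \<turnstile> B \<Colon> Univ m; \<Gamma> \<turnstile> f \<Colon> Pi A B; \<Gamma> \<turnstile> g \<Colon> Pi A B;
      \<Gamma> \<turnstile> h \<Colon> Pi A (Id B (App (shift 1 f) (Var 0)) (App (shift 1 g) (Var 0)))\<rbrakk>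
    \<Longrightarrow> \<Gamma> \<turnstile> Funext h \<Colon> Id (Pi A B) f g"
| t_Uip: "\<lbrakk>\<Gamma> \<turnstile> A \<Colon> Univ n; \<Gamma> \<turnstile> a \<Colon> A; \<Gamma> \<turnstile> b \<Colon> A; \<Gamma> \<turnstile> p \<Colon> Id A a b; \<Gamma> \<turnstile> q \<Colon> Id A a b\<rbrakk>
    \<Longrightarrow> \<Gamma> \<turnstile> Uip p q \<Colon> Id (Id A a b) p q"

| e_refl: "\<Gamma> \<turnstile> a \<Colon> A \<Longrightarrow> \<Gamma> \<turnstile> a \<simeq> a \<Colon> A"
| e_sym: "\<Gamma> \<turnstile> a \<simeq> b \<Colon> A \<Longrightarrow> \<Gamma> \<turnstile> b \<simeq> a \<Colon> A"
| e_trans: "\<lbrakk>\<Gamma> \<turnstile> a \<simeq> b \<Colon> A; \<Gamma> \<turnstile> b \<simeq> c \<Colon> A\<rbrakk> \<Longrightarrow> \<Gamma> \<turnstile> a \<simeq> c \<Colon> A"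
| e_Conv: "\<lbrakk>\<Gamma> \<turnstile> a \<simeq> b \<Colon> A; \<Gamma> \<turnstile> A \<simeq> B \<Colon> Univ n\<rbrakk> \<Longrightarrow> \<Gamma> \<turnstile> a \<simeq> b \<Colon> B"
| e_Cumul: "\<Gamma> \<turnstile> A \<simeq> B \<Colon> Univ n \<Longrightarrow> \<Gamma> \<turnstile> A \<simeq> B \<Colon> Univ (Suc n)"

| e_Pi: "\<lbrakk>\<Gamma> \<turnstile> A \<Colon> Univ n; \<Gamma> \<turnstile> A \<simeq> A' \<Colon> Univ n; A # \<Gamma> \<turnstile> B \<simeq> B' \<Colon> Univ n\<rbrakk>
    \<Longrightarrow> \<Gamma> \<turnstile> Pi A B \<simeq> Pi A' B' \<Colon> Univ n"
| e_Pi_impred: "\<lbrakk>\<Gamma> \<turnstile> A \<Colon> Univ n; \<Gamma> \<turnstile> A \<simeq> A' \<Colon> Univ n; A # \<Gamma> \<turnstile> B \<simeq> B' \<Colon> Univ 0\<rbrakk>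
    \<Longrightarrow> \<Gamma> \<turnstile> Pi A B \<simeq> Pi A' B' \<Colon> Univ 0"
| e_Lam: "\<lbrakk>\<Gamma> \<turnstile> A \<Colon> Univ n; A # \<Gamma> \<turnstile> b \<simeq> b' \<Colon> B\<rbrakk> \<Longrightarrow> \<Gamma> \<turnstile> Lam b \<simeq> Lam b' \<Colon> Pi A B"
| e_App: "\<lbrakk>\<Gamma> \<turnstile> f \<simeq> f' \<Colon> Pi A B; \<Gamma> \<turnstile> a \<simeq> a' \<Colon> A\<rbrakk> \<Longrightarrow> \<Gamma> \<turnstile> App f a \<simeq> App f' a' \<Colon> inst B a"
| e_beta: "\<lbrakk>\<Gamma> \<turnstile> A \<Colon> Univ n; A # \<Gamma> \<turnstile> b \<Colon> B; \<Gamma> \<turnstile> a \<Colon> A\<rbrakk>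
    \<Longrightarrow> \<Gamma> \<turnstile> App (Lam b) a \<simeq> inst b a \<Colon> inst B a"

| e_Sig: "\<lbrakk>\<Gamma> \<turnstile> A \<Colon> Univ n; \<Gamma> \<turnstile> A \<simeq> A' \<Colon> Univ n; A # \<Gamma> \<turnstile> B \<simeq> B' \<Colon> Univ n\<rbrakk>
    \<Longrightarrow> \<Gamma> \<turnstile> Sig A B \<simeq> Sig A' B' \<Colon> Univ n"
| e_Pair: "\<lbrakk>\<Gamma> \<turnstile> A \<Colon> Univ n; A # \<Gamma> \<turnstile> B \<Colon> Univ m; \<Gamma> \<turnstile> a \<simeq> a' \<Colon> A; \<Gamma> \<turnstile> b \<simeq> b' \<Colon> inst B a\<rbrakk>
    \<Longrightarrow> \<Gamma> \<turnstile> Pair a b \<simeq> Pair a' b' \<Colon> Sig A B"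
| e_Split: "\<lbrakk>\<Gamma> \<turnstile> A \<Colon> Univ n; A # \<Gamma> \<turnstile> B \<Colon> Univ m; Sig A B # \<Gamma> \<turnstile> C \<Colon> Univ i;
      \<Gamma> \<turnstile> p \<simeq> p' \<Colon> Sig A B;
      B # A # \<Gamma> \<turnstile> d \<simeq> d' \<Colon> sub (Pair (Var 1) (Var 0) \<cdot> (\<lambda>k. Var (k + 2))) C\<rbrakk>
    \<Longrightarrow> \<Gamma> \<turnstile> Split p d \<simeq> Split p' d' \<Colon> inst C p"
| e_Split_beta: "\<lbrakk>\<Gamma> \<turnstile> A \<Colon> Univ n; A # \<Gamma> \<turnstile> B \<Colon> Univ m; Sig A B # \<Gamma> \<turnstile> C \<Colon> Univ i;
      \<Gamma> \<turnstile> a \<Colon> A; \<Gamma> \<turnstile> b \<Colon> inst B a;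
      B # A # \<Gamma> \<turnstile> d \<Colon> sub (Pair (Var 1) (Var 0) \<cdot> (\<lambda>k. Var (k + 2))) C\<rbrakk>
    \<Longrightarrow> \<Gamma> \<turnstile> Split (Pair a b) d \<simeq> sub (b \<cdot> a \<cdot> Var) d \<Colon> inst C (Pair a b)"

| e_Id: "\<lbrakk>\<Gamma> \<turnstile> A \<simeq> A' \<Colon> Univ n; \<Gamma> \<turnstile> a \<simeq> a' \<Colon> A; \<Gamma> \<turnstile> b \<simeq> b' \<Colon> A\<rbrakk>
    \<Longrightarrow> \<Gamma> \<turnstile> Id A a b \<simeq> Id A' a' b' \<Colon> Univ n"
| e_Refl: "\<Gamma> \<turnstile> a \<simeq> a' \<Colon> A \<Longrightarrow> \<Gamma> \<turnstile> Refl a \<simeq> Refl a' \<Colon> Id A a a"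
| e_J: "\<lbrakk>\<Gamma> \<turnstile> A \<Colon> Univ n; Id (shift 2 A) (Var 1) (Var 0) # shift 1 A # A # \<Gamma> \<turnstile> C \<Colon> Univ m;
      A # \<Gamma> \<turnstile> d \<simeq> d' \<Colon> sub (Refl (Var 0) \<cdot> Var 0 \<cdot> Var 0 \<cdot> (\<lambda>k. Var (k + 1))) C;
      \<Gamma> \<turnstile> a \<Colon> A; \<Gamma> \<turnstile> b \<Colon> A; \<Gamma> \<turnstile> p \<simeq> p' \<Colon> Id A a b\<rbrakk>
    \<Longrightarrow> \<Gamma> \<turnstile> J p d \<simeq> J p' d' \<Colon> sub (p \<cdot> b \<cdot> a \<cdot> Var) C"
| e_J_beta: "\<lbrakk>\<Gamma> \<turnstile> A \<Colon> Univ n; Id (shift 2 A) (Var 1) (Var 0) # shift 1 A # A # \<Gamma> \<turnstile> C \<Colon> Univ m;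
      A # \<Gamma> \<turnstile> d \<Colon> sub (Refl (Var 0) \<cdot> Var 0 \<cdot> Var 0 \<cdot> (\<lambda>k. Var (k + 1))) C; \<Gamma> \<turnstile> a \<Colon> A\<rbrakk>
    \<Longrightarrow> \<Gamma> \<turnstile> J (Refl a) d \<simeq> inst d a \<Colon> sub (Refl a \<cdot> a \<cdot> a \<cdot> Var) C"

| e_Funext: "\<lbrakk>\<Gamma> \<turnstile> A \<Colon> Univ n; A # \<Gamma> \<turnstile> B \<Colon> Univ m; \<Gamma> \<turnstile> f \<Colon> Pi A B; \<Gamma> \<turnstile> g \<Colon> Pi A B;
      \<Gamma> \<turnstile> h \<simeq> h' \<Colon> Pi A (Id B (App (shift 1 f) (Var 0)) (App (shift 1 g) (Var 0)))\<rbrakk>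
    \<Longrightarrow> \<Gamma> \<turnstile> Funext h \<simeq> Funext h' \<Colon> Id (Pi A B) f g"
| e_Uip: "\<lbrakk>\<Gamma> \<turnstile> A \<Colon> Univ n; \<Gamma> \<turnstile> a \<Colon> A; \<Gamma> \<turnstile> b \<Colon> A; \<Gamma> \<turnstile> p \<simeq> p' \<Colon> Id A a b; \<Gamma> \<turnstile> q \<simeq> q' \<Colon> Id A a b\<rbrakk>
    \<Longrightarrow> \<Gamma> \<turnstile> Uip p q \<simeq> Uip p' q' \<Colon> Id (Id A a b) p q"

section \<open>The impredicative encoding of lists\<close>

text \<open>
  Every definition below is a function on terms: all arguments live in the context in which the
  result is formed, and \<open>shift n\<close> moves them under \<open>n\<close> binders.
\<close>

abbreviation U :: tm where
  "U \<equiv> Univ 0"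

text \<open>\<open>\<Pi> X : U. X \<rightarrow> (E \<rightarrow> X \<rightarrow> X) \<rightarrow> X\<close>\<close>
definition ListStar :: "tm \<Rightarrow> tm" where
  "ListStar E = Pi U (arr (Var 0) (arr (arr (shift 1 E) (arr (Var 0) (Var 0))) (Var 0)))"

text \<open>\<open>\<lambda> X x f. x\<close>\<close>
definition nilStar :: tm where
  "nilStar = Lam (Lam (Lam (Var 1)))"

text \<open>\<open>\<lambda> X x f. f e (l X x f)\<close>\<close>
definition consStar :: "tm \<Rightarrow> tm \<Rightarrow> tm" where
  "consStar e l = Lam (Lam (Lam
     (App (App (Var 0) (shift 3 e)) (App (App (App (shift 3 l) (Var 2)) (Var 1)) (Var 0)))))"

definition recStar :: "tm \<Rightarrow> tm \<Rightarrow> tm \<Rightarrow> tm \<Rightarrow> tm" where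
  "recStar X x g l = App (App (App l X) x) g"

text \<open>\<open>(f x = y) \<times> (\<Pi> e : E. f \<circ> g e = h e \<circ> f)\<close>\<close>
definition MorphList :: "tm \<Rightarrow> tm \<Rightarrow> tm \<Rightarrow> tm \<Rightarrow> tm \<Rightarrow> tm \<Rightarrow> tm \<Rightarrow> tm \<Rightarrow> tm" where
  "MorphList E X x g Y y h f =
     prodT (Id Y (App f x) y)
       (Pi E (Id (shift 1 (arr X Y))
         (compT (shift 1 f) (App (shift 1 g) (Var 0)))
         (compT (App (shift 1 h) (Var 0)) (shift 1 f))))"

text \<open>
  The seven leading binders are \<open>X Y x y f g h\<close>, so in the body they are the indices
  \<open>6 5 4 3 2 1 0\<close>.
\<close>
definition LimList :: "tm \<Rightarrow> tm \<Rightarrow> tm" where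
  "LimList E l =
     Pi U (Pi U (Pi (Var 1) (Pi (Var 1) (Pi (arr (Var 3) (Var 2))
       (Pi (arr (shift 5 E) (arr (Var 4) (Var 4))) (Pi (arr (shift 6 E) (arr (Var 4) (Var 4)))
         (arr (MorphList (shift 7 E) (Var 6) (Var 4) (Var 1) (Var 5) (Var 3) (Var 0) (Var 2))
           (Id (Var 5)
             (App (Var 2) (recStar (Var 6) (Var 4) (Var 1) (shift 7 l)))
             (recStar (Var 5) (Var 3) (Var 0) (shift 7 l))))))))))"

definition ListT :: "tm \<Rightarrow> tm" where
  "ListT E = Sig (ListStar E) (LimList (shift 1 E) (Var 0))"

text \<open>
  The types of the proofs \<open>p0\<close> and \<open>pc\<close> from which \<open>nil\<close> and \<open>cons\<close> are built. Both types are
  inhabited (\<open>NilLimT_inhabited\<close>, \<open>ConsLimT_inhabited\<close> below); \<open>nilT\<close> and \<open>consT\<close> take the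
  chosen proofs as arguments, so that results can be stated for arbitrary ones.
\<close>

definition NilLimT :: "tm \<Rightarrow> tm" where
  "NilLimT E = LimList E nilStar"

text \<open>\<open>\<Pi> e : E. \<Pi> l : List. LimList (cons* e (\<pi>\<^sub>1 l))\<close>\<close>
definition ConsLimT :: "tm \<Rightarrow> tm" where
  "ConsLimT E = Pi E (Pi (shift 1 (ListT E))
     (LimList (shift 2 E) (consStar (Var 1) (pi1 (Var 0)))))"

definition nilT :: "tm \<Rightarrow> tm" where
  "nilT p0 = Pair nilStar p0"

definition consT :: "tm \<Rightarrow> tm \<Rightarrow> tm \<Rightarrow> tm" where
  "consT pc e l = Pair (consStar e (pi1 l)) (App (App pc e) l)"

text \<open>
  \<open>P nil \<rightarrow> (\<Pi> l : List. \<Pi> e : E. P l \<rightarrow> P (cons e l)) \<rightarrow> \<Pi> l : List. P l\<close>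
\<close>
definition ListIndT :: "tm \<Rightarrow> tm \<Rightarrow> tm \<Rightarrow> tm \<Rightarrow> tm" where
  "ListIndT E p0 pc P =
     arr (App P (nilT p0))
       (arr (Pi (ListT E) (Pi (shift 1 E)
              (arr (App (shift 2 P) (Var 1))
                   (App (shift 2 P) (consT (shift 2 pc) (Var 0) (Var 1))))))
         (Pi (ListT E) (App (shift 1 P) (Var 0))))"

section \<open>Renaming and substitution calculus\<close>

text \<open>The rest of this theory shows that the types \<open>NilLimT E\<close> and \<open>ConsLimT E\<close> are inhabited.\<close>

lemma scons_simps [simp]:
  "(a \<cdot> \<sigma>) 0 = a" "(a \<cdot> \<sigma>) (Suc k) = \<sigma> k" "(a \<cdot> \<sigma>) (numeral n) = \<sigma> (pred_numeral n)"
  "(a \<cdot> \<sigma>) 1 = \<sigma> 0"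
  by (simp_all add: scons_def)

lemma upr_simps [simp]:
  "upr \<xi> 0 = 0" "upr \<xi> (Suc k) = Suc (\<xi> k)" "upr \<xi> (numeral n) = Suc (\<xi> (pred_numeral n))"
  "upr \<xi> 1 = Suc (\<xi> 0)"
  by (simp_all add: upr_def)

lemma up_simps [simp]:
  "up \<sigma> 0 = Var 0" "up \<sigma> (Suc k) = shift 1 (\<sigma> k)"
  "up \<sigma> (numeral n) = shift 1 (\<sigma> (pred_numeral n))" "up \<sigma> 1 = shift 1 (\<sigma> 0)"
  by (simp_all add: up_def)

lemma upr_comp: "upr \<xi> \<circ> upr \<zeta> = upr (\<xi> \<circ> \<zeta>)"
  by (rule ext, case_tac x) auto

lemma ren_ren: "ren \<xi> (ren \<zeta> t) = ren (\<xi> \<circ> \<zeta>) t"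
  by (induction t arbitrary: \<xi> \<zeta>) (simp_all add: upr_comp)

lemma up_upr: "up \<sigma> \<circ> upr \<xi> = up (\<sigma> \<circ> \<xi>)"
  by (rule ext, case_tac x) auto

lemma sub_ren: "sub \<sigma> (ren \<xi> t) = sub (\<sigma> \<circ> \<xi>) t"
  by (induction t arbitrary: \<sigma> \<xi>) (simp_all add: up_upr)

lemma ren_shift1: "ren (upr \<xi>) (shift (Suc n) t) = shift 1 (ren \<xi> (shift n t))"
  by (simp add: shift_def ren_ren comp_def)

lemma up_ren: "up (ren \<xi> \<circ> \<sigma>) = ren (upr \<xi>) \<circ> up \<sigma>"
  by (rule ext, case_tac x) (auto simp: shift_def ren_ren comp_def)

lemma ren_sub: "ren \<xi> (sub \<sigma> t) = sub (ren \<xi> \<circ> \<sigma>) t"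
  by (induction t arbitrary: \<sigma> \<xi>) (simp_all add: up_ren)

lemma up_Var: "up Var = Var"
proof
  fix k show "up Var k = Var k" by (cases k) (auto simp: shift_def)
qed

lemma sub_Var: "sub Var t = t"
  by (induction t) (simp_all add: up_Var)

lemma shift_0 [simp]: "shift 0 t = t"
proof -
  have "upr (\<lambda>k. k) = (\<lambda>k. k)" by (auto simp: fun_eq_iff upr_def scons_def split: nat.split)
  then have "ren (\<lambda>k. k) t = t" by (induction t) simp_all
  then show ?thesis by (simp add: shift_def)
qed

lemma sub_scons: "sub (a \<cdot> \<sigma>) (shift (Suc n) t) = sub \<sigma> (shift n t)"
  by (simp add: shift_def sub_ren comp_def)

lemma sub_up: "sub (up \<sigma>) (shift (Suc n) t) = shift 1 (sub \<sigma> (shift n t))"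
  by (simp add: shift_def sub_ren ren_sub comp_def)

lemma shift_shift [simp]: "shift m (shift n t) = shift (n + m) t"
  by (simp add: shift_def ren_ren comp_def add.assoc)

lemma shift_Var [simp]: "shift n (Var k) = Var (k + n)" by (simp add: shift_def)
lemma shift_Univ [simp]: "shift n (Univ k) = Univ k" by (simp add: shift_def)

text \<open>\<open>rn \<Gamma> \<xi> \<Delta>\<close>: the renaming \<open>\<xi>\<close> maps the variables of \<open>\<Gamma>\<close> to variables of \<open>\<Delta>\<close> of the renamed type.\<close>
definition rn :: "tm list \<Rightarrow> (nat \<Rightarrow> nat) \<Rightarrow> tm list \<Rightarrow> bool" where
  "rn \<Gamma> \<xi> \<Delta> \<longleftrightarrow> (\<forall>k<length \<Gamma>. \<xi> k < length \<Delta> \<and>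
     shift (Suc (\<xi> k)) (\<Delta> ! \<xi> k) = ren \<xi> (shift (Suc k) (\<Gamma> ! k)))"

lemma rn_up: "rn \<Gamma> \<xi> \<Delta> \<Longrightarrow> rn (A # \<Gamma>) (upr \<xi>) (ren \<xi> A # \<Delta>)"
  unfolding rn_def
proof (intro allI impI)
  fix k assume a: "\<forall>k<length \<Gamma>. \<xi> k < length \<Delta> \<and>
     shift (Suc (\<xi> k)) (\<Delta> ! \<xi> k) = ren \<xi> (shift (Suc k) (\<Gamma> ! k))" and k: "k < length (A # \<Gamma>)"
  show "upr \<xi> k < length (ren \<xi> A # \<Delta>) \<and>
     shift (Suc (upr \<xi> k)) ((ren \<xi> A # \<Delta>) ! upr \<xi> k) = ren (upr \<xi>) (shift (Suc k) ((A # \<Gamma>) ! k))"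
  proof (cases k)
    case 0
    then show ?thesis using ren_shift1[of \<xi> 0] by simp
  next
    case (Suc j)
    then have j: "\<xi> j < length \<Delta>" "shift (Suc (\<xi> j)) (\<Delta> ! \<xi> j) = ren \<xi> (shift (Suc j) (\<Gamma> ! j))"
      using a k by auto
    have "shift (Suc (Suc (\<xi> j))) (\<Delta> ! \<xi> j) = shift 1 (ren \<xi> (shift (Suc j) (\<Gamma> ! j)))"
      using arg_cong[OF j(2), of "shift 1"] by simp
    then show ?thesis using Suc j(1) ren_shift1[of \<xi> "Suc j"] by simp
  qed
qed

lemma ren_inst: "ren \<xi> (sub (a \<cdot> Var) B) = sub (ren \<xi> a \<cdot> Var) (ren (upr \<xi>) B)"
  unfolding ren_sub sub_ren
  by (rule arg_cong[where f = "\<lambda>\<sigma>. sub \<sigma> B"], rule ext, case_tac x) auto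

lemma ren_inst2: "ren \<xi> (sub (b \<cdot> a \<cdot> Var) B) = sub (ren \<xi> b \<cdot> ren \<xi> a \<cdot> Var) (ren (upr (upr \<xi>)) B)"
  unfolding ren_sub sub_ren
  apply (rule arg_cong[where f = "\<lambda>\<sigma>. sub \<sigma> B"], rule ext)
  subgoal for x by (cases x; cases "x - 1") auto
  done

lemma ren_inst3: "ren \<xi> (sub (c \<cdot> b \<cdot> a \<cdot> Var) B) =
    sub (ren \<xi> c \<cdot> ren \<xi> b \<cdot> ren \<xi> a \<cdot> Var) (ren (upr (upr (upr \<xi>))) B)"
  unfolding ren_sub sub_ren
  apply (rule arg_cong[where f = "\<lambda>\<sigma>. sub \<sigma> B"], rule ext)
  subgoal for x by (cases x; cases "x - 1"; cases "x - 2") auto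
  done

lemma ren_pair: "ren (upr (upr \<xi>)) (sub (Pair (Var 1) (Var 0) \<cdot> (\<lambda>k. Var (k + 2))) C) =
    sub (Pair (Var 1) (Var 0) \<cdot> (\<lambda>k. Var (k + 2))) (ren (upr \<xi>) C)"
  unfolding ren_sub sub_ren
  by (rule arg_cong[where f = "\<lambda>\<sigma>. sub \<sigma> C"], rule ext, case_tac x) auto

lemma ren_J: "ren (upr \<xi>) (sub (Refl (Var 0) \<cdot> Var 0 \<cdot> Var 0 \<cdot> (\<lambda>k. Var (k + 1))) C) =
    sub (Refl (Var 0) \<cdot> Var 0 \<cdot> Var 0 \<cdot> (\<lambda>k. Var (k + 1))) (ren (upr (upr (upr \<xi>))) C)"
  unfolding ren_sub sub_ren
  apply (rule arg_cong[where f = "\<lambda>\<sigma>. sub \<sigma> C"], rule ext)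
  subgoal for x by (cases x; cases "x - 1"; cases "x - 2") auto
  done

lemma ren_sh1: "ren (upr \<xi>) (shift 1 t) = shift 1 (ren \<xi> t)"
  using ren_shift1[of \<xi> 0 t] by simp
lemma ren_sh2: "ren (upr (upr \<xi>)) (shift 2 t) = shift 2 (ren \<xi> t)"
  by (simp add: shift_def ren_ren comp_def)


lemma t_Cumul_le: "n \<le> m \<Longrightarrow> \<Gamma> \<turnstile> A \<Colon> Univ n \<Longrightarrow> \<Gamma> \<turnstile> A \<Colon> Univ m"
  by (induction m rule: dec_induct) (auto intro: t_Cumul)

lemma t_Sig_max: "\<Gamma> \<turnstile> A \<Colon> Univ n \<Longrightarrow> A # \<Gamma> \<turnstile> B \<Colon> Univ m \<Longrightarrow> \<Gamma> \<turnstile> Sig A B \<Colon> Univ (max n m)"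
  by (rule t_Sig) (auto intro: t_Cumul_le[rotated])

lemma t_Var_eq: "\<lbrakk>ctx \<Gamma>; k < length \<Gamma>; A = shift (Suc k) (\<Gamma> ! k)\<rbrakk> \<Longrightarrow> \<Gamma> \<turnstile> Var k \<Colon> A"
  using t_Var by simp

lemma rn_Suc: "rn \<Gamma> \<xi> \<Delta> \<Longrightarrow> rn \<Gamma> (\<lambda>k. Suc (\<xi> k)) (A # \<Delta>)"
proof -
  assume a: "rn \<Gamma> \<xi> \<Delta>"
  { fix k assume "k < length \<Gamma>"
    then have "shift 1 (shift (Suc (\<xi> k)) (\<Delta> ! \<xi> k)) = shift 1 (ren \<xi> (shift (Suc k) (\<Gamma> ! k)))"
      using a by (auto simp: rn_def)
    then have "shift (Suc (Suc (\<xi> k))) (\<Delta> ! \<xi> k) = ren (\<lambda>k. Suc (\<xi> k)) (shift (Suc k) (\<Gamma> ! k))"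
      by (simp add: shift_def ren_ren comp_def) }
  then show ?thesis using a by (auto simp: rn_def)
qed

lemma ren_Suc_shift: "ren (\<lambda>k. Suc (\<xi> k)) A = shift 1 (ren \<xi> A)"
  by (simp add: shift_def ren_ren comp_def)

lemma ctx_J:
  assumes "ctx \<Delta>" "\<Delta> \<turnstile> A \<Colon> Univ n" "A # \<Delta> \<turnstile> shift 1 A \<Colon> Univ n" 
    "shift 1 A # A # \<Delta> \<turnstile> shift 2 A \<Colon> Univ n"
  shows "ctx (Id (shift 2 A) (Var 1) (Var 0) # shift 1 A # A # \<Delta>)"
proof -
  have c: "ctx (shift 1 A # A # \<Delta>)" using assms by (auto intro: ctx_Cons)
  show ?thesis
    by (rule ctx_Cons[OF c], rule t_Id[OF assms(4)])
      (auto intro!: t_Var_eq c[simplified] simp: numeral_2_eq_2)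
qed

lemma renaming:
  "ctx \<Gamma> \<Longrightarrow> True"
  "\<Gamma> \<turnstile> a \<Colon> A \<Longrightarrow> (\<And>\<xi> \<Delta>. ctx \<Delta> \<Longrightarrow> rn \<Gamma> \<xi> \<Delta> \<Longrightarrow> \<Delta> \<turnstile> ren \<xi> a \<Colon> ren \<xi> A)"
  "\<Gamma> \<turnstile> a \<simeq> b \<Colon> A \<Longrightarrow> (\<And>\<xi> \<Delta>. ctx \<Delta> \<Longrightarrow> rn \<Gamma> \<xi> \<Delta> \<Longrightarrow> \<Delta> \<turnstile> ren \<xi> a \<simeq> ren \<xi> b \<Colon> ren \<xi> A)"
proof (induction rule: ctx_has_type_jeq.inducts)
  case (t_Var \<Gamma> k)
  then have "\<xi> k < length \<Delta>" "shift (Suc (\<xi> k)) (\<Delta> ! \<xi> k) = ren \<xi> (shift (Suc k) (\<Gamma> ! k))"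
    by (auto simp: rn_def)
  with ctx_has_type_jeq.t_Var[OF t_Var.prems(1), of "\<xi> k"] show ?case by simp
next
  case (t_Conv \<Gamma> a A B n)
  then show ?case using ctx_has_type_jeq.t_Conv by fastforce
next
  case (t_Split \<Gamma> A n B m C i p d)
  note P = t_Split.prems
  note A = t_Split.IH(1)[OF P, simplified]
  note cA = ctx_Cons[OF P(1) A]
  note B = t_Split.IH(2)[OF cA rn_up[OF P(2)], simplified]
  note cS = ctx_Cons[OF P(1) t_Sig_max[OF A B]]
  note C = t_Split.IH(3)[OF _ rn_up[OF P(2)], simplified, OF cS]
  note d = t_Split.IH(5)[OF ctx_Cons[OF cA B] rn_up[OF rn_up[OF P(2)]], unfolded ren_pair]
  show ?case unfolding ren_inst ren.simps
    by (rule ctx_has_type_jeq.t_Split[OF A B C t_Split.IH(4)[OF P, simplified] d])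
next
  case (e_Split \<Gamma> A n B m C i p p' d d')
  note P = e_Split.prems
  note A = e_Split.IH(1)[OF P, simplified]
  note cA = ctx_Cons[OF P(1) A]
  note B = e_Split.IH(2)[OF cA rn_up[OF P(2)], simplified]
  note cS = ctx_Cons[OF P(1) t_Sig_max[OF A B]]
  note C = e_Split.IH(3)[OF _ rn_up[OF P(2)], simplified, OF cS]
  note d = e_Split.IH(5)[OF ctx_Cons[OF cA B] rn_up[OF rn_up[OF P(2)]], unfolded ren_pair]
  show ?case unfolding ren_inst ren.simps
    by (rule ctx_has_type_jeq.e_Split[OF A B C e_Split.IH(4)[OF P, simplified] d])
next
  case (e_Split_beta \<Gamma> A n B m C i a b d)
  note P = e_Split_beta.prems
  note A = e_Split_beta.IH(1)[OF P, simplified]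
  note cA = ctx_Cons[OF P(1) A]
  note B = e_Split_beta.IH(2)[OF cA rn_up[OF P(2)], simplified]
  note cS = ctx_Cons[OF P(1) t_Sig_max[OF A B]]
  note C = e_Split_beta.IH(3)[OF _ rn_up[OF P(2)], simplified, OF cS]
  note d = e_Split_beta.IH(6)[OF ctx_Cons[OF cA B] rn_up[OF rn_up[OF P(2)]], unfolded ren_pair]
  show ?case unfolding ren_inst ren_inst2 ren.simps
    by (rule ctx_has_type_jeq.e_Split_beta[OF A B C e_Split_beta.IH(4)[OF P, simplified]
      e_Split_beta.IH(5)[OF P, unfolded ren_inst] d])
next
  case (t_J \<Gamma> A n C m d a b p)
  note P = t_J.prems
  note A = t_J.IH(1)[OF P, simplified]
  note cA = ctx_Cons[OF P(1) A]
  note A1 = t_J.IH(1)[OF cA rn_Suc[OF P(2)], unfolded ren_Suc_shift ren.simps shift_Univ]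
  note cA1 = ctx_Cons[OF cA A1]
  note A2 = t_J.IH(1)[OF cA1 rn_Suc[OF rn_Suc[OF P(2)]], unfolded ren_Suc_shift ren.simps shift_shift one_add_one shift_Univ]
  note cJ = ctx_J[OF P(1) A A1 A2]
  have r: "rn (Id (shift 2 A) (Var 1) (Var 0) # shift 1 A # A # \<Gamma>) (upr (upr (upr \<xi>)))
     (Id (shift 2 (ren \<xi> A)) (Var 1) (Var 0) # shift 1 (ren \<xi> A) # ren \<xi> A # \<Delta>)"
    using rn_up[OF rn_up[OF rn_up[OF P(2)]], of "Id (shift 2 A) (Var 1) (Var 0)" "shift 1 A" A]
    by (simp add: ren_sh1[simplified] ren_sh2)
  note C = t_J.IH(2)[OF cJ r, unfolded ren.simps]
  note d = t_J.IH(3)[OF cA rn_up[OF P(2)], unfolded ren_J]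
  show ?case unfolding ren_inst3 ren.simps
    by (rule ctx_has_type_jeq.t_J[OF A C d t_J.IH(4)[OF P] t_J.IH(5)[OF P] t_J.IH(6)[OF P, unfolded ren.simps]])
next
  case (e_J \<Gamma> A n C m d d' a b p p')
  note P = e_J.prems
  note A = e_J.IH(1)[OF P, simplified]
  note cA = ctx_Cons[OF P(1) A]
  note A1 = e_J.IH(1)[OF cA rn_Suc[OF P(2)], unfolded ren_Suc_shift ren.simps shift_Univ]
  note cA1 = ctx_Cons[OF cA A1]
  note A2 = e_J.IH(1)[OF cA1 rn_Suc[OF rn_Suc[OF P(2)]], unfolded ren_Suc_shift ren.simps shift_shift one_add_one shift_Univ]
  note cJ = ctx_J[OF P(1) A A1 A2]
  have r: "rn (Id (shift 2 A) (Var 1) (Var 0) # shift 1 A # A # \<Gamma>) (upr (upr (upr \<xi>)))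
     (Id (shift 2 (ren \<xi> A)) (Var 1) (Var 0) # shift 1 (ren \<xi> A) # ren \<xi> A # \<Delta>)"
    using rn_up[OF rn_up[OF rn_up[OF P(2)]], of "Id (shift 2 A) (Var 1) (Var 0)" "shift 1 A" A]
    by (simp add: ren_sh1[simplified] ren_sh2)
  note C = e_J.IH(2)[OF cJ r, unfolded ren.simps]
  note d = e_J.IH(3)[OF cA rn_up[OF P(2)], unfolded ren_J]
  show ?case unfolding ren_inst3 ren.simps
    by (rule ctx_has_type_jeq.e_J[OF A C d e_J.IH(4)[OF P] e_J.IH(5)[OF P] e_J.IH(6)[OF P, unfolded ren.simps]])
next
  case (e_J_beta \<Gamma> A n C m d a)
  note P = e_J_beta.prems
  note A = e_J_beta.IH(1)[OF P, simplified]
  note cA = ctx_Cons[OF P(1) A]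
  note A1 = e_J_beta.IH(1)[OF cA rn_Suc[OF P(2)], unfolded ren_Suc_shift ren.simps shift_Univ]
  note cA1 = ctx_Cons[OF cA A1]
  note A2 = e_J_beta.IH(1)[OF cA1 rn_Suc[OF rn_Suc[OF P(2)]], unfolded ren_Suc_shift ren.simps shift_shift one_add_one shift_Univ]
  note cJ = ctx_J[OF P(1) A A1 A2]
  have r: "rn (Id (shift 2 A) (Var 1) (Var 0) # shift 1 A # A # \<Gamma>) (upr (upr (upr \<xi>)))
     (Id (shift 2 (ren \<xi> A)) (Var 1) (Var 0) # shift 1 (ren \<xi> A) # ren \<xi> A # \<Delta>)"
    using rn_up[OF rn_up[OF rn_up[OF P(2)]], of "Id (shift 2 A) (Var 1) (Var 0)" "shift 1 A" A]
    by (simp add: ren_sh1[simplified] ren_sh2)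
  note C = e_J_beta.IH(2)[OF cJ r, unfolded ren.simps]
  note d = e_J_beta.IH(3)[OF cA rn_up[OF P(2)], unfolded ren_J]
  show ?case unfolding ren_inst3 ren_inst ren.simps
    by (rule ctx_has_type_jeq.e_J_beta[OF A C d e_J_beta.IH(4)[OF P]])
next
  case (t_Funext \<Gamma> A n B m f g h)
  note P = t_Funext.prems
  note A = t_Funext.IH(1)[OF P, simplified]
  note cA = ctx_Cons[OF P(1) A]
  note B = t_Funext.IH(2)[OF cA rn_up[OF P(2)], simplified]
  show ?case unfolding ren.simps
    by (rule ctx_has_type_jeq.t_Funext[OF A B t_Funext.IH(3)[OF P, simplified] t_Funext.IH(4)[OF P, simplified]
      t_Funext.IH(5)[OF P, unfolded ren.simps ren_sh1 upr_simps]])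
next
  case (e_Funext \<Gamma> A n B m f g h h')
  note P = e_Funext.prems
  note A = e_Funext.IH(1)[OF P, simplified]
  note cA = ctx_Cons[OF P(1) A]
  note B = e_Funext.IH(2)[OF cA rn_up[OF P(2)], simplified]
  show ?case unfolding ren.simps
    by (rule ctx_has_type_jeq.e_Funext[OF A B e_Funext.IH(3)[OF P, simplified] e_Funext.IH(4)[OF P, simplified]
      e_Funext.IH(5)[OF P, unfolded ren.simps ren_sh1 upr_simps]])
next
  case (t_Pair \<Gamma> A n B m a b)
  note P = t_Pair.prems
  note A = t_Pair.IH(1)[OF P, simplified]
  note cA = ctx_Cons[OF P(1) A]
  note B = t_Pair.IH(2)[OF cA rn_up[OF P(2)], simplified]
  show ?case unfolding ren.simps
    by (rule ctx_has_type_jeq.t_Pair[OF A B t_Pair.IH(3)[OF P] t_Pair.IH(4)[OF P, unfolded ren_inst]])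
next
  case (e_Pair \<Gamma> A n B m a a' b b')
  note P = e_Pair.prems
  note A = e_Pair.IH(1)[OF P, simplified]
  note cA = ctx_Cons[OF P(1) A]
  note B = e_Pair.IH(2)[OF cA rn_up[OF P(2)], simplified]
  show ?case unfolding ren.simps
    by (rule ctx_has_type_jeq.e_Pair[OF A B e_Pair.IH(3)[OF P] e_Pair.IH(4)[OF P, unfolded ren_inst]])
next
  case (e_beta \<Gamma> A n b B a)
  note P = e_beta.prems
  note A = e_beta.IH(1)[OF P, simplified]
  note cA = ctx_Cons[OF P(1) A]
  note b = e_beta.IH(2)[OF cA rn_up[OF P(2)], simplified]
  show ?case unfolding ren.simps ren_inst
    by (rule ctx_has_type_jeq.e_beta[OF A b e_beta.IH(3)[OF P]])
next
  case (t_App \<Gamma> f A B a)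
  show ?case unfolding ren.simps ren_inst
    by (rule ctx_has_type_jeq.t_App[OF t_App.IH(1)[OF t_App.prems, unfolded ren.simps] t_App.IH(2)[OF t_App.prems]])
next
  case (e_App \<Gamma> f f' A B a a')
  show ?case unfolding ren.simps ren_inst
    by (rule ctx_has_type_jeq.e_App[OF e_App.IH(1)[OF e_App.prems, unfolded ren.simps] e_App.IH(2)[OF e_App.prems]])
next
  case (e_Conv \<Gamma> a b A B n)
  then show ?case using ctx_has_type_jeq.e_Conv by fastforce
next
  case (e_trans \<Gamma> a b A c)
  then show ?case using ctx_has_type_jeq.e_trans by blast
next
  case (t_Pi \<Gamma> A n B)
  note P = t_Pi.prems
  note A = t_Pi.IH(1)[OF P, unfolded ren.simps]
  note B = t_Pi.IH(2)[OF ctx_Cons[OF P(1) A] rn_up[OF P(2)], unfolded ren.simps]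
  show ?case unfolding ren.simps by (rule ctx_has_type_jeq.t_Pi[OF A B])
next
  case (t_Pi_impred \<Gamma> A n B)
  note P = t_Pi_impred.prems
  note A = t_Pi_impred.IH(1)[OF P, unfolded ren.simps]
  note B = t_Pi_impred.IH(2)[OF ctx_Cons[OF P(1) A] rn_up[OF P(2)], unfolded ren.simps]
  show ?case unfolding ren.simps by (rule ctx_has_type_jeq.t_Pi_impred[OF A B])
next
  case (t_Lam \<Gamma> A n b B)
  note P = t_Lam.prems
  note A = t_Lam.IH(1)[OF P, unfolded ren.simps]
  note B = t_Lam.IH(2)[OF ctx_Cons[OF P(1) A] rn_up[OF P(2)], unfolded ren.simps]
  show ?case unfolding ren.simps by (rule ctx_has_type_jeq.t_Lam[OF A B])
next
  case (t_Sig \<Gamma> A n B)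
  note P = t_Sig.prems
  note A = t_Sig.IH(1)[OF P, unfolded ren.simps]
  note B = t_Sig.IH(2)[OF ctx_Cons[OF P(1) A] rn_up[OF P(2)], unfolded ren.simps]
  show ?case unfolding ren.simps by (rule ctx_has_type_jeq.t_Sig[OF A B])
next
  case (e_Pi \<Gamma> A n A' B B')
  note P = e_Pi.prems
  note A = e_Pi.IH(1)[OF P, unfolded ren.simps]
  note B = e_Pi.IH(3)[OF ctx_Cons[OF P(1) A] rn_up[OF P(2)], unfolded ren.simps]
  show ?case unfolding ren.simps by (rule ctx_has_type_jeq.e_Pi[OF A e_Pi.IH(2)[OF P, unfolded ren.simps] B])
next
  case (e_Pi_impred \<Gamma> A n A' B B')
  note P = e_Pi_impred.prems
  note A = e_Pi_impred.IH(1)[OF P, unfolded ren.simps]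
  note B = e_Pi_impred.IH(3)[OF ctx_Cons[OF P(1) A] rn_up[OF P(2)], unfolded ren.simps]
  show ?case unfolding ren.simps by (rule ctx_has_type_jeq.e_Pi_impred[OF A e_Pi_impred.IH(2)[OF P, unfolded ren.simps] B])
next
  case (e_Lam \<Gamma> A n b b' B)
  note P = e_Lam.prems
  note A = e_Lam.IH(1)[OF P, unfolded ren.simps]
  note B = e_Lam.IH(2)[OF ctx_Cons[OF P(1) A] rn_up[OF P(2)], unfolded ren.simps]
  show ?case unfolding ren.simps by (rule ctx_has_type_jeq.e_Lam[OF A B])
next
  case (e_Sig \<Gamma> A n A' B B')
  note P = e_Sig.prems
  note A = e_Sig.IH(1)[OF P, unfolded ren.simps]
  note B = e_Sig.IH(3)[OF ctx_Cons[OF P(1) A] rn_up[OF P(2)], unfolded ren.simps]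
  show ?case unfolding ren.simps by (rule ctx_has_type_jeq.e_Sig[OF A e_Sig.IH(2)[OF P, unfolded ren.simps] B])
next
  case (t_Uip \<Gamma> A n a b p q)
  note P = t_Uip.prems
  show ?case unfolding ren.simps by (rule ctx_has_type_jeq.t_Uip[OF t_Uip.IH(1)[OF P, unfolded ren.simps] t_Uip.IH(2)[OF P, unfolded ren.simps] t_Uip.IH(3)[OF P, unfolded ren.simps] t_Uip.IH(4)[OF P, unfolded ren.simps] t_Uip.IH(5)[OF P, unfolded ren.simps]])
next
  case (e_Uip \<Gamma> A n a b p p' q q')
  note P = e_Uip.prems
  show ?case unfolding ren.simps by (rule ctx_has_type_jeq.e_Uip[OF e_Uip.IH(1)[OF P, unfolded ren.simps] e_Uip.IH(2)[OF P, unfolded ren.simps] e_Uip.IH(3)[OF P, unfolded ren.simps] e_Uip.IH(4)[OF P, unfolded ren.simps] e_Uip.IH(5)[OF P, unfolded ren.simps]])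
qed (auto intro: ctx_Cons rn_up ctx_has_type_jeq.intros)

lemma rn_Suc0: "rn \<Gamma> Suc (A # \<Gamma>)"
  by (simp add: rn_def shift_def ren_ren comp_def)

lemma weak: "\<Gamma> \<turnstile> a \<Colon> A \<Longrightarrow> ctx (B # \<Gamma>) \<Longrightarrow> B # \<Gamma> \<turnstile> shift 1 a \<Colon> shift 1 A"
  using renaming(2)[OF _ _ rn_Suc0] by (simp add: shift_def)

lemma weak_eq: "\<Gamma> \<turnstile> a \<simeq> b \<Colon> A \<Longrightarrow> ctx (B # \<Gamma>) \<Longrightarrow> B # \<Gamma> \<turnstile> shift 1 a \<simeq> shift 1 b \<Colon> shift 1 A"
  using renaming(3)[OF _ _ rn_Suc0] by (simp add: shift_def)

lemma has_ctx: "ctx \<Gamma> \<Longrightarrow> True" "\<Gamma> \<turnstile> a \<Colon> A \<Longrightarrow> ctx \<Gamma>" "\<Gamma> \<turnstile> a \<simeq> b \<Colon> A \<Longrightarrow> ctx \<Gamma>"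
  by (induction rule: ctx_has_type_jeq.inducts) auto

lemma weakn: "\<Gamma> \<turnstile> a \<Colon> A \<Longrightarrow> ctx (\<Delta> @ \<Gamma>) \<Longrightarrow> \<Delta> @ \<Gamma> \<turnstile> shift (length \<Delta>) a \<Colon> shift (length \<Delta>) A"
proof (induction \<Delta>)
  case (Cons B \<Delta>)
  from Cons.prems(2) have "ctx (\<Delta> @ \<Gamma>)" by (auto elim: ctx.cases)
  from weak[OF Cons.IH[OF Cons.prems(1) this]] Cons.prems(2) show ?case by simp
qed simp

lemma weakn_eq: "\<Gamma> \<turnstile> a \<simeq> b \<Colon> A \<Longrightarrow> ctx (\<Delta> @ \<Gamma>) \<Longrightarrow>
   \<Delta> @ \<Gamma> \<turnstile> shift (length \<Delta>) a \<simeq> shift (length \<Delta>) b \<Colon> shift (length \<Delta>) A"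
proof (induction \<Delta>)
  case (Cons B \<Delta>)
  from Cons.prems(2) have "ctx (\<Delta> @ \<Gamma>)" by (auto elim: ctx.cases)
  from weak_eq[OF Cons.IH[OF Cons.prems(1) this]] Cons.prems(2) show ?case by simp
qed simp

lemma wkn: "\<lbrakk>\<Gamma> \<turnstile> a \<Colon> A; ctx \<Delta>; drop n \<Delta> = \<Gamma>; n \<le> length \<Delta>; A' = shift n A\<rbrakk> \<Longrightarrow> \<Delta> \<turnstile> shift n a \<Colon> A'"
  using weakn[of \<Gamma> a A "take n \<Delta>"] by (metis append_take_drop_id length_take min.absorb2)

lemma wkn_eq: "\<lbrakk>\<Gamma> \<turnstile> a \<simeq> b \<Colon> A; ctx \<Delta>; drop n \<Delta> = \<Gamma>; n \<le> length \<Delta>; A' = shift n A\<rbrakk>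
  \<Longrightarrow> \<Delta> \<turnstile> shift n a \<simeq> shift n b \<Colon> A'"
  using weakn_eq[of \<Gamma> a b A "take n \<Delta>"] by (metis append_take_drop_id length_take min.absorb2)

lemma sub_inst_shift [simp]: "sub (a \<cdot> Var) (shift 1 t) = t" "sub (a \<cdot> Var) (shift (Suc 0) t) = t"
  using sub_scons[of a Var 0 t] by (simp_all add: sub_Var)

lemma sub_scons' [simp]: "sub (a \<cdot> \<sigma>) (shift (Suc n) t) = sub \<sigma> (shift n t)" 
   "sub (a \<cdot> \<sigma>) (shift (numeral k) t) = sub \<sigma> (shift (pred_numeral k) t)"
   "sub (a \<cdot> \<sigma>) (shift 1 t) = sub \<sigma> t"
  using sub_scons[of a \<sigma> _ t] sub_scons[of a \<sigma> 0 t] by (simp_all add: numeral_eq_Suc)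

lemma sub_up' [simp]: "sub (up \<sigma>) (shift (Suc n) t) = shift 1 (sub \<sigma> (shift n t))"
   "sub (up \<sigma>) (shift (numeral k) t) = shift 1 (sub \<sigma> (shift (pred_numeral k) t))"
   "sub (up \<sigma>) (shift 1 t) = shift 1 (sub \<sigma> t)"
  using sub_up[of \<sigma> _ t] sub_up[of \<sigma> 0 t] by (simp_all add: numeral_eq_Suc)

lemma sub_Var' [simp]: "sub Var t = t" by (rule sub_Var)

lemma ren_upr' [simp]: "ren (upr \<xi>) (shift (Suc n) t) = shift 1 (ren \<xi> (shift n t))"
   "ren (upr \<xi>) (shift (numeral k) t) = shift 1 (ren \<xi> (shift (pred_numeral k) t))"
   "ren (upr \<xi>) (shift 1 t) = shift 1 (ren \<xi> t)"
  using ren_shift1[of \<xi> _ t] ren_shift1[of \<xi> 0 t] by (simp_all add: numeral_eq_Suc)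

lemma up_Var_ren: "up (\<lambda>k. Var (\<xi> k)) = (\<lambda>k. Var (upr \<xi> k))"
proof
  fix k show "up (\<lambda>k. Var (\<xi> k)) k = Var (upr \<xi> k)" by (cases k) auto
qed

lemma sub_as_ren: "sub (\<lambda>k. Var (\<xi> k)) t = ren \<xi> t"
  by (induction t arbitrary: \<xi>) (simp_all add: up_Var_ren)

lemma sub_shiftn [simp]: "sub (\<lambda>k. Var (Suc (Suc k))) t = shift 2 t" "sub (\<lambda>k. Var (Suc k)) t = shift 1 t"
  "sub (\<lambda>k. Var (k + 2)) t = shift 2 t" "sub (\<lambda>k. Var (k + 1)) t = shift 1 t"
  by (simp_all add: sub_as_ren shift_def)

lemma sub_arr [simp]: "sub \<sigma> (arr A B) = arr (sub \<sigma> A) (sub \<sigma> B)" by (simp add: arr_def)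
lemma ren_arr [simp]: "ren \<sigma> (arr A B) = arr (ren \<sigma> A) (ren \<sigma> B)" by (simp add: arr_def)
lemma sub_compT [simp]: "sub \<sigma> (compT A B) = compT (sub \<sigma> A) (sub \<sigma> B)" by (simp add: compT_def)
lemma ren_compT [simp]: "ren \<sigma> (compT A B) = compT (ren \<sigma> A) (ren \<sigma> B)" by (simp add: compT_def)
lemma sub_pi1 [simp]: "sub \<sigma> (pi1 p) = pi1 (sub \<sigma> p)" by (simp add: pi1_def)
lemma ren_pi1 [simp]: "ren \<sigma> (pi1 p) = pi1 (ren \<sigma> p)" by (simp add: pi1_def)
lemma sub_pi2 [simp]: "sub \<sigma> (pi2 p) = pi2 (sub \<sigma> p)" by (simp add: pi2_def)
lemma ren_pi2 [simp]: "ren \<sigma> (pi2 p) = pi2 (ren \<sigma> p)" by (simp add: pi2_def)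
lemma sub_prodT [simp]: "sub \<sigma> (prodT A B) = prodT (sub \<sigma> A) (sub \<sigma> B)" by (simp add: prodT_def)
lemma ren_prodT [simp]: "ren \<sigma> (prodT A B) = prodT (ren \<sigma> A) (ren \<sigma> B)" by (simp add: prodT_def)
lemma sub_ListStar [simp]: "sub \<sigma> (ListStar A) = ListStar (sub \<sigma> A)" by (simp add: ListStar_def)
lemma ren_ListStar [simp]: "ren \<sigma> (ListStar A) = ListStar (ren \<sigma> A)" by (simp add: ListStar_def)
lemma sub_recStar [simp]: "sub \<sigma> (recStar A B C D) = recStar (sub \<sigma> A) (sub \<sigma> B) (sub \<sigma> C) (sub \<sigma> D)" by (simp add: recStar_def)
lemma ren_recStar [simp]: "ren \<sigma> (recStar A B C D) = recStar (ren \<sigma> A) (ren \<sigma> B) (ren \<sigma> C) (ren \<sigma> D)" by (simp add: recStar_def)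
lemma sub_MorphList [simp]: "sub \<sigma> (MorphList E X x g Y y h f) =
  MorphList (sub \<sigma> E) (sub \<sigma> X) (sub \<sigma> x) (sub \<sigma> g) (sub \<sigma> Y) (sub \<sigma> y) (sub \<sigma> h) (sub \<sigma> f)"
  by (simp add: MorphList_def)
lemma ren_MorphList [simp]: "ren \<sigma> (MorphList E X x g Y y h f) =
  MorphList (ren \<sigma> E) (ren \<sigma> X) (ren \<sigma> x) (ren \<sigma> g) (ren \<sigma> Y) (ren \<sigma> y) (ren \<sigma> h) (ren \<sigma> f)"
  by (simp add: MorphList_def)
lemma sub_LimList [simp]: "sub \<sigma> (LimList A B) = LimList (sub \<sigma> A) (sub \<sigma> B)" by (simp add: LimList_def eval_nat_numeral)
lemma ren_LimList [simp]: "ren \<sigma> (LimList A B) = LimList (ren \<sigma> A) (ren \<sigma> B)" by (simp add: LimList_def eval_nat_numeral)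
lemma sub_ListT [simp]: "sub \<sigma> (ListT A) = ListT (sub \<sigma> A)" by (simp add: ListT_def)
lemma ren_ListT [simp]: "ren \<sigma> (ListT A) = ListT (ren \<sigma> A)" by (simp add: ListT_def)
lemma sub_nilStar [simp]: "sub \<sigma> nilStar = nilStar" by (simp add: nilStar_def)
lemma ren_nilStar [simp]: "ren \<sigma> nilStar = nilStar" by (simp add: nilStar_def)
lemma sub_consStar [simp]: "sub \<sigma> (consStar A B) = consStar (sub \<sigma> A) (sub \<sigma> B)" by (simp add: consStar_def eval_nat_numeral)
lemma ren_consStar [simp]: "ren \<sigma> (consStar A B) = consStar (ren \<sigma> A) (ren \<sigma> B)" by (simp add: consStar_def eval_nat_numeral)

lemma shift_homs [simp]:
  "shift n (arr A B) = arr (shift n A) (shift n B)"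
  "shift n (ListStar E) = ListStar (shift n E)"
  "shift n (ListT E) = ListT (shift n E)"
  "shift n (LimList E A) = LimList (shift n E) (shift n A)"
  "shift n (MorphList E X x g Y y h f) =
  MorphList (shift n E) (shift n X) (shift n x) (shift n g) (shift n Y) (shift n y) (shift n h) (shift n f)"
  "shift n (recStar A B C D) = recStar (shift n A) (shift n B) (shift n C) (shift n D)"
  "shift n nilStar = nilStar"
  "shift n (consStar A B) = consStar (shift n A) (shift n B)"
  "shift n (pi1 A) = pi1 (shift n A)" "shift n (pi2 A) = pi2 (shift n A)"
  "shift n (prodT A B) = prodT (shift n A) (shift n B)"
  "shift n (compT A B) = compT (shift n A) (shift n B)"
  "shift n (Id A a b) = Id (shift n A) (shift n a) (shift n b)"
  "shift n (App a b) = App (shift n a) (shift n b)"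
  by (simp_all add: shift_def)

section \<open>Derived typing rules\<close>

lemma t_App_eq: "\<lbrakk>\<Gamma> \<turnstile> f \<Colon> Pi A B; \<Gamma> \<turnstile> a \<Colon> A; C = inst B a\<rbrakk> \<Longrightarrow> \<Gamma> \<turnstile> App f a \<Colon> C"
  using t_App by simp

lemma app_arr: "\<lbrakk>\<Gamma> \<turnstile> f \<Colon> arr A B; \<Gamma> \<turnstile> a \<Colon> A\<rbrakk> \<Longrightarrow> \<Gamma> \<turnstile> App f a \<Colon> B"
  unfolding arr_def by (erule t_App_eq) auto

lemma app_arr_eq: "\<lbrakk>\<Gamma> \<turnstile> f \<simeq> f' \<Colon> arr A B; \<Gamma> \<turnstile> a \<simeq> a' \<Colon> A\<rbrakk> \<Longrightarrow> \<Gamma> \<turnstile> App f a \<simeq> App f' a' \<Colon> B"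
  unfolding arr_def using e_App[of \<Gamma> f f' A "shift 1 B" a a'] by simp

lemma beta_eq: "\<lbrakk>\<Gamma> \<turnstile> A \<Colon> Univ n; A # \<Gamma> \<turnstile> b \<Colon> B; \<Gamma> \<turnstile> a \<Colon> A; r = inst b a; R = inst B a\<rbrakk>
   \<Longrightarrow> \<Gamma> \<turnstile> App (Lam b) a \<simeq> r \<Colon> R"
  using e_beta by simp

lemma wk1: "\<lbrakk>\<Gamma> \<turnstile> a \<Colon> A; \<Gamma> \<turnstile> B \<Colon> Univ n; A' = shift 1 A\<rbrakk> \<Longrightarrow> B # \<Gamma> \<turnstile> shift 1 a \<Colon> A'"
  using weak[of \<Gamma> a A B] by (metis ctx_Cons has_ctx(2))

lemma Pi_eq: "\<lbrakk>\<Gamma> \<turnstile> A \<Colon> Univ n; A # \<Gamma> \<turnstile> B \<simeq> B' \<Colon> U\<rbrakk> \<Longrightarrow> \<Gamma> \<turnstile> Pi A B \<simeq> Pi A B' \<Colon> U"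
  by (rule e_Pi_impred, assumption, erule e_refl)

lemma arr_U: "\<lbrakk>\<Gamma> \<turnstile> A \<Colon> Univ n; \<Gamma> \<turnstile> B \<Colon> U\<rbrakk> \<Longrightarrow> \<Gamma> \<turnstile> arr A B \<Colon> U"
  unfolding arr_def
  by (rule t_Pi_impred, assumption, rule wk1, auto)

lemma prod_U: "\<lbrakk>\<Gamma> \<turnstile> A \<Colon> U; \<Gamma> \<turnstile> B \<Colon> U\<rbrakk> \<Longrightarrow> \<Gamma> \<turnstile> prodT A B \<Colon> U"
  unfolding prodT_def
  by (rule t_Sig, assumption, rule wk1, auto)

lemma arr_U_eq: "\<lbrakk>\<Gamma> \<turnstile> A \<Colon> Univ n; \<Gamma> \<turnstile> B \<simeq> B' \<Colon> U\<rbrakk> \<Longrightarrow> \<Gamma> \<turnstile> arr A B \<simeq> arr A B' \<Colon> U"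
  unfolding arr_def
  by (rule e_Pi_impred, assumption, erule e_refl) (rule wkn_eq, auto dest: has_ctx intro: ctx_Cons)

lemma lam_arr: "\<lbrakk>\<Gamma> \<turnstile> A \<Colon> Univ n; A # \<Gamma> \<turnstile> b \<Colon> shift 1 B\<rbrakk> \<Longrightarrow> \<Gamma> \<turnstile> Lam b \<Colon> arr A B"
  unfolding arr_def by (rule t_Lam)

lemma var0: "\<lbrakk>\<Gamma> \<turnstile> B \<Colon> Univ n; A' = shift 1 B\<rbrakk> \<Longrightarrow> B # \<Gamma> \<turnstile> Var 0 \<Colon> A'"
  by (rule t_Var_eq) (auto dest: has_ctx intro: ctx_Cons)

lemma compT_t: "\<lbrakk>\<Gamma> \<turnstile> X \<Colon> U; \<Gamma> \<turnstile> f \<Colon> arr Y Z; \<Gamma> \<turnstile> g \<Colon> arr X Y\<rbrakk> \<Longrightarrow> \<Gamma> \<turnstile> compT f g \<Colon> arr X Z"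
  unfolding compT_def
  by (rule lam_arr, assumption, rule app_arr[where A="shift 1 Y"], erule wk1, assumption, simp,
      rule app_arr[where A="shift 1 X"], erule wk1, assumption, simp, erule var0, simp)

lemma compT_beta: "\<lbrakk>\<Gamma> \<turnstile> X \<Colon> U; \<Gamma> \<turnstile> f \<Colon> arr Y Z; \<Gamma> \<turnstile> g \<Colon> arr X Y; \<Gamma> \<turnstile> u \<Colon> X\<rbrakk>
   \<Longrightarrow> \<Gamma> \<turnstile> App (compT f g) u \<simeq> App f (App g u) \<Colon> Z"
  unfolding compT_def
  by (rule beta_eq[where B="shift 1 Z"], assumption, rule app_arr[where A="shift 1 Y"], erule wk1, assumption, simp,
      rule app_arr[where A="shift 1 X"], erule wk1, assumption, simp, erule var0, simp_all)

lemma ListStar_t: "\<Gamma> \<turnstile> E \<Colon> U \<Longrightarrow> \<Gamma> \<turnstile> ListStar E \<Colon> U"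
proof -
  assume E: "\<Gamma> \<turnstile> E \<Colon> U"
  have u: "\<Gamma> \<turnstile> U \<Colon> Univ 1" using has_ctx(2)[OF E] t_Univ[of \<Gamma> 0] by simp
  have v: "U # \<Gamma> \<turnstile> Var 0 \<Colon> U" by (rule var0[OF u]) simp
  have e: "U # \<Gamma> \<turnstile> shift 1 E \<Colon> U" by (rule wk1[OF E u]) simp
  show ?thesis unfolding ListStar_def
    by (rule t_Pi_impred[OF u]) (rule v e arr_U)+
qed

lemma ListStar_app: "\<lbrakk>\<Gamma> \<turnstile> l \<Colon> ListStar E; \<Gamma> \<turnstile> X \<Colon> U\<rbrakk>
   \<Longrightarrow> \<Gamma> \<turnstile> App l X \<Colon> arr X (arr (arr E (arr X X)) X)"
  unfolding ListStar_def by (erule t_App_eq) auto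

lemma recStar_t: "\<lbrakk>\<Gamma> \<turnstile> l \<Colon> ListStar E; \<Gamma> \<turnstile> X \<Colon> U; \<Gamma> \<turnstile> x \<Colon> X; \<Gamma> \<turnstile> g \<Colon> arr E (arr X X)\<rbrakk>
   \<Longrightarrow> \<Gamma> \<turnstile> recStar X x g l \<Colon> X"
  unfolding recStar_def by (meson ListStar_app app_arr)

lemma ListStar_app_eq: "\<lbrakk>\<Gamma> \<turnstile> l \<simeq> l' \<Colon> ListStar E; \<Gamma> \<turnstile> X \<Colon> U\<rbrakk>
   \<Longrightarrow> \<Gamma> \<turnstile> App l X \<simeq> App l' X \<Colon> arr X (arr (arr E (arr X X)) X)"
  unfolding ListStar_def by (drule e_App, erule e_refl) auto

lemma recStar_eq: "\<lbrakk>\<Gamma> \<turnstile> l \<simeq> l' \<Colon> ListStar E; \<Gamma> \<turnstile> X \<Colon> U; \<Gamma> \<turnstile> x \<Colon> X; \<Gamma> \<turnstile> g \<Colon> arr E (arr X X)\<rbrakk>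
   \<Longrightarrow> \<Gamma> \<turnstile> recStar X x g l \<simeq> recStar X x g l' \<Colon> X"
  unfolding recStar_def by (meson ListStar_app_eq app_arr_eq e_refl)

lemma MorphT: 
  assumes "\<Gamma> \<turnstile> E \<Colon> U" "\<Gamma> \<turnstile> X \<Colon> U" "\<Gamma> \<turnstile> Y \<Colon> U" "\<Gamma> \<turnstile> x \<Colon> X" "\<Gamma> \<turnstile> y \<Colon> Y" "\<Gamma> \<turnstile> f \<Colon> arr X Y"
    "\<Gamma> \<turnstile> g \<Colon> arr E (arr X X)" "\<Gamma> \<turnstile> h \<Colon> arr E (arr Y Y)"
  shows "\<Gamma> \<turnstile> Id Y (App f x) y \<Colon> U" 
    "\<Gamma> \<turnstile> Pi E (Id (shift 1 (arr X Y))
         (compT (shift 1 f) (App (shift 1 g) (Var 0)))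
         (compT (App (shift 1 h) (Var 0)) (shift 1 f))) \<Colon> U"
    "\<Gamma> \<turnstile> MorphList E X x g Y y h f \<Colon> U"
proof -
  note w = wk1[OF _ assms(1)]
  show 1: "\<Gamma> \<turnstile> Id Y (App f x) y \<Colon> U" using assms by (intro t_Id) (auto intro: app_arr)
  have v: "E # \<Gamma> \<turnstile> Var 0 \<Colon> shift 1 E" by (rule var0[OF assms(1)]) simp
  have g: "E # \<Gamma> \<turnstile> App (shift 1 g) (Var 0) \<Colon> arr (shift 1 X) (shift 1 X)"
    by (rule app_arr[OF w[OF assms(7)] v]) simp
  have h: "E # \<Gamma> \<turnstile> App (shift 1 h) (Var 0) \<Colon> arr (shift 1 Y) (shift 1 Y)"
    by (rule app_arr[OF w[OF assms(8)] v]) simp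
  have X: "E # \<Gamma> \<turnstile> shift 1 X \<Colon> U" by (rule w[OF assms(2)]) simp
  have Y: "E # \<Gamma> \<turnstile> shift 1 Y \<Colon> U" by (rule w[OF assms(3)]) simp
  have f: "E # \<Gamma> \<turnstile> shift 1 f \<Colon> arr (shift 1 X) (shift 1 Y)" by (rule w[OF assms(6)]) simp
  show 2: "\<Gamma> \<turnstile> Pi E (Id (shift 1 (arr X Y))
         (compT (shift 1 f) (App (shift 1 g) (Var 0)))
         (compT (App (shift 1 h) (Var 0)) (shift 1 f))) \<Colon> U"
    unfolding shift_homs
    by (rule t_Pi[OF assms(1)] t_Id arr_U[OF X Y] compT_t[OF X f g] compT_t[OF X h f])+
  show "\<Gamma> \<turnstile> MorphList E X x g Y y h f \<Colon> U"
    unfolding MorphList_def by (rule prod_U[OF 1 2])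
qed

text \<open>The context of the body of \<open>LimList E l\<close>.\<close>
definition LC :: "tm \<Rightarrow> tm list \<Rightarrow> tm list" where
  "LC E \<Gamma> = [arr (shift 6 E) (arr (Var 4) (Var 4)), arr (shift 5 E) (arr (Var 4) (Var 4)),
     arr (Var 3) (Var 2), Var 1, Var 1, U, U] @ \<Gamma>"

lemma LC_steps:
  assumes E: "\<Gamma> \<turnstile> E \<Colon> U"
  shows "\<Gamma> \<turnstile> U \<Colon> Univ 1" "U # \<Gamma> \<turnstile> U \<Colon> Univ 1" "U # U # \<Gamma> \<turnstile> Var 1 \<Colon> U"
   "Var 1 # U # U # \<Gamma> \<turnstile> Var 1 \<Colon> U"
   "Var 1 # Var 1 # U # U # \<Gamma> \<turnstile> arr (Var 3) (Var 2) \<Colon> U"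
   "arr (Var 3) (Var 2) # Var 1 # Var 1 # U # U # \<Gamma> \<turnstile> arr (shift 5 E) (arr (Var 4) (Var 4)) \<Colon> U"
   "arr (shift 5 E) (arr (Var 4) (Var 4)) # arr (Var 3) (Var 2) # Var 1 # Var 1 # U # U # \<Gamma>
       \<turnstile> arr (shift 6 E) (arr (Var 4) (Var 4)) \<Colon> U"
   "ctx (LC E \<Gamma>)"
proof -
  have c0: "ctx \<Gamma>" using E has_ctx by blast
  show 1: "\<Gamma> \<turnstile> U \<Colon> Univ 1" using c0 t_Univ[of _ 0] by simp
  note c1 = ctx_Cons[OF c0 1]
  show 2: "U # \<Gamma> \<turnstile> U \<Colon> Univ 1" using c1 t_Univ[of _ 0] by simp
  note c2 = ctx_Cons[OF c1 2]
  show 3: "U # U # \<Gamma> \<turnstile> Var 1 \<Colon> U" by (rule t_Var_eq[OF c2]) simp_all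
  note c3 = ctx_Cons[OF c2 3]
  show 4: "Var 1 # U # U # \<Gamma> \<turnstile> Var 1 \<Colon> U" by (rule t_Var_eq[OF c3]) simp_all
  note c4 = ctx_Cons[OF c3 4]
  show 5: "Var 1 # Var 1 # U # U # \<Gamma> \<turnstile> arr (Var 3) (Var 2) \<Colon> U"
    by (rule arr_U; rule t_Var_eq[OF c4]) (simp_all add: eval_nat_numeral)
  note c5 = ctx_Cons[OF c4 5]
  show 6: "arr (Var 3) (Var 2) # Var 1 # Var 1 # U # U # \<Gamma> \<turnstile> arr (shift 5 E) (arr (Var 4) (Var 4)) \<Colon> U"
    by (intro arr_U; (rule t_Var_eq[OF c5] | rule wkn[OF E c5])) (simp_all add: eval_nat_numeral)
  note c6 = ctx_Cons[OF c5 6]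
  show 7: "arr (shift 5 E) (arr (Var 4) (Var 4)) # arr (Var 3) (Var 2) # Var 1 # Var 1 # U # U # \<Gamma>
       \<turnstile> arr (shift 6 E) (arr (Var 4) (Var 4)) \<Colon> U"
    by (intro arr_U; (rule t_Var_eq[OF c6] | rule wkn[OF E c6])) (simp_all add: eval_nat_numeral)
  show "ctx (LC E \<Gamma>)" using ctx_Cons[OF c6 7] by (simp add: LC_def)
qed

lemma LC_wk: "\<lbrakk>\<Gamma> \<turnstile> E \<Colon> U; \<Gamma> \<turnstile> a \<Colon> A; A' = shift 7 A\<rbrakk> \<Longrightarrow> LC E \<Gamma> \<turnstile> shift 7 a \<Colon> A'"
  by (rule wkn[OF _ LC_steps(8)]) (auto simp: LC_def)

lemma LC_wk_eq: "\<lbrakk>\<Gamma> \<turnstile> E \<Colon> U; \<Gamma> \<turnstile> a \<simeq> b \<Colon> A; A' = shift 7 A\<rbrakk> \<Longrightarrow> LC E \<Gamma> \<turnstile> shift 7 a \<simeq> shift 7 b \<Colon> A'"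
  by (rule wkn_eq[OF _ LC_steps(8)]) (auto simp: LC_def)

lemma LC_vars:
  assumes "\<Gamma> \<turnstile> E \<Colon> U"
  shows "LC E \<Gamma> \<turnstile> shift 7 E \<Colon> U" "LC E \<Gamma> \<turnstile> Var 6 \<Colon> U" "LC E \<Gamma> \<turnstile> Var 5 \<Colon> U" "LC E \<Gamma> \<turnstile> Var 4 \<Colon> Var 6" "LC E \<Gamma> \<turnstile> Var 3 \<Colon> Var 5"
   "LC E \<Gamma> \<turnstile> Var 2 \<Colon> arr (Var 6) (Var 5)" "LC E \<Gamma> \<turnstile> Var 1 \<Colon> arr (shift 7 E) (arr (Var 6) (Var 6))"
   "LC E \<Gamma> \<turnstile> Var 0 \<Colon> arr (shift 7 E) (arr (Var 5) (Var 5))"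
  by ((rule t_Var_eq[OF LC_steps(8)[OF assms]] | rule LC_wk[OF assms assms]); simp add: LC_def eval_nat_numeral)+

abbreviation "LMorph E \<equiv> MorphList (shift 7 E) (Var 6) (Var 4) (Var 1) (Var 5) (Var 3) (Var 0) (Var 2)"
abbreviation "LConcl l \<equiv> Id (Var 5) (App (Var 2) (recStar (Var 6) (Var 4) (Var 1) (shift 7 l)))
             (recStar (Var 5) (Var 3) (Var 0) (shift 7 l))"

lemma LMorph_t: "\<Gamma> \<turnstile> E \<Colon> U \<Longrightarrow> LC E \<Gamma> \<turnstile> LMorph E \<Colon> U"
  by (rule MorphT(3)[OF LC_vars(1-8)])

lemma LConcl_t: "\<lbrakk>\<Gamma> \<turnstile> E \<Colon> U; \<Gamma> \<turnstile> l \<Colon> ListStar E\<rbrakk> \<Longrightarrow> LC E \<Gamma> \<turnstile> LConcl l \<Colon> U"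
proof -
  assume a: "\<Gamma> \<turnstile> E \<Colon> U" "\<Gamma> \<turnstile> l \<Colon> ListStar E"
  have l: "LC E \<Gamma> \<turnstile> shift 7 l \<Colon> ListStar (shift 7 E)" by (rule LC_wk[OF a]) simp
  note v = LC_vars[OF a(1)]
  show ?thesis
    by (rule t_Id[OF v(3)] app_arr[OF v(6)] recStar_t[OF l] v)+
qed

lemma LConcl_eq: "\<lbrakk>\<Gamma> \<turnstile> E \<Colon> U; \<Gamma> \<turnstile> l \<simeq> l' \<Colon> ListStar E\<rbrakk> \<Longrightarrow> LC E \<Gamma> \<turnstile> LConcl l \<simeq> LConcl l' \<Colon> U"
proof -
  assume a: "\<Gamma> \<turnstile> E \<Colon> U" "\<Gamma> \<turnstile> l \<simeq> l' \<Colon> ListStar E"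
  have l: "LC E \<Gamma> \<turnstile> shift 7 l \<simeq> shift 7 l' \<Colon> ListStar (shift 7 E)" by (rule LC_wk_eq[OF a]) simp
  note v = LC_vars[OF a(1)]
  show ?thesis
    by (rule e_Id[OF e_refl[OF v(3)]] app_arr_eq[OF e_refl[OF v(6)]] recStar_eq[OF l] v)+
qed

lemma LimList_t: "\<lbrakk>\<Gamma> \<turnstile> E \<Colon> U; \<Gamma> \<turnstile> l \<Colon> ListStar E\<rbrakk> \<Longrightarrow> \<Gamma> \<turnstile> LimList E l \<Colon> U"
proof -
  assume a: "\<Gamma> \<turnstile> E \<Colon> U" "\<Gamma> \<turnstile> l \<Colon> ListStar E"
  note b = arr_U[OF LMorph_t[OF a(1)] LConcl_t[OF a], unfolded LC_def append.simps]
  show ?thesis unfolding LimList_def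
    by (rule LC_steps(1-7)[OF a(1), THEN t_Pi_impred] b)+
qed

lemma LimList_eq: "\<lbrakk>\<Gamma> \<turnstile> E \<Colon> U; \<Gamma> \<turnstile> l \<simeq> l' \<Colon> ListStar E\<rbrakk> \<Longrightarrow> \<Gamma> \<turnstile> LimList E l \<simeq> LimList E l' \<Colon> U"
proof -
  assume a: "\<Gamma> \<turnstile> E \<Colon> U" "\<Gamma> \<turnstile> l \<simeq> l' \<Colon> ListStar E"
  note b = arr_U_eq[OF LMorph_t[OF a(1)] LConcl_eq[OF a], unfolded LC_def append.simps]
  note s = LC_steps[OF a(1)]
  show ?thesis unfolding LimList_def
    by (rule s(1-7)[THEN Pi_eq] b)+
qed

lemma LimList_intro:
  assumes a: "\<Gamma> \<turnstile> E \<Colon> U" and t: "LMorph E # LC E \<Gamma> \<turnstile> t \<Colon> shift 1 (LConcl l)"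
  shows "\<exists>t. \<Gamma> \<turnstile> t \<Colon> LimList E l"
proof -
  note b = lam_arr[OF LMorph_t[OF a(1)] t, unfolded LC_def append.simps]
  show ?thesis unfolding LimList_def
    by (rule exI, (rule LC_steps(1-7)[OF a(1), THEN t_Lam] b)+)
qed

lemma LimList_elim:
  assumes "\<Gamma> \<turnstile> q \<Colon> LimList E l"
   "\<Gamma> \<turnstile> X \<Colon> U" "\<Gamma> \<turnstile> Y \<Colon> U" "\<Gamma> \<turnstile> x \<Colon> X" "\<Gamma> \<turnstile> y \<Colon> Y" "\<Gamma> \<turnstile> f \<Colon> arr X Y"
    "\<Gamma> \<turnstile> g \<Colon> arr E (arr X X)" "\<Gamma> \<turnstile> h \<Colon> arr E (arr Y Y)" "\<Gamma> \<turnstile> m \<Colon> MorphList E X x g Y y h f"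
  shows "\<exists>t. \<Gamma> \<turnstile> t \<Colon> Id Y (App f (recStar X x g l)) (recStar Y y h l)"
proof -
  note 1 = t_App[OF assms(1)[unfolded LimList_def] assms(2)]
  note 2 = t_App[OF 1[simplified] assms(3)]
  note 3 = t_App[OF 2[simplified] assms(4)]
  note 4 = t_App[OF 3[simplified] assms(5)]
  note 5 = t_App[OF 4[simplified] assms(6)]
  note 6 = t_App[OF 5[simplified] assms(7)]
  note 7 = t_App[OF 6[simplified] assms(8)]
  note 8 = app_arr[OF 7[simplified] assms(9)]
  show ?thesis by (rule exI, rule 8)
qed


lemma pi1_t: "\<lbrakk>\<Gamma> \<turnstile> A \<Colon> Univ n; A # \<Gamma> \<turnstile> B \<Colon> Univ m; \<Gamma> \<turnstile> p \<Colon> Sig A B\<rbrakk> \<Longrightarrow> \<Gamma> \<turnstile> pi1 p \<Colon> A"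
proof -
  assume a: "\<Gamma> \<turnstile> A \<Colon> Univ n" "A # \<Gamma> \<turnstile> B \<Colon> Univ m" "\<Gamma> \<turnstile> p \<Colon> Sig A B"
  have C: "Sig A B # \<Gamma> \<turnstile> shift 1 A \<Colon> Univ n" by (rule wk1[OF a(1) t_Sig_max[OF a(1,2)]]) simp
  have c: "ctx (B # A # \<Gamma>)" using a has_ctx ctx_Cons by meson
  have d: "B # A # \<Gamma> \<turnstile> Var 1 \<Colon> sub (Pair (Var 1) (Var 0) \<cdot> (\<lambda>k. Var (k + 2))) (shift 1 A)"
    by (rule t_Var_eq[OF c]) (simp_all add: eval_nat_numeral)
  show ?thesis using t_Split[OF a(1,2) C a(3) d] by (simp add: pi1_def)
qed

lemma pi1_beta: "\<lbrakk>\<Gamma> \<turnstile> A \<Colon> Univ n; A # \<Gamma> \<turnstile> B \<Colon> Univ m; \<Gamma> \<turnstile> a \<Colon> A; \<Gamma> \<turnstile> b \<Colon> inst B a\<rbrakk>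
  \<Longrightarrow> \<Gamma> \<turnstile> pi1 (Pair a b) \<simeq> a \<Colon> A"
proof -
  assume a: "\<Gamma> \<turnstile> A \<Colon> Univ n" "A # \<Gamma> \<turnstile> B \<Colon> Univ m" "\<Gamma> \<turnstile> a \<Colon> A" "\<Gamma> \<turnstile> b \<Colon> inst B a"
  have C: "Sig A B # \<Gamma> \<turnstile> shift 1 A \<Colon> Univ n" by (rule wk1[OF a(1) t_Sig_max[OF a(1,2)]]) simp
  have c: "ctx (B # A # \<Gamma>)" using a has_ctx ctx_Cons by meson
  have d: "B # A # \<Gamma> \<turnstile> Var 1 \<Colon> sub (Pair (Var 1) (Var 0) \<cdot> (\<lambda>k. Var (k + 2))) (shift 1 A)"
    by (rule t_Var_eq[OF c]) (simp_all add: eval_nat_numeral)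
  show ?thesis using e_Split_beta[OF a(1,2) C a(3,4) d] by (simp add: pi1_def)
qed

lemma pi2_prod_t: "\<lbrakk>\<Gamma> \<turnstile> A \<Colon> U; \<Gamma> \<turnstile> B \<Colon> U; \<Gamma> \<turnstile> p \<Colon> prodT A B\<rbrakk> \<Longrightarrow> \<Gamma> \<turnstile> pi2 p \<Colon> B"
proof -
  assume a: "\<Gamma> \<turnstile> A \<Colon> U" "\<Gamma> \<turnstile> B \<Colon> U" "\<Gamma> \<turnstile> p \<Colon> prodT A B"
  have B: "A # \<Gamma> \<turnstile> shift 1 B \<Colon> U" by (rule wk1[OF a(2,1)]) simp
  have C: "Sig A (shift 1 B) # \<Gamma> \<turnstile> shift 1 B \<Colon> U" by (rule wk1[OF a(2) t_Sig[OF a(1) B]]) simp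
  have d: "shift 1 B # A # \<Gamma> \<turnstile> Var 0 \<Colon> sub (Pair (Var 1) (Var 0) \<cdot> (\<lambda>k. Var (k + 2))) (shift 1 B)"
    by (rule var0[OF B]) (simp add: eval_nat_numeral)
  show ?thesis using t_Split[OF a(1) B C a(3)[unfolded prodT_def] d] by (simp add: pi2_def)
qed

lemma ListT_fam:
  assumes E: "\<Gamma> \<turnstile> E \<Colon> U"
  shows "ListStar E # \<Gamma> \<turnstile> LimList (shift 1 E) (Var 0) \<Colon> U"
proof (rule LimList_t)
  note S = ListStar_t[OF E]
  show "ListStar E # \<Gamma> \<turnstile> shift 1 E \<Colon> U" by (rule wk1[OF E S]) simp
  show "ListStar E # \<Gamma> \<turnstile> Var 0 \<Colon> ListStar (shift 1 E)" by (rule var0[OF S]) simp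
qed

lemma ListT_t: "\<Gamma> \<turnstile> E \<Colon> U \<Longrightarrow> \<Gamma> \<turnstile> ListT E \<Colon> U"
  unfolding ListT_def by (rule t_Sig[OF ListStar_t ListT_fam])

lemma ListT_pi1: "\<lbrakk>\<Gamma> \<turnstile> E \<Colon> U; \<Gamma> \<turnstile> l \<Colon> ListT E\<rbrakk> \<Longrightarrow> \<Gamma> \<turnstile> pi1 l \<Colon> ListStar E"
  unfolding ListT_def by (rule pi1_t[OF ListStar_t ListT_fam])

lemma ListT_pi2:
  assumes E: "\<Gamma> \<turnstile> E \<Colon> U" and l: "\<Gamma> \<turnstile> l \<Colon> ListT E"
  shows "\<Gamma> \<turnstile> pi2 l \<Colon> LimList E (pi1 l)"
proof -
  note S = ListStar_t[OF E] note F = ListT_fam[OF E] note T = ListT_t[OF E]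
  have E1: "ListT E # \<Gamma> \<turnstile> shift 1 E \<Colon> U" by (rule wk1[OF E T]) simp
  have v: "ListT E # \<Gamma> \<turnstile> Var 0 \<Colon> ListT (shift 1 E)" by (rule var0[OF T]) simp
  have C: "ListT E # \<Gamma> \<turnstile> LimList (shift 1 E) (pi1 (Var 0)) \<Colon> U"
    by (rule LimList_t[OF E1 ListT_pi1[OF E1 v]])
  let ?D = "LimList (shift 1 E) (Var 0) # ListStar E # \<Gamma>"
  have c: "ctx ?D" using F has_ctx ctx_Cons by meson
  have E2: "?D \<turnstile> shift 2 E \<Colon> U" by (rule wkn[OF E c]) simp_all
  have v1: "?D \<turnstile> Var 1 \<Colon> ListStar (shift 2 E)" by (rule t_Var_eq[OF c]) (simp_all add: eval_nat_numeral)
  have v0: "?D \<turnstile> Var 0 \<Colon> LimList (shift 2 E) (Var 1)" by (rule t_Var_eq[OF c]) (simp_all add: eval_nat_numeral)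
  have "?D \<turnstile> pi1 (Pair (Var 1) (Var 0)) \<simeq> Var 1 \<Colon> ListStar (shift 2 E)"
    by (rule pi1_beta[OF ListStar_t[OF E2] ListT_fam[OF E2] v1]) (use v0 in simp)
  then have "?D \<turnstile> LimList (shift 2 E) (Var 1) \<simeq> LimList (shift 2 E) (pi1 (Pair (Var 1) (Var 0))) \<Colon> U"
    by (rule LimList_eq[OF E2 e_sym])
  then have d: "?D \<turnstile> Var 0 \<Colon> LimList (shift 2 E) (pi1 (Pair (Var 1) (Var 0)))"
    by (rule t_Conv[OF v0])
  show ?thesis
    using t_Split[OF S F C[unfolded ListT_def] l[unfolded ListT_def], of "Var 0"] d by (simp add: pi2_def)
qed

lemma happly_t:
  assumes X: "\<Gamma> \<turnstile> X \<Colon> U" and Y: "\<Gamma> \<turnstile> Y \<Colon> U" and a: "\<Gamma> \<turnstile> a \<Colon> arr X Y" and b: "\<Gamma> \<turnstile> b \<Colon> arr X Y"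
    and p: "\<Gamma> \<turnstile> p \<Colon> Id (arr X Y) a b" and u: "\<Gamma> \<turnstile> u \<Colon> X"
  shows "\<exists>t. \<Gamma> \<turnstile> t \<Colon> Id Y (App a u) (App b u)"
proof -
  let ?A = "arr X Y" let ?C = "Id (shift 3 Y) (App (Var 2) (shift 3 u)) (App (Var 1) (shift 3 u))"
  note A = arr_U[OF X Y]
  have c1: "ctx (?A # \<Gamma>)" using A has_ctx ctx_Cons by meson
  have c: "ctx (Id (shift 2 ?A) (Var 1) (Var 0) # shift 1 ?A # ?A # \<Gamma>)"
  proof (rule ctx_J[OF has_ctx(2)[OF A] A])
    show 1: "?A # \<Gamma> \<turnstile> shift 1 ?A \<Colon> U" by (rule wk1[OF A A]) simp
    show "shift 1 ?A # ?A # \<Gamma> \<turnstile> shift 2 ?A \<Colon> U" by (rule wkn[OF A ctx_Cons[OF c1 1]]) simp_all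
  qed
  have C: "Id (shift 2 ?A) (Var 1) (Var 0) # shift 1 ?A # ?A # \<Gamma> \<turnstile> ?C \<Colon> U"
    by (intro t_Id app_arr[where A="shift 3 X"]; (rule wkn[OF Y c] wkn[OF u c] t_Var_eq[OF c]))
      (simp_all add: eval_nat_numeral)
  have d: "?A # \<Gamma> \<turnstile> Refl (App (Var 0) (shift 1 u)) \<Colon>
       sub (Refl (Var 0) \<cdot> Var 0 \<cdot> Var 0 \<cdot> (\<lambda>k. Var (k + 1))) ?C"
    apply (simp add: eval_nat_numeral)
    apply (rule t_Refl, rule app_arr[where A="shift 1 X"])
     apply (rule var0[OF A], simp)
    using wk1[OF u A, of "shift 1 X"] by simp
  show ?thesis using t_J[OF A C d a b p] by (auto simp: eval_nat_numeral)
qed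

lemma transport_t:
  assumes Y: "\<Gamma> \<turnstile> Y \<Colon> U" and h: "\<Gamma> \<turnstile> h \<Colon> arr Y Y" and a: "\<Gamma> \<turnstile> a \<Colon> Y" and b: "\<Gamma> \<turnstile> b \<Colon> Y"
    and p: "\<Gamma> \<turnstile> p \<Colon> Id Y a b" and w: "\<Gamma> \<turnstile> w \<Colon> Y" and q: "\<Gamma> \<turnstile> q \<Colon> Id Y w (App h a)"
  shows "\<exists>t. \<Gamma> \<turnstile> t \<Colon> Id Y w (App h b)"
proof -
  let ?C = "arr (Id (shift 3 Y) (shift 3 w) (App (shift 3 h) (Var 2)))
                (Id (shift 3 Y) (shift 3 w) (App (shift 3 h) (Var 1)))"
  have c1: "ctx (Y # \<Gamma>)" using Y has_ctx ctx_Cons by meson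
  have c: "ctx (Id (shift 2 Y) (Var 1) (Var 0) # shift 1 Y # Y # \<Gamma>)"
  proof (rule ctx_J[OF has_ctx(2)[OF Y] Y])
    show 1: "Y # \<Gamma> \<turnstile> shift 1 Y \<Colon> U" by (rule wk1[OF Y Y]) simp
    show "shift 1 Y # Y # \<Gamma> \<turnstile> shift 2 Y \<Colon> U" by (rule wkn[OF Y ctx_Cons[OF c1 1]]) simp_all
  qed
  have C: "Id (shift 2 Y) (Var 1) (Var 0) # shift 1 Y # Y # \<Gamma> \<turnstile> ?C \<Colon> U"
    by (intro arr_U t_Id app_arr[where A="shift 3 Y"];
        (rule wkn[OF Y c] wkn[OF h c] wkn[OF w c] t_Var_eq[OF c]))
      (simp_all add: eval_nat_numeral)
  have Y1: "Y # \<Gamma> \<turnstile> shift 1 Y \<Colon> U" by (rule wk1[OF Y Y]) simp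
  have T: "Y # \<Gamma> \<turnstile> Id (shift 1 Y) (shift 1 w) (App (shift 1 h) (Var 0)) \<Colon> U"
    by (rule t_Id[OF Y1], rule wk1[OF w Y], simp, rule app_arr, rule wk1[OF h Y], simp, rule var0[OF Y], simp)
  have d: "Y # \<Gamma> \<turnstile> Lam (Var 0) \<Colon> sub (Refl (Var 0) \<cdot> Var 0 \<cdot> Var 0 \<cdot> (\<lambda>k. Var (k + 1))) ?C"
    using lam_arr[OF T var0[OF T refl]] by (simp add: eval_nat_numeral)
  from t_J[OF Y C d a b p] have "\<Gamma> \<turnstile> J p (Lam (Var 0)) \<Colon> arr (Id Y w (App h a)) (Id Y w (App h b))"
    by (simp add: eval_nat_numeral)
  from app_arr[OF this q] show ?thesis by blast
qed

lemma lamR: "\<lbrakk>\<Gamma> \<turnstile> A \<Colon> Univ n; A # \<Gamma> \<turnstile> b \<Colon> B; C = Pi A B\<rbrakk> \<Longrightarrow> \<Gamma> \<turnstile> Lam b \<Colon> C"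
  using t_Lam by simp

lemma star_ctx:
  assumes E: "\<Gamma> \<turnstile> E \<Colon> U"
  shows "\<Gamma> \<turnstile> U \<Colon> Univ 1" "U # \<Gamma> \<turnstile> Var 0 \<Colon> U" "Var 0 # U # \<Gamma> \<turnstile> arr (shift 2 E) (arr (Var 1) (Var 1)) \<Colon> U"
    "ctx (arr (shift 2 E) (arr (Var 1) (Var 1)) # Var 0 # U # \<Gamma>)"
proof -
  show u: "\<Gamma> \<turnstile> U \<Colon> Univ 1" using has_ctx(2)[OF E] t_Univ[of _ 0] by simp
  show v: "U # \<Gamma> \<turnstile> Var 0 \<Colon> U" by (rule var0[OF u]) simp
  have c: "ctx (Var 0 # U # \<Gamma>)" using ctx_Cons[OF ctx_Cons[OF has_ctx(2)[OF E] u] v] .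
  show 3: "Var 0 # U # \<Gamma> \<turnstile> arr (shift 2 E) (arr (Var 1) (Var 1)) \<Colon> U"
    by (intro arr_U; (rule wkn[OF E c] t_Var_eq[OF c])) simp_all
  show "ctx (arr (shift 2 E) (arr (Var 1) (Var 1)) # Var 0 # U # \<Gamma>)" by (rule ctx_Cons[OF c 3])
qed

lemma shift_Pi: "shift 1 (Pi A (shift 1 B)) = Pi (shift 1 A) (shift 2 B)"
proof -
  have "shift 1 (Pi A (shift 1 B)) = Pi (shift 1 A) (ren (upr (\<lambda>k. k + 1)) (shift 1 B))"
    by (simp only: shift_def ren.simps)
  also have "ren (upr (\<lambda>k. k + 1)) (shift 1 B) = shift 1 (shift 1 B)"
    unfolding ren_upr'(3) by (simp only: shift_def)
  finally show ?thesis by (simp only: shift_shift one_add_one)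
qed

lemma arr_arr: "arr A (arr B C) = Pi A (Pi (shift 1 B) (shift 2 C))"
  unfolding arr_def[of A] arr_def[of B] shift_Pi ..

lemma ListStar_alt: "ListStar E = Pi U (Pi (Var 0) (Pi (arr (shift 2 E) (arr (Var 1) (Var 1))) (Var 2)))"
  unfolding ListStar_def arr_arr[of _ "arr (shift 1 E) _"] by (simp add: eval_nat_numeral)

lemma star_t:
  assumes E: "\<Gamma> \<turnstile> E \<Colon> U"
   and t: "arr (shift 2 E) (arr (Var 1) (Var 1)) # Var 0 # U # \<Gamma> \<turnstile> t \<Colon> Var 2"
  shows "\<Gamma> \<turnstile> Lam (Lam (Lam t)) \<Colon> ListStar E"
  unfolding ListStar_alt by (rule star_ctx(1-3)[OF E, THEN t_Lam] t)+

lemma star_beta: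
  assumes E: "\<Gamma> \<turnstile> E \<Colon> U" and X: "\<Gamma> \<turnstile> X \<Colon> U" and x: "\<Gamma> \<turnstile> x \<Colon> X" and g: "\<Gamma> \<turnstile> g \<Colon> arr E (arr X X)"
   and t: "arr (shift 2 E) (arr (Var 1) (Var 1)) # Var 0 # U # \<Gamma> \<turnstile> t \<Colon> Var 2"
   and t1: "shift 1 (arr E (arr X X)) # X # \<Gamma> \<turnstile> t1 \<Colon> shift 2 X"
   and t1_eq: "sub (up (up (X \<cdot> Var))) t = t1"
   and t2: "arr E (arr X X) # \<Gamma> \<turnstile> t2 \<Colon> shift 1 X" and t2_eq: "sub (up (x \<cdot> Var)) t1 = t2"
   and r: "sub (g \<cdot> Var) t2 = r"
 shows "\<Gamma> \<turnstile> recStar X x g (Lam (Lam (Lam t))) \<simeq> r \<Colon> X"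
proof -
  note s = star_ctx[OF E]
  have G: "\<Gamma> \<turnstile> arr E (arr X X) \<Colon> U" by (rule arr_U E X)+
  have G1: "X # \<Gamma> \<turnstile> shift 1 (arr E (arr X X)) \<Colon> U" by (rule wk1[OF G X]) simp
  have b: "U # \<Gamma> \<turnstile> Lam (Lam t) \<Colon> Pi (Var 0) (Pi (arr (shift 2 E) (arr (Var 1) (Var 1))) (Var 2))"
    by (rule s(2,3)[THEN t_Lam] t)+
  have 1: "\<Gamma> \<turnstile> App (Lam (Lam (Lam t))) X \<simeq> Lam (Lam t1) \<Colon> arr X (arr (arr E (arr X X)) X)"
  proof (rule beta_eq[OF s(1) b X])
    show "Lam (Lam t1) = inst (Lam (Lam t)) X" by (simp add: t1_eq)
    show "arr X (arr (arr E (arr X X)) X) = inst (Pi (Var 0) (Pi (arr (shift 2 E) (arr (Var 1) (Var 1))) (Var 2))) X"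
      unfolding arr_arr[of X "arr E (arr X X)" X] by (simp add: eval_nat_numeral)
  qed
  have 2: "\<Gamma> \<turnstile> App (App (Lam (Lam (Lam t))) X) x \<simeq> App (Lam (Lam t1)) x \<Colon> arr (arr E (arr X X)) X"
    by (rule app_arr_eq[OF 1 e_refl[OF x]])
  have b1: "X # \<Gamma> \<turnstile> Lam t1 \<Colon> shift 1 (arr (arr E (arr X X)) X)"
    using lam_arr[OF G1, of t1 "shift 1 X"] t1 by (simp add: eval_nat_numeral)
  have 3: "\<Gamma> \<turnstile> App (Lam (Lam t1)) x \<simeq> Lam t2 \<Colon> arr (arr E (arr X X)) X"
    by (rule beta_eq[OF X b1 x]) (simp_all add: t2_eq)
  have 4: "\<Gamma> \<turnstile> App (App (App (Lam (Lam (Lam t))) X) x) g \<simeq> App (Lam t2) g \<Colon> X"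
    by (rule app_arr_eq[OF e_trans[OF 2 3] e_refl[OF g]])
  have 5: "\<Gamma> \<turnstile> App (Lam t2) g \<simeq> r \<Colon> X"
    by (rule beta_eq[OF G t2 g]) (simp_all add: r)
  show ?thesis unfolding recStar_def by (rule e_trans[OF 4 5])
qed

lemma two_ctx:
  assumes X: "\<Gamma> \<turnstile> X \<Colon> U" and G: "\<Gamma> \<turnstile> G \<Colon> U"
  shows "ctx (shift 1 G # X # \<Gamma>)"
  by (rule ctx_Cons[OF ctx_Cons[OF has_ctx(2)[OF X] X] wk1[OF G X]]) simp

lemma nilStar_t: "\<Gamma> \<turnstile> E \<Colon> U \<Longrightarrow> \<Gamma> \<turnstile> nilStar \<Colon> ListStar E"
  unfolding nilStar_def
  by (rule star_t, assumption, rule t_Var_eq, erule star_ctx(4)) (simp_all add: eval_nat_numeral)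

lemma nilStar_beta:
  assumes E: "\<Gamma> \<turnstile> E \<Colon> U" and X: "\<Gamma> \<turnstile> X \<Colon> U" and x: "\<Gamma> \<turnstile> x \<Colon> X" and g: "\<Gamma> \<turnstile> g \<Colon> arr E (arr X X)"
  shows "\<Gamma> \<turnstile> recStar X x g nilStar \<simeq> x \<Colon> X"
  unfolding nilStar_def
proof (rule star_beta[OF E X x g])
  have G: "\<Gamma> \<turnstile> arr E (arr X X) \<Colon> U" by (rule arr_U E X)+
  show "arr (shift 2 E) (arr (Var 1) (Var 1)) # Var 0 # U # \<Gamma> \<turnstile> Var 1 \<Colon> Var 2"
    by (rule t_Var_eq[OF star_ctx(4)[OF E]]) (simp_all add: eval_nat_numeral)
  show "shift 1 (arr E (arr X X)) # X # \<Gamma> \<turnstile> Var 1 \<Colon> shift 2 X"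
    by (rule t_Var_eq[OF two_ctx[OF X G]]) (simp_all add: eval_nat_numeral)
  show "arr E (arr X X) # \<Gamma> \<turnstile> shift 1 x \<Colon> shift 1 X"
    by (rule wk1[OF x G refl])
qed simp_all

lemma cons_body: "\<lbrakk>\<Delta> \<turnstile> X \<Colon> U; \<Delta> \<turnstile> x \<Colon> X; \<Delta> \<turnstile> g \<Colon> arr E (arr X X); \<Delta> \<turnstile> e \<Colon> E; \<Delta> \<turnstile> l \<Colon> ListStar E\<rbrakk>
  \<Longrightarrow> \<Delta> \<turnstile> App (App g e) (App (App (App l X) x) g) \<Colon> X"
  by (rule app_arr, erule app_arr, assumption, fold recStar_def, rule recStar_t)

lemma cons_body_t:
  assumes E: "\<Gamma> \<turnstile> E \<Colon> U" and e: "\<Gamma> \<turnstile> e \<Colon> E" and l: "\<Gamma> \<turnstile> l \<Colon> ListStar E"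
  shows "arr (shift 2 E) (arr (Var 1) (Var 1)) # Var 0 # U # \<Gamma> \<turnstile>
    App (App (Var 0) (shift 3 e)) (App (App (App (shift 3 l) (Var 2)) (Var 1)) (Var 0)) \<Colon> Var 2"
  by (rule cons_body[where E = "shift 3 E"];
    (rule wkn[OF e star_ctx(4)[OF E]] wkn[OF l star_ctx(4)[OF E]] t_Var_eq[OF star_ctx(4)[OF E]]))
   (simp_all add: eval_nat_numeral)

lemma consStar_t: "\<lbrakk>\<Gamma> \<turnstile> E \<Colon> U; \<Gamma> \<turnstile> e \<Colon> E; \<Gamma> \<turnstile> l \<Colon> ListStar E\<rbrakk> \<Longrightarrow> \<Gamma> \<turnstile> consStar e l \<Colon> ListStar E"
  unfolding consStar_def by (rule star_t, assumption, rule cons_body_t)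

lemma consStar_beta:
  assumes E: "\<Gamma> \<turnstile> E \<Colon> U" and X: "\<Gamma> \<turnstile> X \<Colon> U" and x: "\<Gamma> \<turnstile> x \<Colon> X" and g: "\<Gamma> \<turnstile> g \<Colon> arr E (arr X X)"
   and e: "\<Gamma> \<turnstile> e \<Colon> E" and l: "\<Gamma> \<turnstile> l \<Colon> ListStar E"
 shows "\<Gamma> \<turnstile> recStar X x g (consStar e l) \<simeq> App (App g e) (recStar X x g l) \<Colon> X"
  unfolding consStar_def recStar_def[of X x g l]
proof (rule star_beta[OF E X x g cons_body_t[OF E e l]])
  have G: "\<Gamma> \<turnstile> arr E (arr X X) \<Colon> U" by (rule arr_U E X)+
  note c = two_ctx[OF X G]
  note c' = ctx_Cons[OF has_ctx(2)[OF X] G]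
  show "shift 1 (arr E (arr X X)) # X # \<Gamma> \<turnstile>
    App (App (Var 0) (shift 2 e)) (App (App (App (shift 2 l) (shift 2 X)) (Var 1)) (Var 0)) \<Colon> shift 2 X"
    by (rule cons_body[where E = "shift 2 E"];
    (rule wkn[OF e c] wkn[OF X c] wkn[OF l c] t_Var_eq[OF c]))
      (simp_all add: eval_nat_numeral)
  show "arr E (arr X X) # \<Gamma> \<turnstile>
    App (App (Var 0) (shift 1 e)) (App (App (App (shift 1 l) (shift 1 X)) (shift 1 x)) (Var 0)) \<Colon> shift 1 X"
    by (rule cons_body[where E = "shift 1 E"];
    (rule wkn[OF e c'] wkn[OF X c'] wkn[OF x c'] wkn[OF l c'] t_Var_eq[OF c']))
      (simp_all add: eval_nat_numeral)
qed (simp_all add: eval_nat_numeral)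

lemma Id_conv: "\<lbrakk>\<Gamma> \<turnstile> p \<Colon> Id A a b; \<Gamma> \<turnstile> A \<Colon> U; \<Gamma> \<turnstile> a \<simeq> a' \<Colon> A; \<Gamma> \<turnstile> b \<simeq> b' \<Colon> A\<rbrakk> \<Longrightarrow> \<Gamma> \<turnstile> p \<Colon> Id A a' b'"
  by (erule t_Conv) (rule e_Id, erule e_refl)

lemma LC_morph:
  assumes E: "\<Gamma> \<turnstile> E \<Colon> U"
  defines "\<Delta> \<equiv> LMorph E # LC E \<Gamma>"
  shows "ctx \<Delta>" "\<And>a A A'. \<Gamma> \<turnstile> a \<Colon> A \<Longrightarrow> A' = shift 8 A \<Longrightarrow> \<Delta> \<turnstile> shift 8 a \<Colon> A'"
   "\<Delta> \<turnstile> shift 8 E \<Colon> U" "\<Delta> \<turnstile> Var 7 \<Colon> U" "\<Delta> \<turnstile> Var 6 \<Colon> U" "\<Delta> \<turnstile> Var 5 \<Colon> Var 7" "\<Delta> \<turnstile> Var 4 \<Colon> Var 6"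
   "\<Delta> \<turnstile> Var 3 \<Colon> arr (Var 7) (Var 6)" "\<Delta> \<turnstile> Var 2 \<Colon> arr (shift 8 E) (arr (Var 7) (Var 7))"
   "\<Delta> \<turnstile> Var 1 \<Colon> arr (shift 8 E) (arr (Var 6) (Var 6))"
   "\<Delta> \<turnstile> Var 0 \<Colon> MorphList (shift 8 E) (Var 7) (Var 5) (Var 2) (Var 6) (Var 4) (Var 1) (Var 3)"
proof -
  show c: "ctx \<Delta>" unfolding \<Delta>_def by (rule ctx_Cons[OF LC_steps(8)[OF E] LMorph_t[OF E]])
  show w: "\<And>a A A'. \<Gamma> \<turnstile> a \<Colon> A \<Longrightarrow> A' = shift 8 A \<Longrightarrow> \<Delta> \<turnstile> shift 8 a \<Colon> A'"
    by (erule wkn[OF _ c]) (simp_all add: \<Delta>_def LC_def)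
  show "\<Delta> \<turnstile> shift 8 E \<Colon> U" by (rule w[OF E]) simp
  show "\<Delta> \<turnstile> Var 7 \<Colon> U" "\<Delta> \<turnstile> Var 6 \<Colon> U" "\<Delta> \<turnstile> Var 5 \<Colon> Var 7" "\<Delta> \<turnstile> Var 4 \<Colon> Var 6"
   "\<Delta> \<turnstile> Var 3 \<Colon> arr (Var 7) (Var 6)" "\<Delta> \<turnstile> Var 2 \<Colon> arr (shift 8 E) (arr (Var 7) (Var 7))"
   "\<Delta> \<turnstile> Var 1 \<Colon> arr (shift 8 E) (arr (Var 6) (Var 6))"
   "\<Delta> \<turnstile> Var 0 \<Colon> MorphList (shift 8 E) (Var 7) (Var 5) (Var 2) (Var 6) (Var 4) (Var 1) (Var 3)"
    by (rule t_Var_eq[OF c]; simp add: \<Delta>_def LC_def eval_nat_numeral)+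
qed

lemma Morph_pi:
  assumes "\<Gamma> \<turnstile> E \<Colon> U" "\<Gamma> \<turnstile> X \<Colon> U" "\<Gamma> \<turnstile> Y \<Colon> U" "\<Gamma> \<turnstile> x \<Colon> X" "\<Gamma> \<turnstile> y \<Colon> Y" "\<Gamma> \<turnstile> f \<Colon> arr X Y"
    "\<Gamma> \<turnstile> g \<Colon> arr E (arr X X)" "\<Gamma> \<turnstile> h \<Colon> arr E (arr Y Y)" and m: "\<Gamma> \<turnstile> m \<Colon> MorphList E X x g Y y h f"
  shows "\<Gamma> \<turnstile> pi1 m \<Colon> Id Y (App f x) y"
    "\<Gamma> \<turnstile> e \<Colon> E \<Longrightarrow> \<Gamma> \<turnstile> App (pi2 m) e \<Colon> Id (arr X Y) (compT f (App g e)) (compT (App h e) f)"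
proof -
  note M = MorphT[OF assms(1-8)]
  show "\<Gamma> \<turnstile> pi1 m \<Colon> Id Y (App f x) y"
    by (rule pi1_t[OF M(1) wk1[OF M(2,1) shift_Univ[symmetric]] m[unfolded MorphList_def prodT_def]])
  have "\<Gamma> \<turnstile> pi2 m \<Colon> Pi E (Id (shift 1 (arr X Y))
         (compT (shift 1 f) (App (shift 1 g) (Var 0)))
         (compT (App (shift 1 h) (Var 0)) (shift 1 f)))"
    by (rule pi2_prod_t[OF M(1,2)]) (use m in \<open>simp add: MorphList_def\<close>)
  then show "\<Gamma> \<turnstile> e \<Colon> E \<Longrightarrow> \<Gamma> \<turnstile> App (pi2 m) e \<Colon> Id (arr X Y) (compT f (App g e)) (compT (App h e) f)"
    by (erule_tac t_App_eq) simp_all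
qed

section \<open>The limit proofs for nil and cons exist\<close>

lemma NilLimT_inhabited:
  assumes E: "\<Gamma> \<turnstile> E \<Colon> U"
  shows "\<exists>p0. \<Gamma> \<turnstile> p0 \<Colon> NilLimT E"
  unfolding NilLimT_def
proof (rule LimList_intro[OF E])
  note v = LC_morph[OF E]
  note n = nilStar_beta[OF v(3), THEN e_sym]
  show "LMorph E # LC E \<Gamma> \<turnstile> pi1 (Var 0) \<Colon> shift 1 (LConcl nilStar)"
    using Id_conv[OF Morph_pi(1)[OF v(3-11)] v(5) app_arr_eq[OF e_refl[OF v(8)] n[OF v(4,6,9)]] n[OF v(5,7,10)]]
    by (simp add: eval_nat_numeral)
qed

lemma cons_step:
  assumes E: "\<Gamma> \<turnstile> E \<Colon> U" and X: "\<Gamma> \<turnstile> X \<Colon> U" and Y: "\<Gamma> \<turnstile> Y \<Colon> U" and x: "\<Gamma> \<turnstile> x \<Colon> X" and y: "\<Gamma> \<turnstile> y \<Colon> Y"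
    and f: "\<Gamma> \<turnstile> f \<Colon> arr X Y" and g: "\<Gamma> \<turnstile> g \<Colon> arr E (arr X X)" and h: "\<Gamma> \<turnstile> h \<Colon> arr E (arr Y Y)"
    and m: "\<Gamma> \<turnstile> m \<Colon> MorphList E X x g Y y h f"
    and e: "\<Gamma> \<turnstile> e \<Colon> E" and l: "\<Gamma> \<turnstile> l \<Colon> ListStar E" and q: "\<Gamma> \<turnstile> q \<Colon> LimList E l"
  shows "\<exists>t. \<Gamma> \<turnstile> t \<Colon> Id Y (App f (recStar X x g (consStar e l))) (recStar Y y h (consStar e l))"
proof -
  let ?u = "recStar X x g l" let ?v = "recStar Y y h l"
  have u: "\<Gamma> \<turnstile> ?u \<Colon> X" by (rule recStar_t[OF l X x g])
  have v: "\<Gamma> \<turnstile> ?v \<Colon> Y" by (rule recStar_t[OF l Y y h])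
  have ge: "\<Gamma> \<turnstile> App g e \<Colon> arr X X" by (rule app_arr[OF g e])
  have he: "\<Gamma> \<turnstile> App h e \<Colon> arr Y Y" by (rule app_arr[OF h e])
  obtain t2 where t2: "\<Gamma> \<turnstile> t2 \<Colon> Id Y (App f ?u) ?v"
    using LimList_elim[OF q X Y x y f g h m] by blast
  have fu: "\<Gamma> \<turnstile> App f ?u \<Colon> Y" by (rule app_arr[OF f u])
  obtain t1 where "\<Gamma> \<turnstile> t1 \<Colon> Id Y (App (compT f (App g e)) ?u) (App (compT (App h e) f) ?u)"
    using happly_t[OF X Y compT_t[OF X f ge] compT_t[OF X he f] Morph_pi(2)[OF E X Y x y f g h m e] u]
    by blast
  then have t1: "\<Gamma> \<turnstile> t1 \<Colon> Id Y (App f (App (App g e) ?u)) (App (App h e) (App f ?u))"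
    by (rule Id_conv[OF _ Y compT_beta[OF X f ge u] compT_beta[OF X he f u]])
  obtain t where t: "\<Gamma> \<turnstile> t \<Colon> Id Y (App f (App (App g e) ?u)) (App (App h e) ?v)"
    using transport_t[OF Y he fu v t2 app_arr[OF f app_arr[OF ge u]] t1] by blast
  show ?thesis
    using Id_conv[OF t Y app_arr_eq[OF e_refl[OF f] e_sym[OF consStar_beta[OF E X x g e l]]]
        e_sym[OF consStar_beta[OF E Y y h e l]]] by blast
qed

lemma cons_lim_aux:
  assumes E: "\<Gamma> \<turnstile> E \<Colon> U" and e: "\<Gamma> \<turnstile> e \<Colon> E" and l: "\<Gamma> \<turnstile> l \<Colon> ListStar E" and q: "\<Gamma> \<turnstile> q \<Colon> LimList E l"
  shows "\<exists>t. \<Gamma> \<turnstile> t \<Colon> LimList E (consStar e l)"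
proof -
  note v = LC_morph[OF E]
  have w: "LMorph E # LC E \<Gamma> \<turnstile> shift 8 e \<Colon> shift 8 E" "LMorph E # LC E \<Gamma> \<turnstile> shift 8 l \<Colon> ListStar (shift 8 E)"
     "LMorph E # LC E \<Gamma> \<turnstile> shift 8 q \<Colon> LimList (shift 8 E) (shift 8 l)"
    by (rule v(2)[OF e] v(2)[OF l] v(2)[OF q], simp)+
  obtain t where "LMorph E # LC E \<Gamma> \<turnstile> t \<Colon> shift 1 (LConcl (consStar e l))"
    using cons_step[OF v(3-11) w] by (auto simp: eval_nat_numeral)
  from LimList_intro[OF E this] show ?thesis .
qed

lemma ConsLimT_inhabited:
  assumes E: "\<Gamma> \<turnstile> E \<Colon> U"
  shows "\<exists>pc. \<Gamma> \<turnstile> pc \<Colon> ConsLimT E"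
proof -
  have E1: "E # \<Gamma> \<turnstile> shift 1 E \<Colon> U" by (rule wk1[OF E E]) simp
  note L = ListT_t[OF E1]
  let ?D = "shift 1 (ListT E) # E # \<Gamma>"
  have c: "ctx ?D" using ctx_Cons[OF has_ctx(2)[OF L] L] by simp
  have E2: "?D \<turnstile> shift 2 E \<Colon> U" by (rule wkn[OF E c]) simp_all
  have e: "?D \<turnstile> Var 1 \<Colon> shift 2 E" by (rule t_Var_eq[OF c]) (simp_all add: eval_nat_numeral)
  have l: "?D \<turnstile> Var 0 \<Colon> ListT (shift 2 E)" by (rule t_Var_eq[OF c]) (simp_all add: eval_nat_numeral)
  obtain t where t: "?D \<turnstile> t \<Colon> LimList (shift 2 E) (consStar (Var 1) (pi1 (Var 0)))"
    using cons_lim_aux[OF E2 e ListT_pi1[OF E2 l] ListT_pi2[OF E2 l]] by blast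
  have L': "E # \<Gamma> \<turnstile> shift 1 (ListT E) \<Colon> U" using L by simp
  show ?thesis unfolding ConsLimT_def by (rule exI, rule t_Lam[OF E t_Lam[OF L' t]])
qed

end

theory Submission
  imports Defs
begin

text \<open>
  Let \<open>L\<close> be \<open>List\<close> and \<open>T = \<Sigma> l : L. P l\<close>, which lies in the bottom universe. The induction
  hypotheses make \<open>T\<close> a list algebra such that \<open>\<pi>\<^sub>1 : T \<rightarrow> L\<close> is a morphism to \<open>(L, nil, cons)\<close>.
  For \<open>l : L\<close>, recursion into \<open>T\<close> gives \<open>r : T\<close>, and the limit condition of \<open>l\<close> for this morphism
  gives \<open>\<pi>\<^sub>1 r = k\<close> with \<open>k = rec* L nil cons (\<pi>\<^sub>1 l)\<close>. Next, \<open>k = l\<close>: for every algebra \<open>(X, x, g)\<close>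
  the map \<open>\<lambda>m. rec* X x g (\<pi>\<^sub>1 m)\<close> is a morphism from \<open>(L, nil, cons)\<close>, so the limit condition of \<open>l\<close>
  gives \<open>\<pi>\<^sub>1 k X x g = \<pi>\<^sub>1 l X x g\<close>; function extensionality yields \<open>\<pi>\<^sub>1 k = \<pi>\<^sub>1 l\<close>, and the limit
  components agree since \<open>LimList\<close> is a proposition by function extensionality and UIP.
  Transporting \<open>\<pi>\<^sub>2 r\<close> along \<open>\<pi>\<^sub>1 r = k = l\<close> proves \<open>P l\<close>.
\<close>

section \<open>Substitution and renaming through the list constructors\<close>

lemma sub_ren_nilT_consT [simp]: "sub \<sigma> (NilLimT E) = NilLimT (sub \<sigma> E)" "ren \<xi> (NilLimT E) = NilLimT (ren \<xi> E)"
  "sub \<sigma> (ConsLimT E) = ConsLimT (sub \<sigma> E)" "ren \<xi> (ConsLimT E) = ConsLimT (ren \<xi> E)"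
  "sub \<sigma> (nilT p0) = nilT (sub \<sigma> p0)" "ren \<xi> (nilT p0) = nilT (ren \<xi> p0)"
  "sub \<sigma> (consT pc e l) = consT (sub \<sigma> pc) (sub \<sigma> e) (sub \<sigma> l)"
  "ren \<xi> (consT pc e l) = consT (ren \<xi> pc) (ren \<xi> e) (ren \<xi> l)"
  by (simp_all add: NilLimT_def ConsLimT_def nilT_def consT_def eval_nat_numeral)

lemma shift_list_homs [simp]:
  "shift n (NilLimT E) = NilLimT (shift n E)"
  "shift n (ConsLimT E) = ConsLimT (shift n E)"
  "shift n (nilT p0) = nilT (shift n p0)"
  "shift n (consT pc e l) = consT (shift n pc) (shift n e) (shift n l)"
  "shift n (Pair a b) = Pair (shift n a) (shift n b)"
  by (simp_all add: shift_def)

section \<open>Identity types and propositions\<close>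

text \<open>Transport for a small predicate: \<open>J\<close> yields a function from
  \<open>P\<close> at one endpoint to \<open>P\<close> at the other, which is then applied to
  \<open>w\<close>.\<close>

lemma Id_subst_App:
  assumes A: "\<Gamma> \<turnstile> A \<Colon> U" and P: "\<Gamma> \<turnstile> P \<Colon> arr A U" and a: "\<Gamma> \<turnstile> a \<Colon> A" and b: "\<Gamma> \<turnstile> b \<Colon> A"
    and p: "\<Gamma> \<turnstile> p \<Colon> Id A a b" and w: "\<Gamma> \<turnstile> w \<Colon> App P a"
  shows "\<exists>t. \<Gamma> \<turnstile> t \<Colon> App P b"
proof -
  \<comment> \<open>In the motive \<open>Var 2\<close> and \<open>Var 1\<close> are the endpoints of
    the path. They coincide in the reflexivity case, which the identity function settles.\<close>
  let ?C = "arr (App (shift 3 P) (Var 2)) (App (shift 3 P) (Var 1))"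
  have c1: "ctx (A # \<Gamma>)" using A has_ctx ctx_Cons by meson
  have c: "ctx (Id (shift 2 A) (Var 1) (Var 0) # shift 1 A # A # \<Gamma>)"
  proof (rule ctx_J[OF has_ctx(2)[OF A] A])
    show 1: "A # \<Gamma> \<turnstile> shift 1 A \<Colon> U" by (rule wk1[OF A A]) simp
    show "shift 1 A # A # \<Gamma> \<turnstile> shift 2 A \<Colon> U" by (rule wkn[OF A ctx_Cons[OF c1 1]]) simp_all
  qed
  have C: "Id (shift 2 A) (Var 1) (Var 0) # shift 1 A # A # \<Gamma> \<turnstile> ?C \<Colon> U"
    by (intro arr_U app_arr[where A="shift 3 A"]; (rule wkn[OF P c] t_Var_eq[OF c]))
      (simp_all add: eval_nat_numeral)
  have T: "A # \<Gamma> \<turnstile> App (shift 1 P) (Var 0) \<Colon> U"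
    by (rule app_arr, rule wk1[OF P A], simp, rule var0[OF A], simp)
  have d: "A # \<Gamma> \<turnstile> Lam (Var 0) \<Colon> sub (Refl (Var 0) \<cdot> Var 0 \<cdot> Var 0 \<cdot> (\<lambda>k. Var (k + 1))) ?C"
    using lam_arr[OF T var0[OF T refl]] by (simp add: eval_nat_numeral)
  from t_J[OF A C d a b p] have "\<Gamma> \<turnstile> J p (Lam (Var 0)) \<Colon> arr (App P a) (App P b)"
    by (simp add: eval_nat_numeral)
  from app_arr[OF this w] show ?thesis by blast
qed

text \<open>An open type family becomes a predicate after abstraction. The two beta redexes at the
  endpoints are removed by conversion.\<close>

lemma Id_subst:
  assumes A: "\<Gamma> \<turnstile> A \<Colon> U" and D: "A # \<Gamma> \<turnstile> D \<Colon> U" and a: "\<Gamma> \<turnstile> a \<Colon> A" and b: "\<Gamma> \<turnstile> b \<Colon> A"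
    and p: "\<Gamma> \<turnstile> p \<Colon> Id A a b" and w: "\<Gamma> \<turnstile> w \<Colon> inst D a"
  shows "\<exists>t. \<Gamma> \<turnstile> t \<Colon> inst D b"
proof -
  have L: "\<Gamma> \<turnstile> Lam D \<Colon> arr A U" by (rule lam_arr[OF A]) (use D in simp)
  have beta: "\<Gamma> \<turnstile> App (Lam D) x \<simeq> inst D x \<Colon> U" if "\<Gamma> \<turnstile> x \<Colon> A" for x
    by (rule beta_eq[OF A D that]) simp_all
  show ?thesis
    using Id_subst_App[OF A L a b p t_Conv[OF w e_sym[OF beta[OF a]]]] t_Conv[OF _ beta[OF b]] by blast
qed

text \<open>Transport of reflexivity at \<open>a\<close> in the family of paths ending in
  \<open>a\<close>.\<close>

lemma Id_sym_inhabited: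
  assumes A: "\<Gamma> \<turnstile> A \<Colon> U" and a: "\<Gamma> \<turnstile> a \<Colon> A" and b: "\<Gamma> \<turnstile> b \<Colon> A" and p: "\<Gamma> \<turnstile> p \<Colon> Id A a b"
  shows "\<exists>t. \<Gamma> \<turnstile> t \<Colon> Id A b a"
proof -
  have D: "A # \<Gamma> \<turnstile> Id (shift 1 A) (Var 0) (shift 1 a) \<Colon> U"
    by (intro t_Id; (rule wk1[OF A A] wk1[OF a A] var0[OF A])) simp_all
  show ?thesis using Id_subst[OF A D a b p] t_Refl[OF a] by simp
qed

text \<open>Transport of \<open>p\<close> along \<open>q\<close> in the family of paths starting at
  \<open>a\<close>.\<close>

lemma Id_trans_inhabited:
  assumes A: "\<Gamma> \<turnstile> A \<Colon> U" and a: "\<Gamma> \<turnstile> a \<Colon> A" and b: "\<Gamma> \<turnstile> b \<Colon> A" and c: "\<Gamma> \<turnstile> c \<Colon> A"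
    and p: "\<Gamma> \<turnstile> p \<Colon> Id A a b" and q: "\<Gamma> \<turnstile> q \<Colon> Id A b c"
  shows "\<exists>t. \<Gamma> \<turnstile> t \<Colon> Id A a c"
proof -
  have D: "A # \<Gamma> \<turnstile> Id (shift 1 A) (shift 1 a) (Var 0) \<Colon> U"
    by (intro t_Id; (rule wk1[OF A A] wk1[OF a A] var0[OF A])) simp_all
  show ?thesis using Id_subst[OF A D b c q] p by simp
qed

text \<open>Renaming \<open>B\<close> under its binder and then putting the new variable in the
  bound place composes to the identity substitution, so exactly \<open>B\<close> returns. This types
  the pointwise sides in function extensionality.\<close>

lemma app_shift_Var0:
  assumes A: "\<Gamma> \<turnstile> A \<Colon> Univ n" and f: "\<Gamma> \<turnstile> f \<Colon> Pi A B"
  shows "A # \<Gamma> \<turnstile> App (shift 1 f) (Var 0) \<Colon> B"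
proof (rule t_App_eq)
  show "A # \<Gamma> \<turnstile> shift 1 f \<Colon> Pi (shift 1 A) (ren (upr (\<lambda>k. k + 1)) B)"
    by (rule wk1[OF f A]) (simp add: shift_def)
  show "A # \<Gamma> \<turnstile> Var 0 \<Colon> shift 1 A" by (rule var0[OF A]) simp
  have "(Var 0 \<cdot> Var) \<circ> upr (\<lambda>k. k + 1) = Var" by (rule ext, case_tac x) auto
  then show "B = inst (ren (upr (\<lambda>k. k + 1)) B) (Var 0)" by (simp only: sub_ren sub_Var)
qed

section \<open>Function extensionality and propositions\<close>

lemma funext_inhabited:
  assumes "\<Gamma> \<turnstile> A \<Colon> Univ n" "A # \<Gamma> \<turnstile> B \<Colon> Univ m" "\<Gamma> \<turnstile> f \<Colon> Pi A B" "\<Gamma> \<turnstile> g \<Colon> Pi A B"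
    and "\<exists>t. A # \<Gamma> \<turnstile> t \<Colon> Id B (App (shift 1 f) (Var 0)) (App (shift 1 g) (Var 0))"
  shows "\<exists>t. \<Gamma> \<turnstile> t \<Colon> Id (Pi A B) f g"
  using assms by (meson t_Funext t_Lam)

text \<open>A meta-level form of being a proposition: it ranges over the terms typable in one fixed
  context. The context is a parameter so that the property can be proved under binders and then
  moved outwards.\<close>

definition isprop :: "tm list \<Rightarrow> tm \<Rightarrow> bool" where
  "isprop \<Gamma> A \<longleftrightarrow> (\<forall>u v. \<Gamma> \<turnstile> u \<Colon> A \<longrightarrow> \<Gamma> \<turnstile> v \<Colon> A \<longrightarrow> (\<exists>t. \<Gamma> \<turnstile> t \<Colon> Id A u v))"

text \<open>Function extensionality reduces the claim to the codomain in the extended context.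
  Smallness is carried along, by impredicativity for any level of \<open>A\<close>, so that the rule
  can be iterated over a chain of binders.\<close>

lemma isprop_Pi: "\<lbrakk>\<Gamma> \<turnstile> A \<Colon> Univ n; A # \<Gamma> \<turnstile> B \<Colon> U \<and> isprop (A # \<Gamma>) B\<rbrakk>
    \<Longrightarrow> \<Gamma> \<turnstile> Pi A B \<Colon> U \<and> isprop \<Gamma> (Pi A B)"
  unfolding isprop_def by (blast intro: t_Pi_impred funext_inhabited app_shift_Var0)

lemma isprop_Id: "\<lbrakk>\<Gamma> \<turnstile> A \<Colon> Univ n; \<Gamma> \<turnstile> a \<Colon> A; \<Gamma> \<turnstile> b \<Colon> A\<rbrakk> \<Longrightarrow> isprop \<Gamma> (Id A a b)"
  unfolding isprop_def by (blast intro: t_Uip)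

text \<open>The endpoint typings that UIP needs for the equation at the end of a limit
  condition.\<close>

lemma LConcl_typed:
  assumes E: "\<Gamma> \<turnstile> E \<Colon> U" and l: "\<Gamma> \<turnstile> l \<Colon> ListStar E"
  shows "LC E \<Gamma> \<turnstile> App (Var 2) (recStar (Var 6) (Var 4) (Var 1) (shift 7 l)) \<Colon> Var 5"
    "LC E \<Gamma> \<turnstile> recStar (Var 5) (Var 3) (Var 0) (shift 7 l) \<Colon> Var 5"
proof -
  have l: "LC E \<Gamma> \<turnstile> shift 7 l \<Colon> ListStar (shift 7 E)" by (rule LC_wk[OF E l]) simp
  note v = LC_vars[OF E]
  show "LC E \<Gamma> \<turnstile> App (Var 2) (recStar (Var 6) (Var 4) (Var 1) (shift 7 l)) \<Colon> Var 5"
    "LC E \<Gamma> \<turnstile> recStar (Var 5) (Var 3) (Var 0) (shift 7 l) \<Colon> Var 5"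
    by (rule app_arr[OF v(6)] recStar_t[OF l] v)+
qed

text \<open>A limit condition is an iterated product ending in an identity type: UIP handles the
  end, and \<open>isprop_Pi\<close> climbs back over the binders.\<close>

lemma isprop_LimList:
  assumes E: "\<Gamma> \<turnstile> E \<Colon> U" and l: "\<Gamma> \<turnstile> l \<Colon> ListStar E"
  shows "isprop \<Gamma> (LimList E l)"
proof -
  note M = LMorph_t[OF E] and C = LConcl_t[OF E l] and v = LC_vars[OF E] and t = LConcl_typed[OF E l]
  let ?D = "LMorph E # LC E \<Gamma>"
  have "?D \<turnstile> shift 1 (LConcl l) \<Colon> U \<and> isprop ?D (shift 1 (LConcl l))"
    unfolding shift_homs(13)
    by (intro conjI t_Id isprop_Id; (rule wk1[OF v(3) M] wk1[OF t(1) M] wk1[OF t(2) M])) simp_all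
  \<comment> \<open>The morphism hypothesis is the innermost binder; the seven binders of
    \<open>LC\<close> follow.\<close>
  note b = isprop_Pi[OF M this, folded arr_def, unfolded LC_def append.simps]
  have "\<Gamma> \<turnstile> LimList E l \<Colon> U \<and> isprop \<Gamma> (LimList E l)"
    unfolding LimList_def by (rule LC_steps(1-7)[OF E, THEN isprop_Pi] b)+
  then show ?thesis ..
qed

section \<open>Equality of encoded lists\<close>

text \<open>Function extensionality three times, once each for carrier, point and operation. The
  form \<open>ListStar_alt\<close> exposes the three nested products.\<close>

lemma ListStar_ext:
  assumes E: "\<Gamma> \<turnstile> E \<Colon> U" and k: "\<Gamma> \<turnstile> k \<Colon> ListStar E" and l: "\<Gamma> \<turnstile> l \<Colon> ListStar E"
    and t: "\<exists>t. arr (shift 2 E) (arr (Var 1) (Var 1)) # Var 0 # U # \<Gamma> \<turnstile> t \<Colon>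
      Id (Var 2) (recStar (Var 2) (Var 1) (Var 0) (shift 3 k)) (recStar (Var 2) (Var 1) (Var 0) (shift 3 l))"
  shows "\<exists>t. \<Gamma> \<turnstile> t \<Colon> Id (ListStar E) k l"
proof -
  note s = star_ctx[OF E]
  let ?G = "arr (shift 2 E) (arr (Var 1) (Var 1))"
  have 3: "?G # Var 0 # U # \<Gamma> \<turnstile> Var 2 \<Colon> U" by (rule t_Var_eq[OF s(4)]) (simp_all add: eval_nat_numeral)
  note 2 = t_Pi_impred[OF s(3) 3]
  note 1 = t_Pi_impred[OF s(2) 2]
  \<comment> \<open>The partial applications to one and two generic arguments are the functions
    compared at the intermediate stages.\<close>
  have app: "U # \<Gamma> \<turnstile> App (shift 1 m) (Var 0) \<Colon> Pi (Var 0) (Pi ?G (Var 2))"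
    "Var 0 # U # \<Gamma> \<turnstile> App (App (shift 2 m) (Var 1)) (Var 0) \<Colon> Pi ?G (Var 2)" if m: "\<Gamma> \<turnstile> m \<Colon> ListStar E" for m
  proof -
    show a: "U # \<Gamma> \<turnstile> App (shift 1 m) (Var 0) \<Colon> Pi (Var 0) (Pi ?G (Var 2))"
      by (rule app_shift_Var0[OF s(1) m[unfolded ListStar_alt]])
    show "Var 0 # U # \<Gamma> \<turnstile> App (App (shift 2 m) (Var 1)) (Var 0) \<Colon> Pi ?G (Var 2)"
      using app_shift_Var0[OF s(2) a] by (simp add: eval_nat_numeral)
  qed
  have "\<exists>t. Var 0 # U # \<Gamma> \<turnstile> t \<Colon> Id (Pi ?G (Var 2)) (App (App (shift 2 k) (Var 1)) (Var 0)) (App (App (shift 2 l) (Var 1)) (Var 0))"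
    by (rule funext_inhabited[OF s(3) 3 app(2)[OF k] app(2)[OF l]])
      (use t in \<open>simp add: recStar_def eval_nat_numeral\<close>)
  then have "\<exists>t. U # \<Gamma> \<turnstile> t \<Colon> Id (Pi (Var 0) (Pi ?G (Var 2))) (App (shift 1 k) (Var 0)) (App (shift 1 l) (Var 0))"
    by (intro funext_inhabited[OF s(2) 2 app(1)[OF k] app(1)[OF l]]) (simp add: eval_nat_numeral)
  then show ?thesis
    unfolding ListStar_alt by (rule funext_inhabited[OF s(1) 1 k[unfolded ListStar_alt] l[unfolded ListStar_alt]])
qed

lemma ListT_pair: "\<lbrakk>\<Gamma> \<turnstile> E \<Colon> U; \<Gamma> \<turnstile> a \<Colon> ListStar E; \<Gamma> \<turnstile> b \<Colon> LimList E a\<rbrakk> \<Longrightarrow> \<Gamma> \<turnstile> Pair a b \<Colon> ListT E"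
  unfolding ListT_def by (rule t_Pair[OF ListStar_t ListT_fam]) simp_all

lemma ListT_pi1_beta: "\<lbrakk>\<Gamma> \<turnstile> E \<Colon> U; \<Gamma> \<turnstile> a \<Colon> ListStar E; \<Gamma> \<turnstile> b \<Colon> LimList E a\<rbrakk>
    \<Longrightarrow> \<Gamma> \<turnstile> pi1 (Pair a b) \<simeq> a \<Colon> ListStar E"
  by (rule pi1_beta[OF ListStar_t ListT_fam]) simp_all

text \<open>Two limit proofs over the same \<open>a\<close> are equal because limit conditions are
  propositions; transport in the second component turns this into an equality of pairs.\<close>

lemma ListT_pair_eq_snd:
  assumes E: "\<Gamma> \<turnstile> E \<Colon> U" and a: "\<Gamma> \<turnstile> a \<Colon> ListStar E" and b: "\<Gamma> \<turnstile> b \<Colon> LimList E a" and c: "\<Gamma> \<turnstile> c \<Colon> LimList E a"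
  shows "\<exists>t. \<Gamma> \<turnstile> t \<Colon> Id (ListT E) (Pair a b) (Pair a c)"
proof -
  note L = LimList_t[OF E a]
  have w: "LimList E a # \<Gamma> \<turnstile> shift 1 E \<Colon> U" "LimList E a # \<Gamma> \<turnstile> shift 1 a \<Colon> ListStar (shift 1 E)"
    "LimList E a # \<Gamma> \<turnstile> shift 1 b \<Colon> LimList (shift 1 E) (shift 1 a)"
    "LimList E a # \<Gamma> \<turnstile> Var 0 \<Colon> LimList (shift 1 E) (shift 1 a)"
    by (rule wk1[OF E L] wk1[OF a L] wk1[OF b L] var0[OF L]; simp)+
  have D: "LimList E a # \<Gamma> \<turnstile> Id (ListT (shift 1 E)) (Pair (shift 1 a) (shift 1 b)) (Pair (shift 1 a) (Var 0)) \<Colon> U"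
    by (rule t_Id[OF ListT_t[OF w(1)] ListT_pair[OF w(1-3)] ListT_pair[OF w(1,2,4)]])
  obtain p where p: "\<Gamma> \<turnstile> p \<Colon> Id (LimList E a) b c"
    using isprop_LimList[OF E a] b c by (auto simp: isprop_def)
  show ?thesis using Id_subst[OF L D b c p] t_Refl[OF ListT_pair[OF E a b]] by simp
qed

text \<open>The proofs \<open>b\<close> and \<open>b'\<close> have different types, so transport
  alone cannot compare them. The family \<open>?D\<close> instead quantifies over all limit proofs
  of the varying first component: it holds at \<open>a\<close> by the case of equal first
  components, is moved to \<open>a'\<close> along \<open>p\<close>, and is then applied to
  \<open>b'\<close>.\<close>

lemma ListT_pair_eq:
  assumes E: "\<Gamma> \<turnstile> E \<Colon> U" and a: "\<Gamma> \<turnstile> a \<Colon> ListStar E" and a': "\<Gamma> \<turnstile> a' \<Colon> ListStar E"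
    and p: "\<Gamma> \<turnstile> p \<Colon> Id (ListStar E) a a'"
    and b: "\<Gamma> \<turnstile> b \<Colon> LimList E a" and b': "\<Gamma> \<turnstile> b' \<Colon> LimList E a'"
  shows "\<exists>t. \<Gamma> \<turnstile> t \<Colon> Id (ListT E) (Pair a b) (Pair a' b')"
proof -
  note S = ListStar_t[OF E] and F = ListT_fam[OF E] and L = LimList_t[OF E a]
  let ?I = "Id (ListT (shift 2 E)) (Pair (shift 2 a) (shift 2 b)) (Pair (Var 1) (Var 0))"
  let ?D = "Pi (LimList (shift 1 E) (Var 0)) ?I"
  have c: "ctx (LimList (shift 1 E) (Var 0) # ListStar E # \<Gamma>)" using F has_ctx ctx_Cons by meson
  have w2: "LimList (shift 1 E) (Var 0) # ListStar E # \<Gamma> \<turnstile> shift 2 E \<Colon> U"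
    "LimList (shift 1 E) (Var 0) # ListStar E # \<Gamma> \<turnstile> shift 2 a \<Colon> ListStar (shift 2 E)"
    "LimList (shift 1 E) (Var 0) # ListStar E # \<Gamma> \<turnstile> shift 2 b \<Colon> LimList (shift 2 E) (shift 2 a)"
    by (rule wkn[OF E c] wkn[OF a c] wkn[OF b c]; simp)+
  have v2: "LimList (shift 1 E) (Var 0) # ListStar E # \<Gamma> \<turnstile> Var 1 \<Colon> ListStar (shift 2 E)"
    "LimList (shift 1 E) (Var 0) # ListStar E # \<Gamma> \<turnstile> Var 0 \<Colon> LimList (shift 2 E) (Var 1)"
    by (rule t_Var_eq[OF c]; simp add: eval_nat_numeral)+
  have D: "ListStar E # \<Gamma> \<turnstile> ?D \<Colon> U"
    by (rule t_Pi[OF F t_Id[OF ListT_t[OF w2(1)] ListT_pair[OF w2] ListT_pair[OF w2(1) v2]]])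
  have w: "LimList E a # \<Gamma> \<turnstile> shift 1 E \<Colon> U" "LimList E a # \<Gamma> \<turnstile> shift 1 a \<Colon> ListStar (shift 1 E)"
    "LimList E a # \<Gamma> \<turnstile> shift 1 b \<Colon> LimList (shift 1 E) (shift 1 a)"
    "LimList E a # \<Gamma> \<turnstile> Var 0 \<Colon> LimList (shift 1 E) (shift 1 a)"
    by (rule wk1[OF E L] wk1[OF a L] wk1[OF b L] var0[OF L]; simp)+
  obtain q where "LimList E a # \<Gamma> \<turnstile> q \<Colon>
      Id (ListT (shift 1 E)) (Pair (shift 1 a) (shift 1 b)) (Pair (shift 1 a) (Var 0))"
    using ListT_pair_eq_snd[OF w] by blast
  then have q: "\<Gamma> \<turnstile> Lam q \<Colon> inst ?D a"
    using t_Lam[OF L] by (simp add: eval_nat_numeral)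
  obtain r where r: "\<Gamma> \<turnstile> r \<Colon> inst ?D a'" using Id_subst[OF S D a a' p q] by blast
  have "\<Gamma> \<turnstile> App r b' \<Colon> Id (ListT E) (Pair a b) (Pair a' b')"
  proof (rule t_App_eq[OF _ b'])
    show "\<Gamma> \<turnstile> r \<Colon> Pi (LimList E a')
        (Id (ListT (shift 1 E)) (Pair (shift 1 a) (shift 1 b)) (Pair (shift 1 a') (Var 0)))"
      using r by (simp add: eval_nat_numeral)
  qed simp
  then show ?thesis ..
qed

text \<open>Eta for lists up to identity, by the dependent eliminator. On a literal pair the first
  components agree by beta, and \<open>ListT_pair_eq\<close> absorbs any difference between the
  limit proofs.\<close>

lemma ListT_eta:
  assumes E: "\<Gamma> \<turnstile> E \<Colon> U" and l: "\<Gamma> \<turnstile> l \<Colon> ListT E"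
  shows "\<exists>t. \<Gamma> \<turnstile> t \<Colon> Id (ListT E) (Pair (pi1 l) (pi2 l)) l"
proof -
  note S = ListStar_t[OF E] note F = ListT_fam[OF E] note T = ListT_t[OF E]
  have E1: "ListT E # \<Gamma> \<turnstile> shift 1 E \<Colon> U" by (rule wk1[OF E T]) simp
  have v: "ListT E # \<Gamma> \<turnstile> Var 0 \<Colon> ListT (shift 1 E)" by (rule var0[OF T]) simp
  let ?C = "Id (ListT (shift 1 E)) (Pair (pi1 (Var 0)) (pi2 (Var 0))) (Var 0)"
  have C: "ListT E # \<Gamma> \<turnstile> ?C \<Colon> U"
    by (rule t_Id[OF ListT_t[OF E1] ListT_pair[OF E1 ListT_pi1[OF E1 v] ListT_pi2[OF E1 v]] v])
  let ?D = "LimList (shift 1 E) (Var 0) # ListStar E # \<Gamma>"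
  have c: "ctx ?D" using F has_ctx ctx_Cons by meson
  have E2: "?D \<turnstile> shift 2 E \<Colon> U" by (rule wkn[OF E c]) simp_all
  have v1: "?D \<turnstile> Var 1 \<Colon> ListStar (shift 2 E)" by (rule t_Var_eq[OF c]) (simp_all add: eval_nat_numeral)
  have v0: "?D \<turnstile> Var 0 \<Colon> LimList (shift 2 E) (Var 1)" by (rule t_Var_eq[OF c]) (simp_all add: eval_nat_numeral)
  note w = ListT_pair[OF E2 v1 v0]
  note pi = ListT_pi1[OF E2 w] ListT_pi2[OF E2 w]
  have "?D \<turnstile> Refl (Var 1) \<Colon> Id (ListStar (shift 2 E)) (pi1 (Pair (Var 1) (Var 0))) (Var 1)"
    by (rule Id_conv[OF t_Refl[OF v1] ListStar_t[OF E2] e_sym[OF ListT_pi1_beta[OF E2 v1 v0]] e_refl[OF v1]])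
  from ListT_pair_eq[OF E2 pi(1) v1 this pi(2) v0] obtain d where
    "?D \<turnstile> d \<Colon> Id (ListT (shift 2 E)) (Pair (pi1 (Pair (Var 1) (Var 0))) (pi2 (Pair (Var 1) (Var 0)))) (Pair (Var 1) (Var 0))"
    by blast
  then have "?D \<turnstile> d \<Colon> sub (Pair (Var 1) (Var 0) \<cdot> (\<lambda>k. Var (k + 2))) ?C" by simp
  from t_Split[OF S F C[unfolded ListT_def] l[unfolded ListT_def] this[unfolded ListT_def]]
  show ?thesis by (auto simp: ListT_def)
qed

text \<open>Both lists are replaced by the pairs of their projections, where only the underlying
  encodings matter.\<close>

lemma ListT_ext:
  assumes E: "\<Gamma> \<turnstile> E \<Colon> U" and k: "\<Gamma> \<turnstile> k \<Colon> ListT E" and l: "\<Gamma> \<turnstile> l \<Colon> ListT E"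
    and p: "\<Gamma> \<turnstile> p \<Colon> Id (ListStar E) (pi1 k) (pi1 l)"
  shows "\<exists>t. \<Gamma> \<turnstile> t \<Colon> Id (ListT E) k l"
proof -
  note T = ListT_t[OF E] and pk = ListT_pi1[OF E k] ListT_pi2[OF E k] and pl = ListT_pi1[OF E l] ListT_pi2[OF E l]
  note k' = ListT_pair[OF E pk] and l' = ListT_pair[OF E pl]
  have "\<exists>t. \<Gamma> \<turnstile> t \<Colon> Id (ListT E) k (Pair (pi1 k) (pi2 k))"
    using ListT_eta[OF E k] Id_sym_inhabited[OF T k' k] by blast
  moreover have "\<exists>t. \<Gamma> \<turnstile> t \<Colon> Id (ListT E) (Pair (pi1 k) (pi2 k)) (Pair (pi1 l) (pi2 l))"
    by (rule ListT_pair_eq[OF E pk(1) pl(1) p pk(2) pl(2)])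
  ultimately show ?thesis
    using ListT_eta[OF E l] Id_trans_inhabited[OF T k k' l'] Id_trans_inhabited[OF T k l' l] by blast
qed

section \<open>Morphisms of list algebras\<close>

text \<open>When both algebra laws hold judgementally, reflexivity proves them. Function
  extensionality is used only to pass from points to the composites in the second law. In
  \<open>e2\<close>, \<open>Var 1\<close> is the element of \<open>E\<close> and
  \<open>Var 0\<close> the point of \<open>X\<close>.\<close>

lemma MorphList_intro:
  assumes E: "\<Gamma> \<turnstile> E \<Colon> U" and X: "\<Gamma> \<turnstile> X \<Colon> U" and Y: "\<Gamma> \<turnstile> Y \<Colon> U" and x: "\<Gamma> \<turnstile> x \<Colon> X" and y: "\<Gamma> \<turnstile> y \<Colon> Y"
    and f: "\<Gamma> \<turnstile> f \<Colon> arr X Y" and g: "\<Gamma> \<turnstile> g \<Colon> arr E (arr X X)" and h: "\<Gamma> \<turnstile> h \<Colon> arr E (arr Y Y)"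
    and e1: "\<Gamma> \<turnstile> App f x \<simeq> y \<Colon> Y"
    and e2: "shift 1 X # E # \<Gamma> \<turnstile> App (shift 2 f) (App (App (shift 2 g) (Var 1)) (Var 0))
      \<simeq> App (App (shift 2 h) (Var 1)) (App (shift 2 f) (Var 0)) \<Colon> shift 2 Y"
  shows "\<exists>m. \<Gamma> \<turnstile> m \<Colon> MorphList E X x g Y y h f"
proof -
  note M = MorphT[OF E X Y x y f g h]
  have t1: "\<Gamma> \<turnstile> Refl y \<Colon> Id Y (App f x) y"
    by (rule Id_conv[OF t_Refl[OF y] Y e_sym[OF e1] e_refl[OF y]])
  have w: "E # \<Gamma> \<turnstile> shift 1 X \<Colon> U" "E # \<Gamma> \<turnstile> shift 1 Y \<Colon> U" "E # \<Gamma> \<turnstile> shift 1 f \<Colon> arr (shift 1 X) (shift 1 Y)"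
    "E # \<Gamma> \<turnstile> shift 1 g \<Colon> arr (shift 1 E) (arr (shift 1 X) (shift 1 X))"
    "E # \<Gamma> \<turnstile> shift 1 h \<Colon> arr (shift 1 E) (arr (shift 1 Y) (shift 1 Y))"
    "E # \<Gamma> \<turnstile> Var 0 \<Colon> shift 1 E"
    by (rule wk1[OF X E] wk1[OF Y E] wk1[OF f E] wk1[OF g E] wk1[OF h E] var0[OF E]; simp)+
  note ge = app_arr[OF w(4,6)] and he = app_arr[OF w(5,6)]
  let ?D = "shift 1 X # E # \<Gamma>"
  have c: "ctx ?D" using w(1) has_ctx ctx_Cons by meson
  have w2: "?D \<turnstile> shift 2 X \<Colon> U" "?D \<turnstile> shift 2 Y \<Colon> U" "?D \<turnstile> shift 2 f \<Colon> arr (shift 2 X) (shift 2 Y)"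
    "?D \<turnstile> shift 2 g \<Colon> arr (shift 2 E) (arr (shift 2 X) (shift 2 X))"
    "?D \<turnstile> shift 2 h \<Colon> arr (shift 2 E) (arr (shift 2 Y) (shift 2 Y))"
    "?D \<turnstile> Var 1 \<Colon> shift 2 E" "?D \<turnstile> Var 0 \<Colon> shift 2 X"
    by ((rule wkn[OF X c] wkn[OF Y c] wkn[OF f c] wkn[OF g c] wkn[OF h c] t_Var_eq[OF c]); simp add: eval_nat_numeral)+
  note ge2 = app_arr[OF w2(4,6)] and he2 = app_arr[OF w2(5,6)]
  note gu = app_arr[OF w2(3) app_arr[OF ge2 w2(7)]]
  \<comment> \<open>Each composite applied to the generic point reduces to one side of
    \<open>e2\<close>.\<close>
  have "?D \<turnstile> Refl (App (shift 2 f) (App (App (shift 2 g) (Var 1)) (Var 0))) \<Colon> Id (shift 2 Y)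
      (App (compT (shift 2 f) (App (shift 2 g) (Var 1))) (Var 0))
      (App (compT (App (shift 2 h) (Var 1)) (shift 2 f)) (Var 0))"
    by (rule Id_conv[OF t_Refl[OF gu] w2(2) e_sym[OF compT_beta[OF w2(1,3) ge2 w2(7)]]
      e_trans[OF e2 e_sym[OF compT_beta[OF w2(1) he2 w2(3,7)]]]])
  then have "\<exists>t. ?D \<turnstile> t \<Colon> Id (shift 1 (shift 1 Y))
     (App (shift 1 (compT (shift 1 f) (App (shift 1 g) (Var 0)))) (Var 0))
     (App (shift 1 (compT (App (shift 1 h) (Var 0)) (shift 1 f))) (Var 0))"
    by (auto simp: eval_nat_numeral)
  moreover have "?D \<turnstile> shift 1 (shift 1 Y) \<Colon> U" using w2(2) by (simp add: eval_nat_numeral)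
  ultimately have "\<exists>t. E # \<Gamma> \<turnstile> t \<Colon> Id (arr (shift 1 X) (shift 1 Y))
     (compT (shift 1 f) (App (shift 1 g) (Var 0))) (compT (App (shift 1 h) (Var 0)) (shift 1 f))"
    using compT_t[OF w(1,3) ge] compT_t[OF w(1) he w(3)] unfolding arr_def
    by (intro funext_inhabited[OF w(1)])
  then obtain t2 where "E # \<Gamma> \<turnstile> t2 \<Colon> Id (shift 1 (arr X Y))
     (compT (shift 1 f) (App (shift 1 g) (Var 0))) (compT (App (shift 1 h) (Var 0)) (shift 1 f))"
    by auto
  from t_Lam[OF E this] have "\<Gamma> \<turnstile> Pair (Refl y) (Lam t2) \<Colon> MorphList E X x g Y y h f"
    unfolding MorphList_def prodT_def
    by (intro t_Pair[OF M(1) wk1[OF M(2,1)] t1]) (simp_all only: sub_inst_shift shift_Univ)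
  then show ?thesis ..
qed

section \<open>The algebra formed by the lists themselves\<close>

lemma nilT_t: "\<lbrakk>\<Gamma> \<turnstile> E \<Colon> U; \<Gamma> \<turnstile> p0 \<Colon> NilLimT E\<rbrakk> \<Longrightarrow> \<Gamma> \<turnstile> nilT p0 \<Colon> ListT E"
  unfolding nilT_def NilLimT_def by (rule ListT_pair[OF _ nilStar_t])

lemma consT_lim:
  assumes E: "\<Gamma> \<turnstile> E \<Colon> U" and pc: "\<Gamma> \<turnstile> pc \<Colon> ConsLimT E" and e: "\<Gamma> \<turnstile> e \<Colon> E" and l: "\<Gamma> \<turnstile> l \<Colon> ListT E"
  shows "\<Gamma> \<turnstile> App (App pc e) l \<Colon> LimList E (consStar e (pi1 l))"
proof (rule t_App_eq)
  show "\<Gamma> \<turnstile> App pc e \<Colon> Pi (ListT E) (LimList (shift 1 E) (consStar (shift 1 e) (pi1 (Var 0))))"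
    by (rule t_App_eq[OF pc[unfolded ConsLimT_def] e]) (simp add: eval_nat_numeral)
qed (simp_all add: l)

lemma consT_t: "\<lbrakk>\<Gamma> \<turnstile> E \<Colon> U; \<Gamma> \<turnstile> pc \<Colon> ConsLimT E; \<Gamma> \<turnstile> e \<Colon> E; \<Gamma> \<turnstile> l \<Colon> ListT E\<rbrakk> \<Longrightarrow> \<Gamma> \<turnstile> consT pc e l \<Colon> ListT E"
  unfolding consT_def by (rule ListT_pair[OF _ consStar_t consT_lim]) (auto intro: ListT_pi1)

lemma lam2_t:
  assumes A: "\<Gamma> \<turnstile> A \<Colon> U" and B: "\<Gamma> \<turnstile> B \<Colon> U" and b: "shift 1 B # A # \<Gamma> \<turnstile> b \<Colon> shift 2 C"
  shows "\<Gamma> \<turnstile> Lam (Lam b) \<Colon> arr A (arr B C)"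
proof -
  have B1: "A # \<Gamma> \<turnstile> shift 1 B \<Colon> U" by (rule wk1[OF B A]) simp
  have "A # \<Gamma> \<turnstile> Lam b \<Colon> arr (shift 1 B) (shift 1 C)"
    by (rule lam_arr[OF B1]) (use b in \<open>simp add: eval_nat_numeral\<close>)
  then show ?thesis by (intro lam_arr[OF A]) simp
qed

text \<open>The body \<open>b1\<close> left after the first substitution has its own typing
  hypothesis, so at each use it can be typed directly from its shape.\<close>

lemma lam2_beta:
  assumes A: "\<Gamma> \<turnstile> A \<Colon> U" and B: "\<Gamma> \<turnstile> B \<Colon> U" and b: "shift 1 B # A # \<Gamma> \<turnstile> b \<Colon> shift 2 C"
    and a: "\<Gamma> \<turnstile> a \<Colon> A" and u: "\<Gamma> \<turnstile> u \<Colon> B"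
    and b1: "B # \<Gamma> \<turnstile> b1 \<Colon> shift 1 C" and b1_eq: "sub (up (a \<cdot> Var)) b = b1" and r: "inst b1 u = r"
  shows "\<Gamma> \<turnstile> App (App (Lam (Lam b)) a) u \<simeq> r \<Colon> C"
proof -
  have B1: "A # \<Gamma> \<turnstile> shift 1 B \<Colon> U" by (rule wk1[OF B A]) simp
  have l: "A # \<Gamma> \<turnstile> Lam b \<Colon> shift 1 (arr B C)"
    using lam_arr[OF B1, of b "shift 1 C"] b by (simp add: eval_nat_numeral)
  have "\<Gamma> \<turnstile> App (Lam (Lam b)) a \<simeq> Lam b1 \<Colon> arr B C"
    by (rule beta_eq[OF A l a]) (simp_all add: b1_eq)
  from app_arr_eq[OF this e_refl[OF u]] show ?thesis
    by (rule e_trans) (rule beta_eq[OF B b1 u], simp_all add: r)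
qed

text \<open>\<open>consT\<close> is a meta-level operation on terms; recursion and morphisms need an
  algebra operation that is itself a term.\<close>

definition consFun :: "tm \<Rightarrow> tm" where
  "consFun pc = Lam (Lam (consT (shift 2 pc) (Var 1) (Var 0)))"

lemma shift_consFun [simp]: "shift n (consFun pc) = consFun (shift n pc)"
proof -
  have "ren \<xi> (consFun pc) = consFun (ren \<xi> pc)" for \<xi> by (simp add: consFun_def eval_nat_numeral)
  then show ?thesis by (simp add: shift_def)
qed

lemma consFun_body:
  assumes E: "\<Gamma> \<turnstile> E \<Colon> U" and pc: "\<Gamma> \<turnstile> pc \<Colon> ConsLimT E"
  shows "shift 1 (ListT E) # E # \<Gamma> \<turnstile> consT (shift 2 pc) (Var 1) (Var 0) \<Colon> shift 2 (ListT E)"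
proof -
  have "E # \<Gamma> \<turnstile> shift 1 (ListT E) \<Colon> U" by (rule wk1[OF ListT_t[OF E] E]) simp
  then have c: "ctx (shift 1 (ListT E) # E # \<Gamma>)" using has_ctx ctx_Cons by meson
  have "shift 1 (ListT E) # E # \<Gamma> \<turnstile> consT (shift 2 pc) (Var 1) (Var 0) \<Colon> ListT (shift 2 E)"
    by (rule consT_t; (rule wkn[OF E c] wkn[OF pc c] t_Var_eq[OF c])) (simp_all add: eval_nat_numeral)
  then show ?thesis by simp
qed

lemma consFun_t: "\<lbrakk>\<Gamma> \<turnstile> E \<Colon> U; \<Gamma> \<turnstile> pc \<Colon> ConsLimT E\<rbrakk> \<Longrightarrow> \<Gamma> \<turnstile> consFun pc \<Colon> arr E (arr (ListT E) (ListT E))"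
  unfolding consFun_def by (rule lam2_t[OF _ ListT_t consFun_body])

lemma consFun_beta:
  assumes E: "\<Gamma> \<turnstile> E \<Colon> U" and pc: "\<Gamma> \<turnstile> pc \<Colon> ConsLimT E" and e: "\<Gamma> \<turnstile> e \<Colon> E" and l: "\<Gamma> \<turnstile> l \<Colon> ListT E"
  shows "\<Gamma> \<turnstile> App (App (consFun pc) e) l \<simeq> consT pc e l \<Colon> ListT E"
  unfolding consFun_def
proof (rule lam2_beta[OF E ListT_t[OF E] consFun_body[OF E pc] e l])
  note T = ListT_t[OF E]
  show "ListT E # \<Gamma> \<turnstile> consT (shift 1 pc) (shift 1 e) (Var 0) \<Colon> shift 1 (ListT E)"
    unfolding shift_homs
    by (rule consT_t; (rule wk1[OF E T] wk1[OF pc T] wk1[OF e T] var0[OF T])) simp_all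
qed (simp_all add: eval_nat_numeral)

section \<open>Recursion as a morphism out of the list algebra\<close>

text \<open>The evaluation map from \<open>List\<close> into the algebra \<open>(X, x, g)\<close>,
  internalised as a function so that it can occur in \<open>MorphList\<close>.\<close>

definition recFun :: "tm \<Rightarrow> tm \<Rightarrow> tm \<Rightarrow> tm" where
  "recFun X x g = Lam (recStar (shift 1 X) (shift 1 x) (shift 1 g) (pi1 (Var 0)))"

lemma shift_recFun [simp]: "shift n (recFun X x g) = recFun (shift n X) (shift n x) (shift n g)"
proof -
  have "ren \<xi> (recFun X x g) = recFun (ren \<xi> X) (ren \<xi> x) (ren \<xi> g)" for \<xi> by (simp add: recFun_def)
  then show ?thesis by (simp add: shift_def)
qed

lemma recFun_body:
  assumes E: "\<Gamma> \<turnstile> E \<Colon> U" and X: "\<Gamma> \<turnstile> X \<Colon> U" and x: "\<Gamma> \<turnstile> x \<Colon> X" and g: "\<Gamma> \<turnstile> g \<Colon> arr E (arr X X)"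
  shows "ListT E # \<Gamma> \<turnstile> recStar (shift 1 X) (shift 1 x) (shift 1 g) (pi1 (Var 0)) \<Colon> shift 1 X"
proof -
  note T = ListT_t[OF E]
  have E1: "ListT E # \<Gamma> \<turnstile> shift 1 E \<Colon> U" by (rule wk1[OF E T]) simp
  have v: "ListT E # \<Gamma> \<turnstile> Var 0 \<Colon> ListT (shift 1 E)" by (rule var0[OF T]) simp
  show ?thesis
    by (rule recStar_t[OF ListT_pi1[OF E1 v]]; (rule wk1[OF X T] wk1[OF x T] wk1[OF g T])) simp_all
qed

lemma recFun_t: "\<lbrakk>\<Gamma> \<turnstile> E \<Colon> U; \<Gamma> \<turnstile> X \<Colon> U; \<Gamma> \<turnstile> x \<Colon> X; \<Gamma> \<turnstile> g \<Colon> arr E (arr X X)\<rbrakk>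
    \<Longrightarrow> \<Gamma> \<turnstile> recFun X x g \<Colon> arr (ListT E) X"
  unfolding recFun_def by (rule lam_arr[OF ListT_t recFun_body])

lemma recFun_beta: "\<lbrakk>\<Gamma> \<turnstile> E \<Colon> U; \<Gamma> \<turnstile> X \<Colon> U; \<Gamma> \<turnstile> x \<Colon> X; \<Gamma> \<turnstile> g \<Colon> arr E (arr X X); \<Gamma> \<turnstile> l \<Colon> ListT E\<rbrakk>
    \<Longrightarrow> \<Gamma> \<turnstile> App (recFun X x g) l \<simeq> recStar X x g (pi1 l) \<Colon> X"
  unfolding recFun_def by (rule beta_eq[OF ListT_t recFun_body]) simp_all

lemma recFun_nilT:
  assumes E: "\<Gamma> \<turnstile> E \<Colon> U" and X: "\<Gamma> \<turnstile> X \<Colon> U" and x: "\<Gamma> \<turnstile> x \<Colon> X" and g: "\<Gamma> \<turnstile> g \<Colon> arr E (arr X X)"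
    and p0: "\<Gamma> \<turnstile> p0 \<Colon> NilLimT E"
  shows "\<Gamma> \<turnstile> App (recFun X x g) (nilT p0) \<simeq> x \<Colon> X"
proof -
  have "\<Gamma> \<turnstile> pi1 (nilT p0) \<simeq> nilStar \<Colon> ListStar E"
    using ListT_pi1_beta[OF E nilStar_t[OF E] p0[unfolded NilLimT_def]] by (simp add: nilT_def)
  from e_trans[OF recFun_beta[OF E X x g nilT_t[OF E p0]] recStar_eq[OF this X x g]]
  show ?thesis by (rule e_trans[OF _ nilStar_beta[OF E X x g]])
qed

text \<open>Both sides reduce to \<open>g e\<close> applied to the recursion on
  \<open>pi1 l\<close>: the left one by computing the first projection of the cons pair and
  unfolding \<open>consStar\<close>, the right one by a single beta step.\<close>

lemma recFun_consFun:
  assumes E: "\<Gamma> \<turnstile> E \<Colon> U" and X: "\<Gamma> \<turnstile> X \<Colon> U" and x: "\<Gamma> \<turnstile> x \<Colon> X" and g: "\<Gamma> \<turnstile> g \<Colon> arr E (arr X X)"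
    and pc: "\<Gamma> \<turnstile> pc \<Colon> ConsLimT E" and e: "\<Gamma> \<turnstile> e \<Colon> E" and l: "\<Gamma> \<turnstile> l \<Colon> ListT E"
  shows "\<Gamma> \<turnstile> App (recFun X x g) (App (App (consFun pc) e) l) \<simeq> App (App g e) (App (recFun X x g) l) \<Colon> X"
proof -
  note pl = ListT_pi1[OF E l]
  have "\<Gamma> \<turnstile> pi1 (consT pc e l) \<simeq> consStar e (pi1 l) \<Colon> ListStar E"
    using ListT_pi1_beta[OF E consStar_t[OF E e pl] consT_lim[OF E pc e l]] by (simp add: consT_def)
  note c = recStar_eq[OF this X x g]
  have 1: "\<Gamma> \<turnstile> App (recFun X x g) (App (App (consFun pc) e) l) \<simeq> App (recFun X x g) (consT pc e l) \<Colon> X"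
    by (rule app_arr_eq[OF e_refl[OF recFun_t[OF E X x g]] consFun_beta[OF E pc e l]])
  have 2: "\<Gamma> \<turnstile> App (App g e) (App (recFun X x g) l) \<simeq> App (App g e) (recStar X x g (pi1 l)) \<Colon> X"
    by (rule app_arr_eq[OF e_refl[OF app_arr[OF g e]] recFun_beta[OF E X x g l]])
  show ?thesis
    by (rule e_trans[OF 1 e_trans[OF recFun_beta[OF E X x g consT_t[OF E pc e l]]
      e_trans[OF c e_trans[OF consStar_beta[OF E X x g e pl] e_sym[OF 2]]]]])
qed

text \<open>Weakening into the context of a generic element and a generic point, where the second
  law of a morphism is checked.\<close>

lemma wk_pair_ctx:
  assumes E: "\<Gamma> \<turnstile> E \<Colon> U" and X: "\<Gamma> \<turnstile> X \<Colon> U"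
  defines "\<Delta> \<equiv> shift 1 X # E # \<Gamma>"
  shows "\<And>a A A'. \<Gamma> \<turnstile> a \<Colon> A \<Longrightarrow> A' = shift 2 A \<Longrightarrow> \<Delta> \<turnstile> shift 2 a \<Colon> A'"
    and "\<Delta> \<turnstile> Var 1 \<Colon> shift 2 E" and "\<And>X'. X' = shift 2 X \<Longrightarrow> \<Delta> \<turnstile> Var 0 \<Colon> X'"
proof -
  have "E # \<Gamma> \<turnstile> shift 1 X \<Colon> U" by (rule wk1[OF X E]) simp
  then have c: "ctx \<Delta>" unfolding \<Delta>_def using has_ctx ctx_Cons by meson
  show "\<And>a A A'. \<Gamma> \<turnstile> a \<Colon> A \<Longrightarrow> A' = shift 2 A \<Longrightarrow> \<Delta> \<turnstile> shift 2 a \<Colon> A'"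
    by (erule wkn[OF _ c]) (simp_all add: \<Delta>_def)
  show "\<Delta> \<turnstile> Var 1 \<Colon> shift 2 E" "\<And>X'. X' = shift 2 X \<Longrightarrow> \<Delta> \<turnstile> Var 0 \<Colon> X'"
    by (rule t_Var_eq[OF c]; simp add: \<Delta>_def eval_nat_numeral)+
qed

lemma recFun_morph:
  assumes E: "\<Gamma> \<turnstile> E \<Colon> U" and X: "\<Gamma> \<turnstile> X \<Colon> U" and x: "\<Gamma> \<turnstile> x \<Colon> X" and g: "\<Gamma> \<turnstile> g \<Colon> arr E (arr X X)"
    and p0: "\<Gamma> \<turnstile> p0 \<Colon> NilLimT E" and pc: "\<Gamma> \<turnstile> pc \<Colon> ConsLimT E"
  shows "\<exists>m. \<Gamma> \<turnstile> m \<Colon> MorphList E (ListT E) (nilT p0) (consFun pc) X x g (recFun X x g)"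
proof (rule MorphList_intro[OF E ListT_t[OF E] X nilT_t[OF E p0] x recFun_t[OF E X x g] consFun_t[OF E pc] g
      recFun_nilT[OF E X x g p0]])
  note w = wk_pair_ctx[OF E ListT_t[OF E]]
  let ?D = "shift 1 (ListT E) # E # \<Gamma>"
  have w2: "?D \<turnstile> shift 2 E \<Colon> U" "?D \<turnstile> shift 2 X \<Colon> U" "?D \<turnstile> shift 2 x \<Colon> shift 2 X"
    "?D \<turnstile> shift 2 g \<Colon> arr (shift 2 E) (arr (shift 2 X) (shift 2 X))" "?D \<turnstile> shift 2 pc \<Colon> ConsLimT (shift 2 E)"
    by (rule w(1)[OF E] w(1)[OF X] w(1)[OF x] w(1)[OF g] w(1)[OF pc]; simp)+
  from recFun_consFun[OF w2 w(2) w(3)[OF shift_homs(3)[symmetric]]]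
  show "?D \<turnstile> App (shift 2 (recFun X x g)) (App (App (shift 2 (consFun pc)) (Var 1)) (Var 0))
      \<simeq> App (App (shift 2 g) (Var 1)) (App (shift 2 (recFun X x g)) (Var 0)) \<Colon> shift 2 X"
    by simp
qed

section \<open>Rebuilding a list from its own constructors\<close>

text \<open>By impredicativity \<open>ListT E\<close> is small, so the limit condition of
  \<open>l\<close> may be instantiated at the list algebra as source and at \<open>recFun\<close> as
  morphism.\<close>

lemma recStar_recStar_consFun:
  assumes E: "\<Gamma> \<turnstile> E \<Colon> U" and X: "\<Gamma> \<turnstile> X \<Colon> U" and x: "\<Gamma> \<turnstile> x \<Colon> X" and g: "\<Gamma> \<turnstile> g \<Colon> arr E (arr X X)"
    and p0: "\<Gamma> \<turnstile> p0 \<Colon> NilLimT E" and pc: "\<Gamma> \<turnstile> pc \<Colon> ConsLimT E" and l: "\<Gamma> \<turnstile> l \<Colon> ListT E"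
  shows "\<exists>t. \<Gamma> \<turnstile> t \<Colon> Id X (recStar X x g (pi1 (recStar (ListT E) (nilT p0) (consFun pc) (pi1 l))))
    (recStar X x g (pi1 l))"
proof -
  note L = ListT_t[OF E] and n = nilT_t[OF E p0] and c = consFun_t[OF E pc]
  note k = recStar_t[OF ListT_pi1[OF E l] L n c]
  from recFun_morph[OF E X x g p0 pc] LimList_elim[OF ListT_pi2[OF E l] L X n x recFun_t[OF E X x g] c g]
  obtain t where "\<Gamma> \<turnstile> t \<Colon> Id X (App (recFun X x g) (recStar (ListT E) (nilT p0) (consFun pc) (pi1 l)))
      (recStar X x g (pi1 l))" by blast
  from Id_conv[OF this X recFun_beta[OF E X x g k] e_refl[OF recStar_t[OF ListT_pi1[OF E l] X x g]]]
  show ?thesis ..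
qed

text \<open>The rebuilt list and \<open>l\<close> give equal results in every algebra, hence have
  equal encodings by \<open>ListStar_ext\<close>, and \<open>ListT_ext\<close> lifts this to
  lists.\<close>

lemma recStar_consFun:
  assumes E: "\<Gamma> \<turnstile> E \<Colon> U" and p0: "\<Gamma> \<turnstile> p0 \<Colon> NilLimT E" and pc: "\<Gamma> \<turnstile> pc \<Colon> ConsLimT E" and l: "\<Gamma> \<turnstile> l \<Colon> ListT E"
  shows "\<exists>t. \<Gamma> \<turnstile> t \<Colon> Id (ListT E) (recStar (ListT E) (nilT p0) (consFun pc) (pi1 l)) l"
proof -
  note k = recStar_t[OF ListT_pi1[OF E l] ListT_t[OF E] nilT_t[OF E p0] consFun_t[OF E pc]]
  \<comment> \<open>A generic algebra: \<open>Var 2\<close>, \<open>Var 1\<close> and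
    \<open>Var 0\<close> are its carrier, point and operation.\<close>
  let ?D = "arr (shift 2 E) (arr (Var 1) (Var 1)) # Var 0 # U # \<Gamma>"
  note c = star_ctx(4)[OF E]
  have w: "?D \<turnstile> shift 3 E \<Colon> U" "?D \<turnstile> Var 2 \<Colon> U" "?D \<turnstile> Var 1 \<Colon> Var 2"
    "?D \<turnstile> Var 0 \<Colon> arr (shift 3 E) (arr (Var 2) (Var 2))"
    "?D \<turnstile> shift 3 p0 \<Colon> NilLimT (shift 3 E)" "?D \<turnstile> shift 3 pc \<Colon> ConsLimT (shift 3 E)"
    "?D \<turnstile> shift 3 l \<Colon> ListT (shift 3 E)"
    by ((rule wkn[OF E c] wkn[OF p0 c] wkn[OF pc c] wkn[OF l c] t_Var_eq[OF c]); simp add: eval_nat_numeral)+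
  have "\<exists>t. \<Gamma> \<turnstile> t \<Colon> Id (ListStar E) (pi1 (recStar (ListT E) (nilT p0) (consFun pc) (pi1 l))) (pi1 l)"
    by (rule ListStar_ext[OF E ListT_pi1[OF E k] ListT_pi1[OF E l]])
      (use recStar_recStar_consFun[OF w] in simp)
  then show ?thesis using ListT_ext[OF E k l] by blast
qed

section \<open>The total algebra of a predicate\<close>

text \<open>The total space of a predicate. It stays in \<open>U\<close>, as \<open>U\<close> is
  closed under \<open>Sig\<close>, so it can be the target of recursion.\<close>

definition compr :: "tm \<Rightarrow> tm \<Rightarrow> tm" where
  "compr A P = Sig A (App (shift 1 P) (Var 0))"

lemma shift_compr [simp]: "shift n (compr A P) = compr (shift n A) (shift n P)"
proof -
  have "ren \<xi> (compr A P) = compr (ren \<xi> A) (ren \<xi> P)" for \<xi> by (simp add: compr_def)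
  then show ?thesis by (simp add: shift_def)
qed

lemma compr_fam: "\<lbrakk>\<Gamma> \<turnstile> A \<Colon> U; \<Gamma> \<turnstile> P \<Colon> arr A U\<rbrakk> \<Longrightarrow> A # \<Gamma> \<turnstile> App (shift 1 P) (Var 0) \<Colon> U"
  by (rule app_arr, erule wk1, assumption, simp, erule var0, simp)

lemma compr_t: "\<lbrakk>\<Gamma> \<turnstile> A \<Colon> U; \<Gamma> \<turnstile> P \<Colon> arr A U\<rbrakk> \<Longrightarrow> \<Gamma> \<turnstile> compr A P \<Colon> U"
  unfolding compr_def by (rule t_Sig[OF _ compr_fam])

lemma compr_pair: "\<lbrakk>\<Gamma> \<turnstile> A \<Colon> U; \<Gamma> \<turnstile> P \<Colon> arr A U; \<Gamma> \<turnstile> a \<Colon> A; \<Gamma> \<turnstile> b \<Colon> App P a\<rbrakk> \<Longrightarrow> \<Gamma> \<turnstile> Pair a b \<Colon> compr A P"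
  unfolding compr_def by (rule t_Pair[OF _ compr_fam]) simp_all

lemma compr_pi1: "\<lbrakk>\<Gamma> \<turnstile> A \<Colon> U; \<Gamma> \<turnstile> P \<Colon> arr A U; \<Gamma> \<turnstile> p \<Colon> compr A P\<rbrakk> \<Longrightarrow> \<Gamma> \<turnstile> pi1 p \<Colon> A"
  unfolding compr_def by (rule pi1_t[OF _ compr_fam])

lemma compr_pi1_beta: "\<lbrakk>\<Gamma> \<turnstile> A \<Colon> U; \<Gamma> \<turnstile> P \<Colon> arr A U; \<Gamma> \<turnstile> a \<Colon> A; \<Gamma> \<turnstile> b \<Colon> App P a\<rbrakk> \<Longrightarrow> \<Gamma> \<turnstile> pi1 (Pair a b) \<simeq> a \<Colon> A"
  by (rule pi1_beta[OF _ compr_fam]) simp_all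

text \<open>The motive is \<open>P\<close> at the first projection. For a literal pair this converts
  to \<open>P\<close> at the first component, the type of the second.\<close>

lemma compr_pi2:
  assumes A: "\<Gamma> \<turnstile> A \<Colon> U" and P: "\<Gamma> \<turnstile> P \<Colon> arr A U" and p: "\<Gamma> \<turnstile> p \<Colon> compr A P"
  shows "\<Gamma> \<turnstile> pi2 p \<Colon> App P (pi1 p)"
proof -
  note F = compr_fam[OF A P] and S = compr_t[OF A P]
  have w: "compr A P # \<Gamma> \<turnstile> shift 1 A \<Colon> U" "compr A P # \<Gamma> \<turnstile> shift 1 P \<Colon> arr (shift 1 A) U"
    "compr A P # \<Gamma> \<turnstile> Var 0 \<Colon> compr (shift 1 A) (shift 1 P)"
    by (rule wk1[OF A S] wk1[OF P S] var0[OF S]; simp)+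
  have C: "compr A P # \<Gamma> \<turnstile> App (shift 1 P) (pi1 (Var 0)) \<Colon> U"
    by (rule app_arr[OF w(2) compr_pi1[OF w]])
  let ?D = "App (shift 1 P) (Var 0) # A # \<Gamma>"
  have c: "ctx ?D" using F has_ctx ctx_Cons by meson
  have w2: "?D \<turnstile> shift 2 A \<Colon> U" "?D \<turnstile> shift 2 P \<Colon> arr (shift 2 A) U" "?D \<turnstile> Var 1 \<Colon> shift 2 A"
    "?D \<turnstile> Var 0 \<Colon> App (shift 2 P) (Var 1)"
    by ((rule wkn[OF A c] wkn[OF P c] t_Var_eq[OF c]); simp add: eval_nat_numeral)+
  have "?D \<turnstile> Var 0 \<Colon> App (shift 2 P) (pi1 (Pair (Var 1) (Var 0)))"
    by (rule t_Conv[OF w2(4) app_arr_eq[OF e_refl[OF w2(2)] e_sym[OF compr_pi1_beta[OF w2]]]])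
  then have d: "?D \<turnstile> Var 0 \<Colon> sub (Pair (Var 1) (Var 0) \<cdot> (\<lambda>k. Var (k + 2))) (App (shift 1 P) (pi1 (Var 0)))"
    by simp
  show ?thesis
    using t_Split[OF A F C[unfolded compr_def] p[unfolded compr_def] d] by (simp add: pi2_def)
qed

text \<open>The projection as an internal function. Abstractions are unannotated, so one closed term
  serves every total space.\<close>

definition pi1Fun :: tm where
  "pi1Fun = Lam (pi1 (Var 0))"

lemma shift_pi1Fun [simp]: "shift n pi1Fun = pi1Fun"
  by (simp add: pi1Fun_def shift_def)

lemma pi1Fun_body:
  assumes A: "\<Gamma> \<turnstile> A \<Colon> U" and P: "\<Gamma> \<turnstile> P \<Colon> arr A U"
  shows "compr A P # \<Gamma> \<turnstile> pi1 (Var 0) \<Colon> shift 1 A"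
proof -
  note S = compr_t[OF A P]
  show ?thesis
    by (rule compr_pi1[where P = "shift 1 P"]; (rule wk1[OF A S] wk1[OF P S] var0[OF S])) simp_all
qed

lemma pi1Fun_t: "\<lbrakk>\<Gamma> \<turnstile> A \<Colon> U; \<Gamma> \<turnstile> P \<Colon> arr A U\<rbrakk> \<Longrightarrow> \<Gamma> \<turnstile> pi1Fun \<Colon> arr (compr A P) A"
  unfolding pi1Fun_def by (rule lam_arr[OF compr_t pi1Fun_body])

lemma pi1Fun_beta: "\<lbrakk>\<Gamma> \<turnstile> A \<Colon> U; \<Gamma> \<turnstile> P \<Colon> arr A U; \<Gamma> \<turnstile> p \<Colon> compr A P\<rbrakk> \<Longrightarrow> \<Gamma> \<turnstile> App pi1Fun p \<simeq> pi1 p \<Colon> A"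
  unfolding pi1Fun_def by (rule beta_eq[OF compr_t pi1Fun_body]) simp_all

text \<open>The inductive step inside \<open>ListIndT\<close>, named so that weakening can act on it
  as a unit. The list is bound before the element, the reverse of \<open>consFun\<close>.\<close>

definition IndStepT :: "tm \<Rightarrow> tm \<Rightarrow> tm \<Rightarrow> tm" where
  "IndStepT E pc P = Pi (ListT E) (Pi (shift 1 E)
     (arr (App (shift 2 P) (Var 1)) (App (shift 2 P) (consT (shift 2 pc) (Var 0) (Var 1)))))"

lemma shift_IndStepT [simp]: "shift n (IndStepT E pc P) = IndStepT (shift n E) (shift n pc) (shift n P)"
proof -
  have "ren \<xi> (IndStepT E pc P) = IndStepT (ren \<xi> E) (ren \<xi> pc) (ren \<xi> P)" for \<xi>
    by (simp add: IndStepT_def eval_nat_numeral)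
  then show ?thesis by (simp add: shift_def)
qed

lemma IndStepT_elim:
  assumes s: "\<Gamma> \<turnstile> s \<Colon> IndStepT E pc P" and l: "\<Gamma> \<turnstile> l \<Colon> ListT E" and e: "\<Gamma> \<turnstile> e \<Colon> E" and w: "\<Gamma> \<turnstile> w \<Colon> App P l"
  shows "\<Gamma> \<turnstile> App (App (App s l) e) w \<Colon> App P (consT pc e l)"
proof (rule app_arr[OF _ w], rule t_App_eq[OF _ e])
  show "\<Gamma> \<turnstile> App s l \<Colon> Pi E (arr (App (shift 1 P) (shift 1 l)) (App (shift 1 P) (consT (shift 1 pc) (Var 0) (shift 1 l))))"
    by (rule t_App_eq[OF s[unfolded IndStepT_def] l]) (simp add: eval_nat_numeral)
qed simp

text \<open>The cons operation of the total algebra: \<open>cons\<close> on first components, with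
  the inductive step \<open>s\<close> supplying the new proof from the old one.\<close>

definition stepFun :: "tm \<Rightarrow> tm \<Rightarrow> tm" where
  "stepFun pc s = Lam (Lam (Pair (consT (shift 2 pc) (Var 1) (pi1 (Var 0)))
     (App (App (App (shift 2 s) (pi1 (Var 0))) (Var 1)) (pi2 (Var 0)))))"

lemma shift_stepFun [simp]: "shift n (stepFun pc s) = stepFun (shift n pc) (shift n s)"
proof -
  have "ren \<xi> (stepFun pc s) = stepFun (ren \<xi> pc) (ren \<xi> s)" for \<xi> by (simp add: stepFun_def eval_nat_numeral)
  then show ?thesis by (simp add: shift_def)
qed

text \<open>Stated for an arbitrary \<open>p\<close>, so that it types both the body under its
  binders and the result of applying \<open>stepFun\<close>.\<close>

lemma stepFun_pair:
  assumes E: "\<Gamma> \<turnstile> E \<Colon> U" and pc: "\<Gamma> \<turnstile> pc \<Colon> ConsLimT E" and P: "\<Gamma> \<turnstile> P \<Colon> arr (ListT E) U"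
    and s: "\<Gamma> \<turnstile> s \<Colon> IndStepT E pc P" and e: "\<Gamma> \<turnstile> e \<Colon> E" and p: "\<Gamma> \<turnstile> p \<Colon> compr (ListT E) P"
  shows "\<Gamma> \<turnstile> Pair (consT pc e (pi1 p)) (App (App (App s (pi1 p)) e) (pi2 p)) \<Colon> compr (ListT E) P"
    and "\<Gamma> \<turnstile> pi1 (Pair (consT pc e (pi1 p)) (App (App (App s (pi1 p)) e) (pi2 p))) \<simeq> consT pc e (pi1 p) \<Colon> ListT E"
proof -
  note L = ListT_t[OF E]
  note p1 = compr_pi1[OF L P p] and p2 = compr_pi2[OF L P p]
  note c = consT_t[OF E pc e p1] and i = IndStepT_elim[OF s p1 e p2]
  show "\<Gamma> \<turnstile> Pair (consT pc e (pi1 p)) (App (App (App s (pi1 p)) e) (pi2 p)) \<Colon> compr (ListT E) P"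
    by (rule compr_pair[OF L P c i])
  show "\<Gamma> \<turnstile> pi1 (Pair (consT pc e (pi1 p)) (App (App (App s (pi1 p)) e) (pi2 p))) \<simeq> consT pc e (pi1 p) \<Colon> ListT E"
    by (rule compr_pi1_beta[OF L P c i])
qed

lemma stepFun_body:
  assumes E: "\<Gamma> \<turnstile> E \<Colon> U" and pc: "\<Gamma> \<turnstile> pc \<Colon> ConsLimT E" and P: "\<Gamma> \<turnstile> P \<Colon> arr (ListT E) U"
    and s: "\<Gamma> \<turnstile> s \<Colon> IndStepT E pc P"
  shows "shift 1 (compr (ListT E) P) # E # \<Gamma> \<turnstile> Pair (consT (shift 2 pc) (Var 1) (pi1 (Var 0)))
     (App (App (App (shift 2 s) (pi1 (Var 0))) (Var 1)) (pi2 (Var 0))) \<Colon> shift 2 (compr (ListT E) P)"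
proof -
  note w = wk_pair_ctx[OF E compr_t[OF ListT_t[OF E] P]]
  let ?D = "shift 1 (compr (ListT E) P) # E # \<Gamma>"
  have w2: "?D \<turnstile> shift 2 E \<Colon> U" "?D \<turnstile> shift 2 pc \<Colon> ConsLimT (shift 2 E)"
    "?D \<turnstile> shift 2 P \<Colon> arr (ListT (shift 2 E)) U" "?D \<turnstile> shift 2 s \<Colon> IndStepT (shift 2 E) (shift 2 pc) (shift 2 P)"
    "?D \<turnstile> Var 0 \<Colon> compr (ListT (shift 2 E)) (shift 2 P)"
    by (rule w(1)[OF E] w(1)[OF pc] w(1)[OF P] w(1)[OF s] w(3); simp)+
  from stepFun_pair(1)[OF w2(1-4) w(2) w2(5)] show ?thesis by simp
qed

lemma stepFun_t: "\<lbrakk>\<Gamma> \<turnstile> E \<Colon> U; \<Gamma> \<turnstile> pc \<Colon> ConsLimT E; \<Gamma> \<turnstile> P \<Colon> arr (ListT E) U; \<Gamma> \<turnstile> s \<Colon> IndStepT E pc P\<rbrakk>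
    \<Longrightarrow> \<Gamma> \<turnstile> stepFun pc s \<Colon> arr E (arr (compr (ListT E) P) (compr (ListT E) P))"
  unfolding stepFun_def by (rule lam2_t[OF _ compr_t[OF ListT_t] stepFun_body])

lemma stepFun_beta:
  assumes E: "\<Gamma> \<turnstile> E \<Colon> U" and pc: "\<Gamma> \<turnstile> pc \<Colon> ConsLimT E" and P: "\<Gamma> \<turnstile> P \<Colon> arr (ListT E) U"
    and s: "\<Gamma> \<turnstile> s \<Colon> IndStepT E pc P" and e: "\<Gamma> \<turnstile> e \<Colon> E" and p: "\<Gamma> \<turnstile> p \<Colon> compr (ListT E) P"
  shows "\<Gamma> \<turnstile> App (App (stepFun pc s) e) p \<simeq>
    Pair (consT pc e (pi1 p)) (App (App (App s (pi1 p)) e) (pi2 p)) \<Colon> compr (ListT E) P"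
  unfolding stepFun_def
proof (rule lam2_beta[OF E compr_t[OF ListT_t[OF E] P] stepFun_body[OF assms(1-4)] e p])
  note T = compr_t[OF ListT_t[OF E] P]
  have w: "compr (ListT E) P # \<Gamma> \<turnstile> shift 1 E \<Colon> U" "compr (ListT E) P # \<Gamma> \<turnstile> shift 1 pc \<Colon> ConsLimT (shift 1 E)"
    "compr (ListT E) P # \<Gamma> \<turnstile> shift 1 P \<Colon> arr (ListT (shift 1 E)) U"
    "compr (ListT E) P # \<Gamma> \<turnstile> shift 1 s \<Colon> IndStepT (shift 1 E) (shift 1 pc) (shift 1 P)"
    "compr (ListT E) P # \<Gamma> \<turnstile> shift 1 e \<Colon> shift 1 E"
    "compr (ListT E) P # \<Gamma> \<turnstile> Var 0 \<Colon> compr (ListT (shift 1 E)) (shift 1 P)"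
    by (rule wk1[OF E T] wk1[OF pc T] wk1[OF P T] wk1[OF s T] wk1[OF e T] var0[OF T]; simp)+
  from stepFun_pair(1)[OF w] show "compr (ListT E) P # \<Gamma> \<turnstile> Pair (consT (shift 1 pc) (shift 1 e) (pi1 (Var 0)))
    (App (App (App (shift 1 s) (pi1 (Var 0))) (shift 1 e)) (pi2 (Var 0))) \<Colon> shift 1 (compr (ListT E) P)"
    by simp
qed (simp_all add: eval_nat_numeral)

text \<open>Both sides reduce to \<open>consT pc e (pi1 p)\<close>, so the projection respects cons
  judgementally.\<close>

lemma pi1Fun_stepFun:
  assumes E: "\<Gamma> \<turnstile> E \<Colon> U" and pc: "\<Gamma> \<turnstile> pc \<Colon> ConsLimT E" and P: "\<Gamma> \<turnstile> P \<Colon> arr (ListT E) U"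
    and s: "\<Gamma> \<turnstile> s \<Colon> IndStepT E pc P" and e: "\<Gamma> \<turnstile> e \<Colon> E" and p: "\<Gamma> \<turnstile> p \<Colon> compr (ListT E) P"
  shows "\<Gamma> \<turnstile> App pi1Fun (App (App (stepFun pc s) e) p) \<simeq> App (App (consFun pc) e) (App pi1Fun p) \<Colon> ListT E"
proof -
  note L = ListT_t[OF E]
  note f = pi1Fun_t[OF L P] and c = consFun_t[OF E pc]
  have 1: "\<Gamma> \<turnstile> App (App (consFun pc) e) (App pi1Fun p) \<simeq> App (App (consFun pc) e) (pi1 p) \<Colon> ListT E"
    by (rule app_arr_eq[OF e_refl[OF app_arr[OF c e]] pi1Fun_beta[OF L P p]])
  note 2 = e_trans[OF 1 consFun_beta[OF E pc e compr_pi1[OF L P p]]]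
  note 3 = e_trans[OF app_arr_eq[OF e_refl[OF f] stepFun_beta[OF assms]] pi1Fun_beta[OF L P stepFun_pair(1)[OF assms]]]
  show ?thesis by (rule e_trans[OF e_trans[OF 3 stepFun_pair(2)[OF assms]] e_sym[OF 2]])
qed

text \<open>The premises of induction enter here: \<open>z\<close> supplies the point of the total
  algebra and \<open>s\<close> its operation. Both laws of the projection are judgemental.\<close>

lemma pi1Fun_morph:
  assumes E: "\<Gamma> \<turnstile> E \<Colon> U" and p0: "\<Gamma> \<turnstile> p0 \<Colon> NilLimT E" and pc: "\<Gamma> \<turnstile> pc \<Colon> ConsLimT E"
    and P: "\<Gamma> \<turnstile> P \<Colon> arr (ListT E) U" and z: "\<Gamma> \<turnstile> z \<Colon> App P (nilT p0)" and s: "\<Gamma> \<turnstile> s \<Colon> IndStepT E pc P"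
  shows "\<exists>m. \<Gamma> \<turnstile> m \<Colon> MorphList E (compr (ListT E) P) (Pair (nilT p0) z) (stepFun pc s)
    (ListT E) (nilT p0) (consFun pc) pi1Fun"
proof -
  note L = ListT_t[OF E] and n = nilT_t[OF E p0]
  note T = compr_t[OF L P] and zz = compr_pair[OF L P n z]
  note w = wk_pair_ctx[OF E T]
  let ?D = "shift 1 (compr (ListT E) P) # E # \<Gamma>"
  have w2: "?D \<turnstile> shift 2 E \<Colon> U" "?D \<turnstile> shift 2 pc \<Colon> ConsLimT (shift 2 E)"
    "?D \<turnstile> shift 2 P \<Colon> arr (ListT (shift 2 E)) U" "?D \<turnstile> shift 2 s \<Colon> IndStepT (shift 2 E) (shift 2 pc) (shift 2 P)"
    "?D \<turnstile> Var 0 \<Colon> compr (ListT (shift 2 E)) (shift 2 P)"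
    by (rule w(1)[OF E] w(1)[OF pc] w(1)[OF P] w(1)[OF s] w(3); simp)+
  show ?thesis
  proof (rule MorphList_intro[OF E T L zz n pi1Fun_t[OF L P] stepFun_t[OF E pc P s] consFun_t[OF E pc]])
    show "\<Gamma> \<turnstile> App pi1Fun (Pair (nilT p0) z) \<simeq> nilT p0 \<Colon> ListT E"
      by (rule e_trans[OF pi1Fun_beta[OF L P zz] compr_pi1_beta[OF L P n z]])
    from pi1Fun_stepFun[OF w2(1-4) w(2) w2(5)]
    show "?D \<turnstile> App (shift 2 pi1Fun) (App (App (shift 2 (stepFun pc s)) (Var 1)) (Var 0))
        \<simeq> App (App (shift 2 (consFun pc)) (Var 1)) (App (shift 2 pi1Fun) (Var 0)) \<Colon> shift 2 (ListT E)"
      by simp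
  qed
qed

section \<open>The induction principle\<close>

lemma list_induct_inhabited:
  assumes E: "\<Gamma> \<turnstile> E \<Colon> U" and p0: "\<Gamma> \<turnstile> p0 \<Colon> NilLimT E" and pc: "\<Gamma> \<turnstile> pc \<Colon> ConsLimT E"
    and P: "\<Gamma> \<turnstile> P \<Colon> arr (ListT E) U" and z: "\<Gamma> \<turnstile> z \<Colon> App P (nilT p0)" and s: "\<Gamma> \<turnstile> s \<Colon> IndStepT E pc P"
    and l: "\<Gamma> \<turnstile> l \<Colon> ListT E"
  shows "\<exists>t. \<Gamma> \<turnstile> t \<Colon> App P l"
proof -
  note L = ListT_t[OF E] and n = nilT_t[OF E p0] and c = consFun_t[OF E pc]
  note T = compr_t[OF L P] and zz = compr_pair[OF L P n z] and ss = stepFun_t[OF E pc P s]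
  note pl = ListT_pi1[OF E l]
  let ?r = "recStar (compr (ListT E) P) (Pair (nilT p0) z) (stepFun pc s) (pi1 l)"
  let ?k = "recStar (ListT E) (nilT p0) (consFun pc) (pi1 l)"
  note r = recStar_t[OF pl T zz ss] and k = recStar_t[OF pl L n c]
  \<comment> \<open>The limit condition of \<open>l\<close> for the projection compares recursion
    into the total algebra with recursion into the lists.\<close>
  from pi1Fun_morph[OF E p0 pc P z s] LimList_elim[OF ListT_pi2[OF E l] T L zz n pi1Fun_t[OF L P] ss c]
  obtain t where "\<Gamma> \<turnstile> t \<Colon> Id (ListT E) (App pi1Fun ?r) ?k" by blast
  note t = Id_conv[OF this L pi1Fun_beta[OF L P r] e_refl[OF k]]
  obtain q where "\<Gamma> \<turnstile> q \<Colon> Id (ListT E) ?k l" using recStar_consFun[OF E p0 pc l] by blast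
  from Id_trans_inhabited[OF L compr_pi1[OF L P r] k l t this]
  \<comment> \<open>The second projection of \<open>?r\<close> proves \<open>P\<close> at its first
    projection, which is now identified with \<open>l\<close>.\<close>
  show ?thesis using Id_subst_App[OF L P compr_pi1[OF L P r] l _ compr_pi2[OF L P r]] by blast
qed

text \<open>The step hypothesis must be a type before it can be abstracted over.\<close>

lemma IndStepT_t:
  assumes E: "\<Gamma> \<turnstile> E \<Colon> U" and pc: "\<Gamma> \<turnstile> pc \<Colon> ConsLimT E" and P: "\<Gamma> \<turnstile> P \<Colon> arr (ListT E) U"
  shows "\<Gamma> \<turnstile> IndStepT E pc P \<Colon> U"
proof -
  note L = ListT_t[OF E]
  have E1: "ListT E # \<Gamma> \<turnstile> shift 1 E \<Colon> U" by (rule wk1[OF E L]) simp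
  let ?D = "shift 1 E # ListT E # \<Gamma>"
  have c: "ctx ?D" using E1 has_ctx ctx_Cons by meson
  have w: "?D \<turnstile> shift 2 E \<Colon> U" "?D \<turnstile> shift 2 pc \<Colon> ConsLimT (shift 2 E)" "?D \<turnstile> shift 2 P \<Colon> arr (ListT (shift 2 E)) U"
    "?D \<turnstile> Var 0 \<Colon> shift 2 E" "?D \<turnstile> Var 1 \<Colon> ListT (shift 2 E)"
    by ((rule wkn[OF E c] wkn[OF P c] wkn[OF pc c] t_Var_eq[OF c]); simp add: eval_nat_numeral)+
  show ?thesis unfolding IndStepT_def
    by (rule t_Pi[OF L] t_Pi[OF E1] arr_U app_arr[OF w(3)] consT_t[OF w(1,2,4,5)] w(5))+
qed

lemma ListIndT_inhabited:
  assumes E: "\<Gamma> \<turnstile> E \<Colon> U" and p0: "\<Gamma> \<turnstile> p0 \<Colon> NilLimT E" and pc: "\<Gamma> \<turnstile> pc \<Colon> ConsLimT E"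
    and P: "\<Gamma> \<turnstile> P \<Colon> arr (ListT E) U"
  shows "\<exists>t. \<Gamma> \<turnstile> t \<Colon> ListIndT E p0 pc P"
proof -
  note L = ListT_t[OF E]
  note Z = app_arr[OF P nilT_t[OF E p0]] and S = IndStepT_t[OF E pc P]
  have S1: "App P (nilT p0) # \<Gamma> \<turnstile> shift 1 (IndStepT E pc P) \<Colon> U" by (rule wk1[OF S Z]) simp
  have c2: "ctx (shift 1 (IndStepT E pc P) # App P (nilT p0) # \<Gamma>)" using S1 has_ctx ctx_Cons by meson
  have L2: "shift 1 (IndStepT E pc P) # App P (nilT p0) # \<Gamma> \<turnstile> shift 2 (ListT E) \<Colon> U"
    by (rule wkn[OF L c2]) simp_all
  let ?D = "shift 2 (ListT E) # shift 1 (IndStepT E pc P) # App P (nilT p0) # \<Gamma>"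
  have c: "ctx ?D" using L2 has_ctx ctx_Cons by meson
  \<comment> \<open>In \<open>?D\<close>, \<open>Var 2\<close> is the nil case, \<open>Var 1\<close>
    the inductive step and \<open>Var 0\<close> the list.\<close>
  have w: "?D \<turnstile> shift 3 E \<Colon> U" "?D \<turnstile> shift 3 p0 \<Colon> NilLimT (shift 3 E)" "?D \<turnstile> shift 3 pc \<Colon> ConsLimT (shift 3 E)"
    "?D \<turnstile> shift 3 P \<Colon> arr (ListT (shift 3 E)) U"
    "?D \<turnstile> Var 2 \<Colon> App (shift 3 P) (nilT (shift 3 p0))"
    "?D \<turnstile> Var 1 \<Colon> IndStepT (shift 3 E) (shift 3 pc) (shift 3 P)" "?D \<turnstile> Var 0 \<Colon> ListT (shift 3 E)"
    by ((rule wkn[OF E c] wkn[OF p0 c] wkn[OF P c] wkn[OF pc c] t_Var_eq[OF c]); simp add: eval_nat_numeral)+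
  obtain t where "?D \<turnstile> t \<Colon> App (shift 3 P) (Var 0)" using list_induct_inhabited[OF w] by blast
  from t_Lam[OF L2 this]
  have "App P (nilT p0) # \<Gamma> \<turnstile> Lam (Lam t) \<Colon> arr (shift 1 (IndStepT E pc P)) (Pi (shift 1 (ListT E)) (App (shift 2 P) (Var 0)))"
    \<comment> \<open>Weakening crosses the binder of the final product: its bound variable stays
      fixed while \<open>P\<close> is shifted.\<close>
    by (intro lam_arr[OF S1]) (simp add: shift_def ren_ren comp_def eval_nat_numeral)
  then have "\<Gamma> \<turnstile> Lam (Lam (Lam t)) \<Colon> arr (App P (nilT p0)) (arr (IndStepT E pc P) (Pi (ListT E) (App (shift 1 P) (Var 0))))"
    by (intro lam_arr[OF Z]) (simp add: shift_def ren_ren comp_def eval_nat_numeral)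
  then show ?thesis unfolding ListIndT_def IndStepT_def by blast
qed

theorem theorem4p4p4:
  shows "\<exists>t. [] \<turnstile> t \<Colon>
    Pi U (Pi (NilLimT (Var 0)) (Pi (ConsLimT (Var 1))
      (Pi (arr (ListT (Var 2)) U) (ListIndT (Var 3) (Var 2) (Var 1) (Var 0)))))"
proof -
  have T0: "[] \<turnstile> U \<Colon> Univ (Suc 0)" by (rule t_Univ[OF ctx_Nil])
  have E: "[U] \<turnstile> Var 0 \<Colon> U" by (rule var0[OF T0]) simp
  have T1: "[U] \<turnstile> NilLimT (Var 0) \<Colon> U"
    unfolding NilLimT_def by (rule LimList_t[OF E nilStar_t[OF E]])
  let ?G2 = "[NilLimT (Var 0), U]"
  have E2: "?G2 \<turnstile> Var 1 \<Colon> U" using wk1[OF E T1] by simp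
  have T2: "?G2 \<turnstile> ConsLimT (Var 1) \<Colon> U"
  proof -
    have E1: "Var 1 # ?G2 \<turnstile> shift 1 (Var 1) \<Colon> U" by (rule wk1[OF E2 E2]) simp
    have L: "Var 1 # ?G2 \<turnstile> shift 1 (ListT (Var 1)) \<Colon> U" using ListT_t[OF E1] by simp
    have c: "ctx (shift 1 (ListT (Var 1)) # Var 1 # ?G2)" using L has_ctx ctx_Cons by meson
    have w: "shift 1 (ListT (Var 1)) # Var 1 # ?G2 \<turnstile> shift 2 (Var 1) \<Colon> U"
      "shift 1 (ListT (Var 1)) # Var 1 # ?G2 \<turnstile> Var 1 \<Colon> shift 2 (Var 1)"
      "shift 1 (ListT (Var 1)) # Var 1 # ?G2 \<turnstile> Var 0 \<Colon> ListT (shift 2 (Var 1))"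
      by ((rule wkn[OF E2 c] t_Var_eq[OF c]); simp add: eval_nat_numeral)+
    show ?thesis unfolding ConsLimT_def
      by (rule t_Pi[OF E2 t_Pi[OF L LimList_t[OF w(1) consStar_t[OF w(1,2) ListT_pi1[OF w(1,3)]]]]])
  qed
  let ?G3 = "ConsLimT (Var 1) # ?G2"
  have E3: "?G3 \<turnstile> Var 2 \<Colon> U" using wk1[OF E2 T2] by (simp add: eval_nat_numeral)
  note c3 = has_ctx(2)[OF E3]
  \<comment> \<open>The type of predicates mentions \<open>U\<close> as codomain and so is formed
    one level up; \<open>ListT\<close> is raised there by cumulativity.\<close>
  have T3: "?G3 \<turnstile> arr (ListT (Var 2)) U \<Colon> Univ (Suc 0)"
    unfolding arr_def
  proof (rule t_Pi)
    show L: "?G3 \<turnstile> ListT (Var 2) \<Colon> Univ (Suc 0)" by (rule t_Cumul[OF ListT_t[OF E3]])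
    show "ListT (Var 2) # ?G3 \<turnstile> shift 1 U \<Colon> Univ (Suc 0)" using t_Univ[OF ctx_Cons[OF c3 L]] by simp
  qed
  let ?G4 = "arr (ListT (Var 2)) U # ?G3"
  note c4 = ctx_Cons[OF c3 T3]
  \<comment> \<open>In \<open>?G4\<close> the variables 3, 2, 1 and 0 are \<open>E\<close>, the two
    limit proofs and the predicate.\<close>
  have "\<exists>t. ?G4 \<turnstile> t \<Colon> ListIndT (Var 3) (Var 2) (Var 1) (Var 0)"
    by (rule ListIndT_inhabited; rule t_Var_eq[OF c4]) (simp_all add: eval_nat_numeral)
  then show ?thesis by (meson t_Lam T0 T1 T2 T3)
qed

end
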